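(* Let $k$ be an algebraically closed field of characteristic zero, $\mathfrak{g}$ a finite-dimensional simple Lie algebra over $k$ with a fixed Cartan subalgebra $\mathfrak{h}$, and $S$ a commutative, associative, unital $k$-algebra of finite type. Let $V(\underline{M},\underline{W})$ be a simple evaluation weight module for $\mathfrak{g}\otimes_k S$, where $\underline{W}=(W_1,\ldots,W_\ell)$. Then $V(\underline{M},\underline{W})$ is admissible if and only if each of the $W_i$ is admissible and at most one of the $W_i$ is infinite dimensional.
   Context: The Lie bracket on $\mathcal{L}=\mathfrak{g}\otimes S$ is $[x\otimes r,y\otimes s]=[x,y]\otimes rs$. An $\mathcal{L}$-module $V$ is a weight module if $V=\bigoplus_{\lambda\in\mathfrak{h}^*}V_\lambda$ with each weight space $V_\lambda=\{v\in V\mid (h\otimes 1)v=\lambda(h)v\text{ for all }h\in\mathfrak{h}\}$ finite dimensional. A weight module is admissible if there is $B\in\mathbb{Z}_{>0}$ with $\dim V_\lambda\le B$ for all $\lambda$. For $\mathfrak{g}$-modules the same definitions are used (the case $S=k$). For $s\in S$ and a maximal ideal $M$ of $S$, $s(M)\in k$ is the residue of $s$ in $S/M\cong k$. Given maximal ideals $\underline{M}=(M_1,\ldots,M_\ell)$ of $S$ and simple $\mathfrak{g}$-modules $\underline{W}=(W_1,\ldots,W_\ell)$, $V(\underline{M},\underline{W})$ is the vector space $W_1\otimes\cdots\otimes W_\ell$ with $\mathcal{L}$-action $(x\otimes s).(w_1\otimes\cdots\otimes w_\ell)=\sum_{i=1}^\ell s(M_i)\,w_1\otimes\cdots\otimes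 xw_i\otimes\cdots\otimes w_\ell$. It is called an evaluation weight module if $M_1,\ldots,M_\ell$ are distinct and each (simple) $W_i$ is a weight module for $\mathfrak{g}$. (An evaluation weight module may have infinite-dimensional weight spaces, in which case it is not a weight module for $\mathcal{L}$, and so not admissible.) *)

theory Defs
  imports
    "HOL-Computational_Algebra.Polynomial"
    "HOL-Library.Poly_Mapping"
    "HOL-Library.FuncSet"
begin

section \<open>Vector spaces\<close>

text \<open>
  A vector space is a subspace of an ambient type that carries a \<^locale>\<open>vector_space\<close>
  structure. Since \<^const>\<open>vector_space.dim\<close> is 0 on infinite-dimensional subspaces, bounds on
  \<open>dim\<close> always come together with \<open>fin_dim\<close>.
\<close>

definition fin_dim :: "('k::field \<Rightarrow> 'v::ab_group_add \<Rightarrow> 'v) \<Rightarrow> 'v set \<Rightarrow> bool" where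
  "fin_dim sc U \<longleftrightarrow> (\<exists>B. finite B \<and> U \<subseteq> module.span sc B)"

definition internal_direct_sum ::
    "('k::field \<Rightarrow> 'v::ab_group_add \<Rightarrow> 'v) \<Rightarrow> 'i set \<Rightarrow> ('i \<Rightarrow> 'v set) \<Rightarrow> 'v set \<Rightarrow> bool" where
  "internal_direct_sum sc I X V \<longleftrightarrow>
     (\<forall>i\<in>I. module.subspace sc (X i)) \<and>
     module.span sc (\<Union>i\<in>I. X i) = V \<and>
     (\<forall>F f. finite F \<and> F \<subseteq> I \<and> (\<forall>i\<in>F. f i \<in> X i) \<and> (\<Sum>i\<in>F. f i) = 0 \<longrightarrow> (\<forall>i\<in>F. f i = 0))"


section \<open>Tensor products\<close>

text \<open>
  The type \<open>'x \<Rightarrow>\<^sub>0 'k\<close> of finitely supported functions is the free vector space on \<open>'x\<close>,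
  with basis vectors \<open>Poly_Mapping.single x 1\<close>.
\<close>

definition free_scale :: "'k::field \<Rightarrow> ('x \<Rightarrow>\<^sub>0 'k) \<Rightarrow> ('x \<Rightarrow>\<^sub>0 'k)" where
  "free_scale c = Poly_Mapping.map ((*) c)"

lemma lookup_free_scale: "Poly_Mapping.lookup (free_scale c p) x = c * Poly_Mapping.lookup p x"
  by (simp add: free_scale_def Poly_Mapping.map.rep_eq when_def)

lemma vector_space_free_scale: "vector_space free_scale"
  by unfold_locales
    (auto intro!: poly_mapping_eqI simp: lookup_free_scale lookup_add algebra_simps)

definition free_extension ::
    "('k::field \<Rightarrow> 'v::ab_group_add \<Rightarrow> 'v) \<Rightarrow> ('x \<Rightarrow> 'v) \<Rightarrow> ('x \<Rightarrow>\<^sub>0 'k) \<Rightarrow> 'v" where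
  "free_extension sc \<tau> p = (\<Sum>x\<in>Poly_Mapping.keys p. sc (Poly_Mapping.lookup p x) (\<tau> x))"

text \<open>
  \<open>T\<close> is the quotient of the free vector space on \<open>X\<close> by the span of the relations \<open>R\<close>, with
  \<open>\<tau> x\<close> the class of the basis vector of \<open>x\<close>: the linear extension of \<open>\<tau>\<close> maps onto \<open>T\<close> and
  its kernel is the span of \<open>R\<close>. This describes the quotient up to unique isomorphism.
\<close>

definition is_free_quotient ::
    "('k::field \<Rightarrow> 'v::ab_group_add \<Rightarrow> 'v) \<Rightarrow> 'x set \<Rightarrow> ('x \<Rightarrow>\<^sub>0 'k) set \<Rightarrow> 'v set \<Rightarrow> ('x \<Rightarrow> 'v) \<Rightarrow> bool"
  where
  "is_free_quotient sc X R T \<tau> \<longleftrightarrow>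
     vector_space sc \<and>
     free_extension sc \<tau> ` {p. Poly_Mapping.keys p \<subseteq> X} = T \<and>
     (\<forall>p. Poly_Mapping.keys p \<subseteq> X \<longrightarrow>
        (free_extension sc \<tau> p = 0 \<longleftrightarrow> p \<in> module.span free_scale R))"

definition bilinear_relations ::
    "('k::field \<Rightarrow> 'a::ab_group_add \<Rightarrow> 'a) \<Rightarrow> ('k \<Rightarrow> 'b::ab_group_add \<Rightarrow> 'b) \<Rightarrow> ('a \<times> 'b \<Rightarrow>\<^sub>0 'k) set"
  where
  "bilinear_relations sca scb =
     {Poly_Mapping.single (a + a', b) 1
        - Poly_Mapping.single (a, b) 1 - Poly_Mapping.single (a', b) 1 | a a' b. True} \<union>
     {Poly_Mapping.single (a, b + b') 1
        - Poly_Mapping.single (a, b) 1 - Poly_Mapping.single (a, b') 1 | a b b'. True} \<union>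
     {Poly_Mapping.single (sca c a, b) 1 - Poly_Mapping.single (a, b) c | c a b. True} \<union>
     {Poly_Mapping.single (a, scb c b) 1 - Poly_Mapping.single (a, b) c | c a b. True}"

definition is_tensor_product2 ::
    "('k::field \<Rightarrow> 'a::ab_group_add \<Rightarrow> 'a) \<Rightarrow> ('k \<Rightarrow> 'b::ab_group_add \<Rightarrow> 'b) \<Rightarrow>
     ('k \<Rightarrow> 't::ab_group_add \<Rightarrow> 't) \<Rightarrow> ('a \<Rightarrow> 'b \<Rightarrow> 't) \<Rightarrow> bool" where
  "is_tensor_product2 sca scb sct tens \<longleftrightarrow>
     is_free_quotient sct UNIV (bilinear_relations sca scb) UNIV (\<lambda>(a, b). tens a b)"

text \<open>
  Tensor product of the subspaces \<open>W 0, \<dots>, W (l - 1)\<close> of one ambient vector space, taken over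
  extensional tuples. Any finite family of vector spaces embeds into its direct sum, so the common
  ambient space is no restriction.
\<close>

definition multilinear_relations ::
    "('k::field \<Rightarrow> 'w::ab_group_add \<Rightarrow> 'w) \<Rightarrow> nat \<Rightarrow> (nat \<Rightarrow> 'w set) \<Rightarrow> ((nat \<Rightarrow> 'w) \<Rightarrow>\<^sub>0 'k) set"
  where
  "multilinear_relations scw l W =
     {Poly_Mapping.single (w(i := u + v)) 1
        - Poly_Mapping.single (w(i := u)) 1 - Poly_Mapping.single (w(i := v)) 1
        | w i u v. w \<in> PiE {..<l} W \<and> i < l \<and> u \<in> W i \<and> v \<in> W i} \<union>
     {Poly_Mapping.single (w(i := scw c u)) 1 - Poly_Mapping.single (w(i := u)) c
        | w i c u. w \<in> PiE {..<l} W \<and> i < l \<and> u \<in> W i}"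

definition is_tensor_product ::
    "('k::field \<Rightarrow> 'w::ab_group_add \<Rightarrow> 'w) \<Rightarrow> nat \<Rightarrow> (nat \<Rightarrow> 'w set) \<Rightarrow>
     ('k \<Rightarrow> 't::ab_group_add \<Rightarrow> 't) \<Rightarrow> 't set \<Rightarrow> ((nat \<Rightarrow> 'w) \<Rightarrow> 't) \<Rightarrow> bool" where
  "is_tensor_product scw l W sct T \<tau> \<longleftrightarrow>
     is_free_quotient sct (PiE {..<l} W) (multilinear_relations scw l W) T \<tau>"


section \<open>Lie algebras and their modules\<close>

locale lie_algebra = vector_space scale
  for scale :: "'k::field \<Rightarrow> 'g::ab_group_add \<Rightarrow> 'g" +
  fixes bracket :: "'g \<Rightarrow> 'g \<Rightarrow> 'g"
  assumes linear_right: "Vector_Spaces.linear scale scale (\<lambda>y. bracket x y)"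
    and linear_left: "Vector_Spaces.linear scale scale (\<lambda>x. bracket x y)"
    and bracket_self: "bracket x x = 0"
    and jacobi: "bracket x (bracket y z) + bracket y (bracket z x) + bracket z (bracket x y) = 0"
begin

definition lie_ideal :: "'g set \<Rightarrow> bool" where
  "lie_ideal I \<longleftrightarrow> subspace I \<and> (\<forall>x. \<forall>y\<in>I. bracket x y \<in> I)"

definition lie_subalgebra :: "'g set \<Rightarrow> bool" where
  "lie_subalgebra A \<longleftrightarrow> subspace A \<and> (\<forall>x\<in>A. \<forall>y\<in>A. bracket x y \<in> A)"

primrec lower_central_series :: "'g set \<Rightarrow> nat \<Rightarrow> 'g set" where
  "lower_central_series A 0 = A"
| "lower_central_series A (Suc n) =
     span {bracket x y | x y. x \<in> A \<and> y \<in> lower_central_series A n}"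

definition nilpotent :: "'g set \<Rightarrow> bool" where
  "nilpotent A \<longleftrightarrow> (\<exists>n. lower_central_series A n = {0})"

definition normalizer :: "'g set \<Rightarrow> 'g set" where
  "normalizer A = {x. \<forall>y\<in>A. bracket x y \<in> A}"

definition cartan_subalgebra :: "'g set \<Rightarrow> bool" where
  "cartan_subalgebra H \<longleftrightarrow> lie_subalgebra H \<and> nilpotent H \<and> normalizer H = H"

end

locale simple_lie_algebra = lie_algebra +
  assumes nonabelian: "\<exists>x y. bracket x y \<noteq> 0"
    and ideals_trivial: "lie_ideal I \<Longrightarrow> I = {0} \<or> I = UNIV"

locale lie_module =
  lie_algebra scale bracket + module: vector_space mscale
  for scale :: "'k::field \<Rightarrow> 'g::ab_group_add \<Rightarrow> 'g"
    and bracket :: "'g \<Rightarrow> 'g \<Rightarrow> 'g"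
    and mscale :: "'k \<Rightarrow> 'v::ab_group_add \<Rightarrow> 'v" +
  fixes V :: "'v set" and act :: "'g \<Rightarrow> 'v \<Rightarrow> 'v"
  assumes subspace_V: "module.subspace V"
    and act_closed: "v \<in> V \<Longrightarrow> act x v \<in> V"
    and act_add_right: "v \<in> V \<Longrightarrow> w \<in> V \<Longrightarrow> act x (v + w) = act x v + act x w"
    and act_scale_right: "v \<in> V \<Longrightarrow> act x (mscale c v) = mscale c (act x v)"
    and act_add_left: "v \<in> V \<Longrightarrow> act (x + y) v = act x v + act y v"
    and act_scale_left: "v \<in> V \<Longrightarrow> act (scale c x) v = mscale c (act x v)"
    and act_bracket: "v \<in> V \<Longrightarrow> act (bracket x y) v = act x (act y v) - act y (act x v)"

locale simple_lie_module = lie_module +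
  assumes nonzero: "V \<noteq> {0}"
    and submodules_trivial:
      "module.subspace U \<Longrightarrow> U \<subseteq> V \<Longrightarrow> (\<And>x u. u \<in> U \<Longrightarrow> act x u \<in> U) \<Longrightarrow> U = {0} \<or> U = V"


section \<open>Weight modules\<close>

text \<open>
  Weight spaces only involve the action of the Cartan subalgebra \<open>H\<close>, so they are stated for an
  operator \<open>hact\<close> which is the action itself for modules over \<open>g\<close> and \<open>h \<mapsto> h \<otimes> 1\<close> followed by the
  action for modules over \<open>g \<otimes> S\<close>. Functionals on \<open>H\<close> are taken extensional so that each element
  of the dual space is indexed exactly once.
\<close>

definition dual_of :: "('k::field \<Rightarrow> 'g::ab_group_add \<Rightarrow> 'g) \<Rightarrow> 'g set \<Rightarrow> ('g \<Rightarrow> 'k) set" where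
  "dual_of scg H = {\<mu>. \<mu> \<in> extensional H \<and>
     (\<forall>x\<in>H. \<forall>y\<in>H. \<mu> (x + y) = \<mu> x + \<mu> y) \<and> (\<forall>c. \<forall>x\<in>H. \<mu> (scg c x) = c * \<mu> x)}"

definition weight_space ::
    "'g set \<Rightarrow> ('k::field \<Rightarrow> 'v::ab_group_add \<Rightarrow> 'v) \<Rightarrow> 'v set \<Rightarrow> ('g \<Rightarrow> 'v \<Rightarrow> 'v) \<Rightarrow> ('g \<Rightarrow> 'k) \<Rightarrow> 'v set"
  where
  "weight_space H scv V hact \<mu> = {v \<in> V. \<forall>h\<in>H. hact h v = scv (\<mu> h) v}"

definition weight_module ::
    "('k::field \<Rightarrow> 'g::ab_group_add \<Rightarrow> 'g) \<Rightarrow> 'g set \<Rightarrow>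
     ('k \<Rightarrow> 'v::ab_group_add \<Rightarrow> 'v) \<Rightarrow> 'v set \<Rightarrow> ('g \<Rightarrow> 'v \<Rightarrow> 'v) \<Rightarrow> bool" where
  "weight_module scg H scv V hact \<longleftrightarrow>
     internal_direct_sum scv (dual_of scg H) (weight_space H scv V hact) V \<and>
     (\<forall>\<mu>\<in>dual_of scg H. fin_dim scv (weight_space H scv V hact \<mu>))"

definition admissible ::
    "('k::field \<Rightarrow> 'g::ab_group_add \<Rightarrow> 'g) \<Rightarrow> 'g set \<Rightarrow>
     ('k \<Rightarrow> 'v::ab_group_add \<Rightarrow> 'v) \<Rightarrow> 'v set \<Rightarrow> ('g \<Rightarrow> 'v \<Rightarrow> 'v) \<Rightarrow> bool" where
  "admissible scg H scv V hact \<longleftrightarrow>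
     weight_module scg H scv V hact \<and>
     (\<exists>B>0. \<forall>\<mu>\<in>dual_of scg H. vector_space.dim scv (weight_space H scv V hact \<mu>) \<le> B)"


section \<open>The coordinate algebra and the map algebra\<close>

locale finite_type_algebra = vector_space scale
  for scale :: "'k::field \<Rightarrow> 's::comm_ring_1 \<Rightarrow> 's" +
  assumes scale_mult: "scale c (r * s) = scale c r * s"
    and finite_type: "\<exists>G. finite G \<and>
      (\<forall>A. subspace A \<and> 1 \<in> A \<and> (\<forall>r\<in>A. \<forall>s\<in>A. r * s \<in> A) \<and> G \<subseteq> A \<longrightarrow> A = UNIV)"

text \<open>Ideals of a commutative ring are its submodules.\<close>

definition maximal_ideal :: "'s::comm_ring_1 set \<Rightarrow> bool" where
  "maximal_ideal M \<longleftrightarrow> module.subspace (*) M \<and> M \<noteq> UNIV \<and>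
     (\<forall>J. module.subspace (*) J \<and> M \<subseteq> J \<longrightarrow> J = M \<or> J = UNIV)"

text \<open>
  The element of \<open>k\<close> that \<open>s\<close> is congruent to modulo \<open>M\<close>; existence and uniqueness is the
  isomorphism of \<open>k\<close> with \<open>S / M\<close>.
\<close>

definition residue_at :: "('k::field \<Rightarrow> 's::comm_ring_1 \<Rightarrow> 's) \<Rightarrow> 's set \<Rightarrow> 's \<Rightarrow> 'k" where
  "residue_at scs M s = (THE c. s - scs c 1 \<in> M)"

text \<open>The Lie algebra structure on \<open>g \<otimes> S\<close>; \<open>tens x s\<close> is the pure tensor \<open>x \<otimes> s\<close>.\<close>

locale map_algebra =
  g: lie_algebra scg brg + S: finite_type_algebra scs + L: lie_algebra scl brl
  for scg :: "'k::field \<Rightarrow> 'g::ab_group_add \<Rightarrow> 'g" and brg :: "'g \<Rightarrow> 'g \<Rightarrow> 'g"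
    and scs :: "'k \<Rightarrow> 's::comm_ring_1 \<Rightarrow> 's"
    and scl :: "'k \<Rightarrow> 'l::ab_group_add \<Rightarrow> 'l" and brl :: "'l \<Rightarrow> 'l \<Rightarrow> 'l" +
  fixes tens :: "'g \<Rightarrow> 's \<Rightarrow> 'l"
  assumes tensor_product: "is_tensor_product2 scg scs scl tens"
    and bracket_tens: "brl (tens x r) (tens y s) = tens (brg x y) (r * s)"


section \<open>Evaluation weight modules\<close>

text \<open>
  \<open>V\<close> with action \<open>act\<close> is the module \<open>V(M, W)\<close> for \<open>M = (M 0, \<dots>, M (l - 1))\<close> and
  \<open>W = (W 0, \<dots>, W (l - 1))\<close>, where \<open>actW i\<close> is the action on \<open>W i\<close> and \<open>\<tau> w\<close> is the pure tensor
  \<open>w 0 \<otimes> \<dots> \<otimes> w (l - 1)\<close>. The formula on pure tensors determines \<open>act\<close> on \<open>V\<close>.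
\<close>

locale evaluation_module =
  map_algebra scg brg scs scl brl tens + lie_module scl brl scv V act
  for scg :: "'k::field \<Rightarrow> 'g::ab_group_add \<Rightarrow> 'g" and brg :: "'g \<Rightarrow> 'g \<Rightarrow> 'g"
    and scs :: "'k \<Rightarrow> 's::comm_ring_1 \<Rightarrow> 's"
    and scl :: "'k \<Rightarrow> 'l::ab_group_add \<Rightarrow> 'l" and brl :: "'l \<Rightarrow> 'l \<Rightarrow> 'l"
    and tens :: "'g \<Rightarrow> 's \<Rightarrow> 'l"
    and scv :: "'k \<Rightarrow> 'v::ab_group_add \<Rightarrow> 'v" and V :: "'v set" and act :: "'l \<Rightarrow> 'v \<Rightarrow> 'v" +
  fixes scw :: "'k \<Rightarrow> 'w::ab_group_add \<Rightarrow> 'w" and l :: nat and M :: "nat \<Rightarrow> 's set"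
    and W :: "nat \<Rightarrow> 'w set" and actW :: "nat \<Rightarrow> 'g \<Rightarrow> 'w \<Rightarrow> 'w" and \<tau> :: "(nat \<Rightarrow> 'w) \<Rightarrow> 'v"
  assumes maximal: "i < l \<Longrightarrow> maximal_ideal (M i)"
    and simple_W: "i < l \<Longrightarrow> simple_lie_module scg brg scw (W i) (actW i)"
    and tensor_product_W: "is_tensor_product scw l W scv V \<tau>"
    and act_pure: "w \<in> PiE {..<l} W \<Longrightarrow>
      act (tens x s) (\<tau> w) = (\<Sum>i<l. scv (residue_at scs (M i) s) (\<tau> (w(i := actW i x (w i)))))"

locale evaluation_weight_module =
  evaluation_module scg brg scs scl brl tens scv V act scw l M W actW \<tau>
  for scg :: "'k::field \<Rightarrow> 'g::ab_group_add \<Rightarrow> 'g" and brg :: "'g \<Rightarrow> 'g \<Rightarrow> 'g"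
    and scs :: "'k \<Rightarrow> 's::comm_ring_1 \<Rightarrow> 's"
    and scl :: "'k \<Rightarrow> 'l::ab_group_add \<Rightarrow> 'l" and brl :: "'l \<Rightarrow> 'l \<Rightarrow> 'l"
    and tens :: "'g \<Rightarrow> 's \<Rightarrow> 'l"
    and scv :: "'k \<Rightarrow> 'v::ab_group_add \<Rightarrow> 'v" and V :: "'v set" and act :: "'l \<Rightarrow> 'v \<Rightarrow> 'v"
    and scw :: "'k \<Rightarrow> 'w::ab_group_add \<Rightarrow> 'w" and l :: nat and M :: "nat \<Rightarrow> 's set"
    and W :: "nat \<Rightarrow> 'w set" and actW :: "nat \<Rightarrow> 'g \<Rightarrow> 'w \<Rightarrow> 'w" and \<tau> :: "(nat \<Rightarrow> 'w) \<Rightarrow> 'v" +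
  fixes H :: "'g set"
  assumes distinct: "inj_on M {..<l}"
    and weight_W: "i < l \<Longrightarrow> weight_module scg H scw (W i) (actW i)"

end

theory Submission
  imports Defs "HOL-Library.Function_Algebras"
begin

text \<open>
  Bases \<open>B i\<close> of weight vectors of the factors give the basis of pure tensors of \<open>V\<close>, whose weights are
  the sums of the weights of the factors. Admissibility thus says that the fibres of the sum map are
  bounded, and everything except the finiteness of all but one factor is counting.

  For that, let \<open>W\<close> be an infinite-dimensional simple weight module. It is faithful, so \<open>H\<close> acts diagonally on
  the Lie algebra and there is a root decomposition. A root vector acts on \<open>W\<close> either injectively or locally
  nilpotently. The locally nilpotent elements span a subalgebra which acts locally finitely, hence the
  locally nilpotent root spaces are closed under addition of roots, and some root is exceptional for
  \<open>W\<close>, meaning that it or its negative acts injectively. The exceptional roots of two such modules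
  cannot be disjoint: otherwise their root spaces would commute and the centralizer of one family would be a
  proper nonzero ideal. A common exceptional root \<open>\<alpha>\<close> yields weights \<open>\<mu> + n\<alpha>\<close> of one module and
  \<open>\<nu> \<plusminus> n\<alpha>\<close> of the other for all \<open>n\<close>, which makes the fibres unbounded.
\<close>

section \<open>Bases and weights\<close>

text \<open>Nilpotent and self-normalizing says nothing direct about how \<open>H\<close> acts on
  the Lie algebra; diagonalizability is read off from one infinite-dimensional factor, and the
  resulting decomposition serves both modules. Locally nilpotent elements are not visibly closed
  under brackets. If \<open>x\<close> and \<open>y\<close> are nilpotent on the module and under ad,
  then exp(t ad x) y acts as a conjugate of \<open>y\<close>, so it is nilpotent for every t, and
  its coefficient at t is [x,y]; this only puts [x,y] into the span. To return to single elements,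
  ordered monomials give local finiteness, and a root vector acting locally finitely cannot be
  injective, since its weight strings would be infinite. One-dimensional root spaces then turn one
  bracket into a whole root space. That dimension statement rests on a nondegenerate trace form.
  Nondegeneracy comes from integrality: for opposite root vectors the weights at h = [x,y] are
  half-integral multiples of \<alpha>(h), so four times the form at h is \<alpha>(h)^2 times a sum
  of integer squares. A root common up to sign suffices at the end, because one of two finite
  strings can be traversed backwards.\<close>

context vector_space
begin

text \<open>A Gram-Schmidt process that corrects only the vectors: the functionals stay members of
  \<open>\<Phi>\<close>, since in the application they are eigenfunctionals of \<open>H\<close>, a
  property that linear combinations would lose.\<close>

lemma biorthogonal_basis:
  assumes S: "finite S" "span S = UNIV"
    and lin: "\<And>f x y. f \<in> \<Phi> \<Longrightarrow> f (x + y) = f x + f y" "\<And>f c x. f \<in> \<Phi> \<Longrightarrow> f (scale c x) = c * f x"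
    and sep: "\<And>x. x \<noteq> 0 \<Longrightarrow> \<exists>f\<in>\<Phi>. f x \<noteq> 0"
  shows "\<exists>(n::nat) e f. (\<forall>i<n. f i \<in> \<Phi>) \<and> (\<forall>i<n. \<forall>j<n. f i (e j) = (if i = j then 1 else 0)) \<and>
           (\<forall>x. x = (\<Sum>j<n. scale (f j x) (e j)))"
proof -
  have sum_lin: "f (\<Sum>i\<in>I. scale (c i) (x i)) = (\<Sum>i\<in>I. c i * f (x i))" if "f \<in> \<Phi>" "finite I" 
    for f and I :: "nat set" and c x
  proof -
    have "f 0 = 0" using lin(2)[OF that(1), of 0 0] by simp
    with that(2) show ?thesis by (induction rule: finite_induct) (simp_all add: lin that(1))
  qed
  have diff_lin: "f (x - y) = f x - f y" if "f \<in> \<Phi>" for f x y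
    using lin(1)[OF that, of "x - y" y] by simp
  have "\<exists>(n::nat) e f. (\<forall>i<n. f i \<in> \<Phi>) \<and> (\<forall>i<n. \<forall>j<n. f i (e j) = (if i = j then 1 else 0)) \<and>
      (\<forall>x\<in>S. x = (\<Sum>j<n. scale (f j x) (e j)))"
    using S(1)
  proof (induction S)
    case empty
    show ?case by (rule exI[of _ 0]) simp
  next
    case (insert s S)
    then obtain n :: nat and e f where f: "\<And>i. i < n \<Longrightarrow> f i \<in> \<Phi>"
      and fe: "\<And>i j. i < n \<Longrightarrow> j < n \<Longrightarrow> f i (e j) = (if i = j then 1 else 0)"
      and S: "\<And>x. x \<in> S \<Longrightarrow> x = (\<Sum>j<n. scale (f j x) (e j))" by blast
    \<comment> \<open>The part of \<open>s\<close> that the functionals found so far do not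
      see.\<close>
    define t where "t = s - (\<Sum>j<n. scale (f j s) (e j))"
    have ft: "f i t = 0" if "i < n" for i
    proof -
      have "f i (\<Sum>j<n. scale (f j s) (e j)) = (\<Sum>j<n. f j s * f i (e j))"
        by (intro sum_lin f that finite_lessThan)
      also have "\<dots> = (\<Sum>j<n. if j = i then f j s else 0)"
        using fe that by (intro sum.cong) auto
      finally show ?thesis unfolding t_def using that by (simp add: diff_lin[OF f])
    qed
    show ?case
    proof (cases "t = 0")
      case True
      then have "s = (\<Sum>j<n. scale (f j s) (e j))" by (simp add: t_def)
      then show ?thesis using f fe S by blast
    next
      case False
      then obtain g where g: "g \<in> \<Phi>" "g t \<noteq> 0" using sep by blast
      define u where "u = scale (inverse (g t)) t"
      \<comment> \<open>The new vector is \<open>u\<close>, normalised to g u = 1. Subtracting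
        multiples of it makes the old vectors vanish under \<open>g\<close>; the old functionals are
        0 on \<open>u\<close> and do not notice.\<close>
      define e' where "e' = (\<lambda>j. if j < n then e j - scale (g (e j)) u else u)"
      define f' where "f' = (\<lambda>j. if j < n then f j else g)"
      have gu: "g u = 1" using g by (simp add: u_def lin)
      have fu: "f i u = 0" if "i < n" for i using ft that by (simp add: u_def lin(2)[OF f])
      have exp: "x = (\<Sum>j<Suc n. scale (f' j x) (e' j))" if x: "x = (\<Sum>j<n. scale (f j x) (e j)) + scale c t" for x c
      proof -
        have "g x = (\<Sum>j<n. f j x * g (e j)) + c * g t"
          by (subst x) (simp add: lin g sum_lin[OF g(1)])
        moreover have "scale c t = scale (c * g t) u" using g by (simp add: u_def)
        ultimately have ct: "scale c t = scale (g x) u - (\<Sum>j<n. scale (f j x * g (e j)) u)"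
          by (simp add: scale_left_distrib scale_sum_left)
        note x
        also have "(\<Sum>j<n. scale (f j x) (e j)) + scale c t =
            (\<Sum>j<n. scale (f j x) (e j)) - (\<Sum>j<n. scale (f j x * g (e j)) u) + scale (g x) u"
          unfolding ct by simp
        also have "\<dots> = (\<Sum>j<n. scale (f j x) (e j - scale (g (e j)) u)) + scale (g x) u"
          by (simp add: sum_subtractf scale_right_diff_distrib)
        finally show ?thesis by (simp add: f'_def e'_def)
      qed
      have "s = (\<Sum>j<Suc n. scale (f' j s) (e' j))"
        by (rule exp[of s 1]) (simp add: t_def)
      moreover have "x = (\<Sum>j<Suc n. scale (f' j x) (e' j))" if "x \<in> S" for x
        by (rule exp[of x 0]) (use S[OF that] in simp)
      moreover have "f' i (e' j) = (if i = j then 1 else 0)" if "i < Suc n" "j < Suc n" for i j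
        using that f g fe fu gu by (auto simp: f'_def e'_def diff_lin[OF f] lin(2)[OF f] diff_lin[OF g(1)] lin(2)[OF g(1)])
      moreover have "f' i \<in> \<Phi>" if "i < Suc n" for i using f g that by (auto simp: f'_def)
      ultimately show ?thesis by (intro exI[of _ "Suc n"] exI[of _ e'] exI[of _ f'] conjI) blast+
    qed
  qed
  then obtain n :: nat and e f where f: "\<And>i. i < n \<Longrightarrow> f i \<in> \<Phi>"
      and fe: "\<And>i j. i < n \<Longrightarrow> j < n \<Longrightarrow> f i (e j) = (if i = j then 1 else 0)"
      and S': "\<And>x. x \<in> S \<Longrightarrow> x = (\<Sum>j<n. scale (f j x) (e j))" by blast
  have "x = (\<Sum>j<n. scale (f j x) (e j))" for x
  proof -
    have "x \<in> span S" using S by simp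
    then show ?thesis
    proof (induction rule: span_induct_alt)
      case base
      have "f j 0 = 0" if "j < n" for j using lin(2)[OF f[OF that], of 0 0] by simp
      then show ?case by simp
    next
      case (step c x y)
      have "scale c x + y = scale c (\<Sum>j<n. scale (f j x) (e j)) + (\<Sum>j<n. scale (f j y) (e j))"
        using S'[OF step(1)] step(2) by simp
      also have "\<dots> = (\<Sum>j<n. scale (f j (scale c x + y)) (e j))"
        unfolding scale_sum_right sum.distrib[symmetric]
        by (intro sum.cong) (simp_all add: lin f scale_left_distrib)
      finally show ?case .
    qed
  qed
  then show ?thesis using f fe by blast
qed

lemma fin_dim_span_iff:
  assumes "independent C"
  shows "fin_dim scale (span C) \<longleftrightarrow> finite C"
proof
  assume "fin_dim scale (span C)"
  then obtain F where "finite F" "span C \<subseteq> span F" unfolding fin_dim_def by blast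
  then show "finite C" using assms independent_span_bound span_superset by blast
qed (auto simp: fin_dim_def)

end

text \<open>Linearity of \<open>T\<close> is asked only on the span, since an action is
  unconstrained off its module. \<open>T\<close> stands for the action of g as well as for that of h
  \<otimes> 1.\<close>

locale weight_basis = vector_space scale
  for scale :: "'k::field \<Rightarrow> 'v::ab_group_add \<Rightarrow> 'v" +
  fixes scg :: "'k \<Rightarrow> 'g::ab_group_add \<Rightarrow> 'g" and H :: "'g set"
    and T :: "'g \<Rightarrow> 'v \<Rightarrow> 'v" and B :: "'v set" and wt :: "'v \<Rightarrow> 'g \<Rightarrow> 'k"
  assumes independent_B: "independent B"
    and T_add: "h \<in> H \<Longrightarrow> v \<in> span B \<Longrightarrow> w \<in> span B \<Longrightarrow> T h (v + w) = T h v + T h w"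
    and T_scale: "h \<in> H \<Longrightarrow> v \<in> span B \<Longrightarrow> T h (scale c v) = scale c (T h v)"
    and wt_dual: "b \<in> B \<Longrightarrow> wt b \<in> dual_of scg H"
    and T_basis: "b \<in> B \<Longrightarrow> h \<in> H \<Longrightarrow> T h b = scale (wt b h) b"
begin

lemma T_rep:
  assumes "h \<in> H" "v \<in> span B"
  shows "T h v \<in> span B" "representation B (T h v) b = wt b h * representation B v b"
proof -
  have "v \<in> span B \<and> T h v \<in> span B \<and>
      (\<forall>b. representation B (T h v) b = wt b h * representation B v b)"
    using assms(2)
  proof (induction rule: span_induct_alt)
    case base
    have "T h 0 = 0" using T_scale[OF assms(1) span_zero, of 0] by simp
    then show ?case by (simp add: span_zero representation_zero)
  next
    case (step c x y)
    have x: "x \<in> span B" "T h x = scale (wt x h) x" using step assms(1)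
      by (simp_all add: span_base T_basis)
    have "T h (scale c x + y) = scale (c * wt x h) x + T h y"
      using x step by (simp add: T_add T_scale assms(1) span_scale)
    moreover have "c * wt x h * representation B x b = wt b h * (c * representation B x b)" for b
      using step(1) independent_B by (simp add: representation_basis)
    ultimately show ?case using x step independent_B
      by (auto simp: span_add span_scale representation_add representation_scale algebra_simps)
  qed
  then show "T h v \<in> span B" "representation B (T h v) b = wt b h * representation B v b" by auto
qed

text \<open>\<open>T\<close> is diagonal in \<open>B\<close>, so comparing coordinates turns the
  eigenvector equation into a condition on each basis vector in the support of
  \<open>v\<close>.\<close>

lemma in_weight_space_iff:
  assumes "v \<in> span B"
  shows "(\<forall>h\<in>H. T h v = scale (\<mu> h) v) \<longleftrightarrow>
    (\<forall>b. representation B v b \<noteq> 0 \<longrightarrow> (\<forall>h\<in>H. wt b h = \<mu> h))"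
proof -
  have "T h v = scale (\<mu> h) v \<longleftrightarrow> (\<forall>b. representation B v b \<noteq> 0 \<longrightarrow> wt b h = \<mu> h)" if "h \<in> H" for h
  proof -
    have "T h v = scale (\<mu> h) v \<longleftrightarrow> representation B (T h v) = representation B (scale (\<mu> h) v)"
      using independent_B T_rep(1)[OF that assms] span_scale[OF assms] representation_eqI
      by (metis sum_nonzero_representation_eq)
    also have "\<dots> \<longleftrightarrow> (\<forall>b. wt b h * representation B v b = \<mu> h * representation B v b)"
      using T_rep(2)[OF that assms] independent_B assms
      by (simp add: fun_eq_iff representation_scale)
    finally show ?thesis by auto
  qed
  then show ?thesis by blast
qed

lemma weight_space_eq_span:
  "weight_space H scale (span B) T \<mu> = span {b \<in> B. \<forall>h\<in>H. wt b h = \<mu> h}" (is "?L = span ?C")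
proof
  show "?L \<subseteq> span ?C"
  proof
    fix v assume "v \<in> ?L"
    then have v: "v \<in> span B" "\<forall>h\<in>H. T h v = scale (\<mu> h) v" by (auto simp: weight_space_def)
    have wt: "\<forall>b. representation B v b \<noteq> 0 \<longrightarrow> (\<forall>h\<in>H. wt b h = \<mu> h)"
      using v(2) unfolding in_weight_space_iff[OF v(1)] .
    have "(\<Sum>b | representation B v b \<noteq> 0. scale (representation B v b) b) \<in> span ?C"
    proof (intro span_sum span_scale span_base)
      fix b assume "b \<in> {b. representation B v b \<noteq> 0}"
      then show "b \<in> ?C" using wt representation_ne_zero[of B v b] by blast
    qed
    then show "v \<in> span ?C" unfolding sum_nonzero_representation_eq[OF independent_B v(1)] .
  qed
  show "span ?C \<subseteq> ?L"
  proof
    fix v assume v: "v \<in> span ?C"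
    have vB: "v \<in> span B" using v span_mono[of ?C B] by blast
    have eq: "representation B v = representation ?C v"
      by (rule representation_extend[OF independent_B v]) simp
    have "\<forall>b. representation B v b \<noteq> 0 \<longrightarrow> (\<forall>h\<in>H. wt b h = \<mu> h)"
    proof (intro allI impI)
      fix b assume "representation B v b \<noteq> 0"
      then have "b \<in> ?C" unfolding eq by (rule representation_ne_zero)
      then show "\<forall>h\<in>H. wt b h = \<mu> h" by blast
    qed
    then have "\<forall>h\<in>H. T h v = scale (\<mu> h) v" using in_weight_space_iff[OF vB] by blast
    then show "v \<in> ?L" using vB by (simp add: weight_space_def)
  qed
qed

lemma weight_space_dual:
  assumes "\<mu> \<in> dual_of scg H"
  shows "weight_space H scale (span B) T \<mu> = span {b \<in> B. wt b = \<mu>}"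
proof -
  have "(\<forall>h\<in>H. wt b h = \<mu> h) \<longleftrightarrow> wt b = \<mu>" if "b \<in> B" for b
    using wt_dual[OF that] assms by (auto simp: dual_of_def intro: extensionalityI)
  then have "{b \<in> B. \<forall>h\<in>H. wt b h = \<mu> h} = {b \<in> B. wt b = \<mu>}" by blast
  then show ?thesis by (simp add: weight_space_eq_span)
qed

text \<open>A vector of weight \<mu> is supported on basis vectors of weight \<mu>, so the
  coordinates there see only the \<mu>-component of a sum.\<close>

lemma direct_sum_weight_spaces:
  "internal_direct_sum scale (dual_of scg H) (weight_space H scale (span B) T) (span B)"
  unfolding internal_direct_sum_def
proof (intro conjI ballI allI impI)
  fix \<mu> assume "\<mu> \<in> dual_of scg H"
  then show "subspace (weight_space H scale (span B) T \<mu>)" by (simp add: weight_space_dual)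
next
  have "B \<subseteq> (\<Union>\<mu>\<in>dual_of scg H. weight_space H scale (span B) T \<mu>)"
    using wt_dual by (auto simp: weight_space_dual intro: span_base)
  moreover have "(\<Union>\<mu>\<in>dual_of scg H. weight_space H scale (span B) T \<mu>) \<subseteq> span B"
    by (auto simp: weight_space_def)
  ultimately show "span (\<Union>\<mu>\<in>dual_of scg H. weight_space H scale (span B) T \<mu>) = span B"
    by (metis span_mono span_span subset_antisym)
next
  fix F f \<mu>
  assume *: "finite F \<and> F \<subseteq> dual_of scg H \<and>
      (\<forall>i\<in>F. f i \<in> weight_space H scale (span B) T i) \<and> sum f F = 0" and \<mu>: "\<mu> \<in> F"
  have sp: "f i \<in> span B" if "i \<in> F" for i using * that by (auto simp: weight_space_def)
  have z: "representation B (f i) b = 0" if "i \<in> F" "b \<in> B" "wt b \<noteq> i" for i b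
  proof (rule ccontr)
    assume b: "representation B (f i) b \<noteq> 0"
    have "\<forall>h\<in>H. T h (f i) = scale (i h) (f i)" using * that(1) by (auto simp: weight_space_def)
    then have "\<forall>h\<in>H. wt b h = i h" using b in_weight_space_iff[OF sp[OF that(1)], of i] by blast
    moreover have "i \<in> extensional H" "wt b \<in> extensional H"
      using * that(1) wt_dual[OF that(2)] by (auto simp: dual_of_def)
    ultimately have "wt b = i" by (intro extensionalityI) auto
    then show False using that(3) by contradiction
  qed
  have "representation B (f \<mu>) b = 0" for b
  proof (cases "b \<in> B \<and> wt b = \<mu>")
    case True
    have "0 = representation B (sum f F) b" using * by (simp add: representation_zero)
    also have "\<dots> = (\<Sum>i\<in>F. representation B (f i) b)"
      using independent_B sp by (simp add: representation_sum)
    also have "\<dots> = (\<Sum>i\<in>{\<mu>}. representation B (f i) b)"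
      using True z * \<mu> by (intro sum.mono_neutral_right) auto
    finally show ?thesis by simp
  next
    case False
    then show ?thesis using z[OF \<mu>] representation_ne_zero[of B "f \<mu>" b] by blast
  qed
  then show "f \<mu> = 0"
    using sum_nonzero_representation_eq[OF independent_B sp[OF \<mu>]] by simp
qed

lemma admissible_iff:
  "admissible scg H scale (span B) T \<longleftrightarrow>
    (\<exists>N. \<forall>\<mu>\<in>dual_of scg H. finite {b \<in> B. wt b = \<mu>} \<and> card {b \<in> B. wt b = \<mu>} \<le> N)"
proof -
  have ind: "independent {b \<in> B. wt b = \<mu>}" for \<mu>
    using independent_B by (rule independent_mono) auto
  have "admissible scg H scale (span B) T \<longleftrightarrow>
    (\<forall>\<mu>\<in>dual_of scg H. finite {b \<in> B. wt b = \<mu>}) \<and>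
    (\<exists>N>0. \<forall>\<mu>\<in>dual_of scg H. card {b \<in> B. wt b = \<mu>} \<le> N)"
    unfolding admissible_def weight_module_def using direct_sum_weight_spaces
    by (simp add: weight_space_dual fin_dim_span_iff dim_eq_card_independent ind cong: conj_cong)
  also have "\<dots> \<longleftrightarrow> (\<exists>N. \<forall>\<mu>\<in>dual_of scg H. finite {b \<in> B. wt b = \<mu>} \<and> card {b \<in> B. wt b = \<mu>} \<le> N)"
  proof (intro iffI)
    assume "\<exists>N. \<forall>\<mu>\<in>dual_of scg H. finite {b \<in> B. wt b = \<mu>} \<and> card {b \<in> B. wt b = \<mu>} \<le> N"
    then obtain N where "\<forall>\<mu>\<in>dual_of scg H. finite {b \<in> B. wt b = \<mu>} \<and> card {b \<in> B. wt b = \<mu>} \<le> N" ..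
    \<comment> \<open>\<open>Suc N\<close> replaces \<open>N\<close> because the bound in
      \<open>admissible\<close> has to be positive.\<close>
    then show "(\<forall>\<mu>\<in>dual_of scg H. finite {b \<in> B. wt b = \<mu>}) \<and>
        (\<exists>N>0. \<forall>\<mu>\<in>dual_of scg H. card {b \<in> B. wt b = \<mu>} \<le> N)"
      by (intro conjI exI[of _ "Suc N"]) (auto intro: le_SucI)
  qed auto
  finally show ?thesis .
qed

end

lemma weight_basis_exists:
  assumes "vector_space sc" and V: "module.subspace sc V"
    and T_add: "\<And>h v w. h \<in> H \<Longrightarrow> v \<in> V \<Longrightarrow> w \<in> V \<Longrightarrow> T h (v + w) = T h v + T h w"
    and T_scale: "\<And>h v c. h \<in> H \<Longrightarrow> v \<in> V \<Longrightarrow> T h (sc c v) = sc c (T h v)"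
    and weight: "weight_module scg H sc V T"
  shows "\<exists>B wt. weight_basis sc scg H T B wt \<and> module.span sc B = V"
proof -
  interpret vector_space sc by fact
  let ?U = "\<Union>\<mu>\<in>dual_of scg H. weight_space H sc V T \<mu>"
  have span: "span ?U = V" using weight by (simp add: weight_module_def internal_direct_sum_def)
  obtain B where B: "B \<subseteq> ?U" "independent B" "?U \<subseteq> span B" 
    by (rule basis_exists)
  have BV: "span B = V" using B span by (metis span_mono span_span subset_antisym)
  have "\<forall>b\<in>B. \<exists>\<mu>\<in>dual_of scg H. b \<in> weight_space H sc V T \<mu>" using B(1) by blast
  then obtain wt where wt: "\<And>b. b \<in> B \<Longrightarrow> wt b \<in> dual_of scg H \<and> b \<in> weight_space H sc V T (wt b)"
    by metis
  have "weight_basis sc scg H T B wt"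
    by unfold_locales (use B(2) BV wt T_add T_scale in \<open>auto simp: weight_space_def\<close>)
  then show ?thesis using BV by blast
qed

section \<open>Bases of tensor products\<close>

lemma free_extension_superset:
  assumes "vector_space sc" "finite K" "Poly_Mapping.keys p \<subseteq> K"
  shows "free_extension sc \<tau> p = (\<Sum>x\<in>K. sc (Poly_Mapping.lookup p x) (\<tau> x))"
proof -
  interpret vector_space sc by fact
  show ?thesis unfolding free_extension_def
    using assms(2,3) by (intro sum.mono_neutral_left) (auto simp: in_keys_iff)
qed

lemma free_extension_linear:
  fixes sc :: "'k::field \<Rightarrow> 'v::ab_group_add \<Rightarrow> 'v" and \<tau> :: "'x \<Rightarrow> 'v"
  assumes "vector_space sc"
  shows "Vector_Spaces.linear free_scale sc (free_extension sc \<tau>)"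
proof -
  interpret v: vector_space sc by fact
  interpret f: vector_space free_scale by (rule vector_space_free_scale)
  show ?thesis
  proof unfold_locales
    fix p q :: "'x \<Rightarrow>\<^sub>0 'k"
    let ?K = "Poly_Mapping.keys p \<union> Poly_Mapping.keys q"
    have "Poly_Mapping.keys (p + q) \<subseteq> ?K" by (rule keys_add)
    then show "free_extension sc \<tau> (p + q) = free_extension sc \<tau> p + free_extension sc \<tau> q"
      by (subst (1 2 3) free_extension_superset[OF assms, of ?K])
        (auto simp: lookup_add v.scale_left_distrib sum.distrib)
  next
    fix c and p :: "'x \<Rightarrow>\<^sub>0 'k"
    have "Poly_Mapping.keys (free_scale c p) \<subseteq> Poly_Mapping.keys p"
      by (auto simp: in_keys_iff lookup_free_scale)
    then show "free_extension sc \<tau> (free_scale c p) = sc c (free_extension sc \<tau> p)"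
      by (subst (1 2) free_extension_superset[OF assms, of "Poly_Mapping.keys p"])
        (auto simp: lookup_free_scale v.scale_sum_right)
  qed
qed

lemma free_extension_single:
  assumes "vector_space sc"
  shows "free_extension sc \<tau> (Poly_Mapping.single x c) = sc c (\<tau> x)"
  by (subst free_extension_superset[OF assms, of "{x}"]) auto

locale tensor_product_family =
  w: vector_space scw + v: vector_space scv
  for scw :: "'k::field \<Rightarrow> 'w::ab_group_add \<Rightarrow> 'w" and scv :: "'k \<Rightarrow> 'v::ab_group_add \<Rightarrow> 'v" +
  fixes l :: nat and W :: "nat \<Rightarrow> 'w set" and V :: "'v set" and \<tau> :: "(nat \<Rightarrow> 'w) \<Rightarrow> 'v"
  assumes tensor: "is_tensor_product scw l W scv V \<tau>"
    and subspace_W: "i < l \<Longrightarrow> w.subspace (W i)"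
begin

sublocale ext: Vector_Spaces.linear free_scale scv "free_extension scv \<tau>"
  by (rule free_extension_linear) unfold_locales

lemma ext_single: "free_extension scv \<tau> (Poly_Mapping.single x c) = scv c (\<tau> x)"
  by (rule free_extension_single) unfold_locales

lemma upd_PiE: "w \<in> PiE {..<l} W \<Longrightarrow> i < l \<Longrightarrow> u \<in> W i \<Longrightarrow> w(i := u) \<in> PiE {..<l} W"
  by (auto simp: PiE_iff extensional_def)

text \<open>The kernel is described only for elements supported on \<open>PiE {..<l} W\<close>, so
  the supports of the relations have to be checked.\<close>

lemma relation_zero:
  assumes "p \<in> multilinear_relations scw l W"
  shows "free_extension scv \<tau> p = 0"
proof -
  have single: "Poly_Mapping.keys (Poly_Mapping.single x c) \<subseteq> PiE {..<l} W" if "x \<in> PiE {..<l} W"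
    for x and c :: 'k using that by auto
  have diff: "Poly_Mapping.keys (p - q) \<subseteq> PiE {..<l} W"
    if "Poly_Mapping.keys p \<subseteq> PiE {..<l} W" "Poly_Mapping.keys q \<subseteq> PiE {..<l} W"
    for p q :: "(nat \<Rightarrow> 'w) \<Rightarrow>\<^sub>0 'k" using that keys_diff[of p q] by blast
  consider (add) w i u u' where "w \<in> PiE {..<l} W" "i < l" "u \<in> W i" "u' \<in> W i"
      "p = Poly_Mapping.single (w(i := u + u')) 1
        - Poly_Mapping.single (w(i := u)) 1 - Poly_Mapping.single (w(i := u')) 1"
    | (scale) w i c u where "w \<in> PiE {..<l} W" "i < l" "u \<in> W i"
      "p = Poly_Mapping.single (w(i := scw c u)) 1 - Poly_Mapping.single (w(i := u)) c"
    using assms unfolding multilinear_relations_def by blast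
  then have "Poly_Mapping.keys p \<subseteq> PiE {..<l} W"
  proof cases
    case add
    show ?thesis unfolding add(5) using add(1-4) subspace_W[OF add(2)]
      by (intro diff single upd_PiE) (auto intro: w.subspace_add)
  next
    case scale
    show ?thesis unfolding scale(4) using scale(1-3) subspace_W[OF scale(2)]
      by (intro diff single upd_PiE) (auto intro: w.subspace_scale)
  qed
  moreover have "p \<in> module.span free_scale (multilinear_relations scw l W)"
    using assms by (rule ext.vs1.span_base)
  ultimately show ?thesis
    using tensor by (simp add: is_tensor_product_def is_free_quotient_def)
qed

lemma \<tau>_add:
  assumes "w \<in> PiE {..<l} W" "i < l" "u \<in> W i" "u' \<in> W i"
  shows "\<tau> (w(i := u + u')) = \<tau> (w(i := u)) + \<tau> (w(i := u'))"
proof -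
  have "Poly_Mapping.single (w(i := u + u')) 1
        - Poly_Mapping.single (w(i := u)) 1 - Poly_Mapping.single (w(i := u')) 1
        \<in> multilinear_relations scw l W"
    unfolding multilinear_relations_def using assms by blast
  from relation_zero[OF this] show ?thesis by (simp add: ext.diff ext_single diff_eq_eq add.commute)
qed

lemma \<tau>_scale:
  assumes "w \<in> PiE {..<l} W" "i < l" "u \<in> W i"
  shows "\<tau> (w(i := scw c u)) = scv c (\<tau> (w(i := u)))"
proof -
  have "Poly_Mapping.single (w(i := scw c u)) 1 - Poly_Mapping.single (w(i := u)) c
        \<in> multilinear_relations scw l W"
    unfolding multilinear_relations_def using assms by blast
  from relation_zero[OF this] show ?thesis by (simp add: ext.diff ext_single)
qed

lemma V_eq_span: "V = v.span (\<tau> ` PiE {..<l} W)"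
proof
  have V: "V = free_extension scv \<tau> ` {p. Poly_Mapping.keys p \<subseteq> PiE {..<l} W}"
    using tensor by (simp add: is_tensor_product_def is_free_quotient_def)
  show "V \<subseteq> v.span (\<tau> ` PiE {..<l} W)"
  proof
    fix y assume "y \<in> V"
    then obtain p where p: "Poly_Mapping.keys p \<subseteq> PiE {..<l} W" "y = free_extension scv \<tau> p"
      unfolding V by blast
    show "y \<in> v.span (\<tau> ` PiE {..<l} W)" unfolding p(2) free_extension_def
      using p(1) by (intro v.span_sum v.span_scale v.span_base) blast
  qed
  have "\<tau> ` PiE {..<l} W \<subseteq> V" 
  proof
    fix y assume "y \<in> \<tau> ` PiE {..<l} W"
    then obtain x where "x \<in> PiE {..<l} W" "y = \<tau> x" by blast
    then show "y \<in> V" unfolding V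
      by (intro image_eqI[of _ _ "Poly_Mapping.single x 1"]) (auto simp: ext_single)
  qed
  moreover have "v.subspace V"
  proof (rule v.subspaceI)
    show "0 \<in> V" unfolding V by (intro image_eqI[of _ _ 0]) (auto simp: ext.zero)
  next
    fix x y assume "x \<in> V" "y \<in> V"
    then obtain p q where "x = free_extension scv \<tau> p" "y = free_extension scv \<tau> q"
      "Poly_Mapping.keys p \<subseteq> PiE {..<l} W" "Poly_Mapping.keys q \<subseteq> PiE {..<l} W"
      unfolding V by blast
    then show "x + y \<in> V" unfolding V using keys_add[of p q]
      by (intro image_eqI[of _ _ "p + q"]) (auto simp: ext.add)
  next
    fix c x assume "x \<in> V"
    then obtain p where "x = free_extension scv \<tau> p" "Poly_Mapping.keys p \<subseteq> PiE {..<l} W"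
      unfolding V by blast
    then show "scv c x \<in> V" unfolding V
      by (intro image_eqI[of _ _ "free_scale c p"])
        (auto simp: ext.scale in_keys_iff lookup_free_scale subset_iff)
  qed
  ultimately show "v.span (\<tau> ` PiE {..<l} W) \<subseteq> V" by (rule v.span_minimal)
qed

context
  fixes B :: "nat \<Rightarrow> 'w set"
  assumes B_ind: "\<And>i. i < l \<Longrightarrow> w.independent (B i)"
    and B_span: "\<And>i. i < l \<Longrightarrow> w.span (B i) = W i"
begin

lemma PiE_B_subset: "PiE {..<l} B \<subseteq> PiE {..<l} W"
  using B_span w.span_superset by (intro PiE_mono) auto

lemma span_pure_basis: "v.span (\<tau> ` PiE {..<l} B) = V"
proof -
  let ?S = "v.span (\<tau> ` PiE {..<l} B)"
  \<comment> \<open>Slots are converted one at a time: the first \<open>k\<close> hold arbitrary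
    vectors, the others basis vectors.\<close>
  have key: "k \<le> l \<Longrightarrow> \<forall>w \<in> PiE {..<l} W. (\<forall>i. k \<le> i \<longrightarrow> i < l \<longrightarrow> w i \<in> B i) \<longrightarrow> \<tau> w \<in> ?S" for k
  proof (induction k)
    case 0
    then show ?case by (auto intro!: v.span_base simp: PiE_iff)
  next
    case (Suc k)
    show ?case
    proof (intro ballI impI)
      fix w assume w: "w \<in> PiE {..<l} W" "\<forall>i. Suc k \<le> i \<longrightarrow> i < l \<longrightarrow> w i \<in> B i"
      have k: "k < l" using Suc by simp
      have "\<tau> (w(k := u)) \<in> ?S" if "u \<in> w.span (B k)" for u
      proof -
        have "u \<in> W k \<and> \<tau> (w(k := u)) \<in> ?S"
          using that
        proof (induction rule: w.span_induct_alt)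
          case base
          have 0: "0 \<in> W k" using subspace_W k by (simp add: w.subspace_0)
          then show ?case using \<tau>_scale[OF w(1) k 0, of 0] by (simp add: v.span_zero del: fun_upd_apply)
        next
          case (step c x y)
          have x: "x \<in> W k" using step B_span[OF k] w.span_base by blast
          have "\<tau> (w(k := x)) \<in> ?S"
            using Suc w k x step(1) by (intro Suc.IH[rule_format] upd_PiE) auto
          then show ?case
            using x step subspace_W[OF k] by (simp add: \<tau>_add[OF w(1) k] \<tau>_scale[OF w(1) k]
              w.subspace_add w.subspace_scale v.span_add v.span_scale
              del: fun_upd_apply)
        qed
        then show ?thesis ..
      qed
      from this[of "w k"] show "\<tau> w \<in> ?S" using w k B_span by (auto simp: PiE_iff)
    qed
  qed
  show ?thesis
  proof
    show "?S \<subseteq> V" unfolding V_eq_span using PiE_B_subset by (intro v.span_mono) auto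
    have "\<tau> ` PiE {..<l} W \<subseteq> ?S" using key[of l] by auto
    then show "V \<subseteq> ?S" unfolding V_eq_span by (rule v.span_minimal) simp
  qed
qed

text \<open>Products of coordinate functionals are multilinear, hence well defined on the tensor product.\<close>

lemma pure_basis_combination_zero:
  assumes S: "finite S" "S \<subseteq> PiE {..<l} B" and sum: "(\<Sum>b\<in>S. scv (c b) (\<tau> b)) = 0" and b: "b \<in> S"
  shows "c b = 0"
proof -
  interpret k: vector_space "(*) :: 'k \<Rightarrow> 'k \<Rightarrow> 'k"
    by unfold_locales (simp_all add: algebra_simps)
  define \<phi> where "\<phi> w = (\<Prod>i<l. w.representation (B i) (w i) (b i))" for w
  interpret \<phi>: Vector_Spaces.linear free_scale "(*)" "free_extension (*) \<phi>"
    by (rule free_extension_linear) unfold_locales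
  have \<phi>_single: "free_extension (*) \<phi> (Poly_Mapping.single x a) = a * \<phi> x" for x a
    by (rule free_extension_single) unfold_locales
  have \<phi>_upd: "\<phi> (w(i := u)) = w.representation (B i) u (b i) *
      (\<Prod>j\<in>{..<l} - {i}. w.representation (B j) (w j) (b j))" if "i < l" for w i u
  proof -
    have "(\<Prod>j\<in>{..<l} - {i}. w.representation (B j) ((w(i := u)) j) (b j)) =
        (\<Prod>j\<in>{..<l} - {i}. w.representation (B j) (w j) (b j))" by (rule prod.cong) auto
    then show ?thesis unfolding \<phi>_def using that by (subst prod.remove[of _ i]) auto
  qed
  have "free_extension (*) \<phi> p = 0" if p: "p \<in> multilinear_relations scw l W" for p
  proof -
    consider (add) w i u u' where "i < l" "u \<in> W i" "u' \<in> W i"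
        "p = Poly_Mapping.single (w(i := u + u')) 1
          - Poly_Mapping.single (w(i := u)) 1 - Poly_Mapping.single (w(i := u')) 1"
      | (scale) w i c u where "i < l" "u \<in> W i"
        "p = Poly_Mapping.single (w(i := scw c u)) 1 - Poly_Mapping.single (w(i := u)) c"
      using p unfolding multilinear_relations_def by blast
    then show ?thesis
    proof cases
      case add
      then have "w.representation (B i) (u + u') (b i) =
          w.representation (B i) u (b i) + w.representation (B i) u' (b i)"
        by (simp add: w.representation_add[OF B_ind] B_span)
      then show ?thesis unfolding add(4) \<phi>.diff \<phi>_single \<phi>_upd[OF add(1)]
        by (simp add: algebra_simps)
    next
      case scale
      then have "w.representation (B i) (scw c u) (b i) = c * w.representation (B i) u (b i)"
        by (simp add: w.representation_scale[OF B_ind] B_span)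
      then show ?thesis unfolding scale(3) \<phi>.diff \<phi>_single \<phi>_upd[OF scale(1)] by simp
    qed
  qed
  then have \<phi>0: "free_extension (*) \<phi> p = 0" if "p \<in> module.span free_scale (multilinear_relations scw l W)" for p
    using that by (rule \<phi>.eq_0_on_span)
  define p where "p = (\<Sum>x\<in>S. Poly_Mapping.single x (c x))"
  have "Poly_Mapping.keys p \<subseteq> (\<Union>x\<in>S. Poly_Mapping.keys (Poly_Mapping.single x (c x)))"
    unfolding p_def by (rule keys_sum)
  also have "\<dots> \<subseteq> S" by auto
  also have "\<dots> \<subseteq> PiE {..<l} W" using S PiE_B_subset by blast
  finally have "Poly_Mapping.keys p \<subseteq> PiE {..<l} W" .
  moreover have "free_extension scv \<tau> p = 0" unfolding p_def using sum by (simp add: ext.sum ext_single)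
  ultimately have "p \<in> module.span free_scale (multilinear_relations scw l W)"
    using tensor by (simp add: is_tensor_product_def is_free_quotient_def)
  then have "0 = free_extension (*) \<phi> p" using \<phi>0 by simp
  also have "\<dots> = (\<Sum>x\<in>S. c x * \<phi> x)" unfolding p_def by (simp add: \<phi>.sum \<phi>_single)
  \<comment> \<open>On tuples of basis vectors \<open>\<phi>\<close> is the Kronecker delta at
    \<open>b\<close>.\<close>
  also have "\<dots> = (\<Sum>x\<in>S. if x = b then c x else 0)"
  proof (rule sum.cong)
    fix x assume x: "x \<in> S"
    have rep: "w.representation (B i) (x i) (b i) = (if b i = x i then 1 else 0)" if "i < l" for i
    proof -
      have "x i \<in> B i" using x S that by (auto simp: PiE_iff)
      then show ?thesis using B_ind[OF that] by (simp add: w.representation_basis)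
    qed
    show "c x * \<phi> x = (if x = b then c x else 0)"
    proof (cases "x = b")
      case True
      then show ?thesis using rep by (simp add: \<phi>_def)
    next
      case False
      have "x \<in> PiE {..<l} B" "b \<in> PiE {..<l} B" using x b S by auto
      then obtain i where i: "i < l" "x i \<noteq> b i" using False PiE_ext[of x "{..<l}" B b] by blast
      then have "w.representation (B i) (x i) (b i) = 0" using rep[of i] by auto
      then have "\<phi> x = 0" using i(1) unfolding \<phi>_def by (intro prod_zero) auto
      then show ?thesis using False by simp
    qed
  qed simp
  also have "\<dots> = c b" using S b by simp
  finally show ?thesis by simp
qed

lemma inj_pure_basis: "inj_on \<tau> (PiE {..<l} B)"
proof (rule inj_onI, rule ccontr)
  fix b b' assume b: "b \<in> PiE {..<l} B" "b' \<in> PiE {..<l} B" "\<tau> b = \<tau> b'" "b \<noteq> b'"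
  have "(if b = b then 1 else - 1 :: 'k) = 0"
    by (rule pure_basis_combination_zero[of "{b, b'}" "\<lambda>x. if x = b then 1 else - 1"])
      (use b in auto)
  then show False by simp
qed

lemma independent_pure_basis: "v.independent (\<tau> ` PiE {..<l} B)"
proof
  assume "v.dependent (\<tau> ` PiE {..<l} B)"
  then obtain S u where S: "finite S" "S \<subseteq> \<tau> ` PiE {..<l} B" "(\<Sum>v\<in>S. scv (u v) v) = 0" "\<exists>v\<in>S. u v \<noteq> 0"
    unfolding v.dependent_explicit by blast
  obtain S' where S': "finite S'" "S' \<subseteq> PiE {..<l} B" "S = \<tau> ` S'"
    using S(1,2) by (meson finite_subset_image)
  have "inj_on \<tau> S'" using inj_pure_basis S'(2) by (rule inj_on_subset)
  then have "(\<Sum>b\<in>S'. scv (u (\<tau> b)) (\<tau> b)) = 0" using S(3) unfolding S'(3) by (simp add: sum.reindex)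
  then have "u (\<tau> b) = 0" if "b \<in> S'" for b
    by (rule pure_basis_combination_zero[OF S'(1,2) _ that, where c = "\<lambda>b. u (\<tau> b)"])
  then show False using S(4) unfolding S'(3) by blast
qed

end

end

section \<open>Locally nilpotent elements\<close>

context lie_algebra
begin

lemma bracket_add_right: "bracket x (y + z) = bracket x y + bracket x z"
proof -
  interpret r: Vector_Spaces.linear scale scale "\<lambda>y. bracket x y" by (rule linear_right)
  show ?thesis by (rule r.add)
qed
lemma bracket_scale_right: "bracket x (scale c y) = scale c (bracket x y)"
proof -
  interpret r: Vector_Spaces.linear scale scale "\<lambda>y. bracket x y" by (rule linear_right)
  show ?thesis by (rule r.scale)
qed
lemma bracket_add_left: "bracket (x + y) z = bracket x z + bracket y z"
proof -
  interpret r: Vector_Spaces.linear scale scale "\<lambda>x. bracket x z" by (rule linear_left)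
  show ?thesis by (rule r.add)
qed
lemma bracket_scale_left: "bracket (scale c x) z = scale c (bracket x z)"
proof -
  interpret r: Vector_Spaces.linear scale scale "\<lambda>x. bracket x z" by (rule linear_left)
  show ?thesis by (rule r.scale)
qed
lemma bracket_diff_left: "bracket (x - y) z = bracket x z - bracket y z"
  using bracket_add_left[of "x - y" y z] by simp
lemma bracket_diff_right: "bracket x (y - z) = bracket x y - bracket x z"
  using bracket_add_right[of x "y - z" z] by simp
lemma bracket_zero_left [simp]: "bracket 0 x = 0"
  using bracket_diff_left[of 0 0 x] by simp
lemma bracket_zero_right [simp]: "bracket x 0 = 0"
  using bracket_diff_right[of x 0 0] by simp
lemma bracket_antisym: "bracket y x = - bracket x y"
proof -
  have "0 = bracket (x + y) (x + y)" by (simp only: bracket_self)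
  also have "\<dots> = bracket x y + bracket y x"
    unfolding bracket_add_left bracket_add_right by (simp add: bracket_self)
  finally show ?thesis by (metis add.commute eq_neg_iff_add_eq_0)
qed
lemma bracket_minus_right: "bracket x (- y) = - bracket x y"
  using bracket_diff_right[of x 0 y] by simp
lemma bracket_minus_left: "bracket (- x) y = - bracket x y"
  using bracket_diff_left[of 0 x y] by simp
lemma bracket_sum_right: "bracket x (\<Sum>i\<in>I. f i) = (\<Sum>i\<in>I. bracket x (f i))"
  by (induction I rule: infinite_finite_induct) (simp_all add: bracket_add_right)

lemma bracket_bracket: "bracket (bracket x y) z = bracket x (bracket y z) - bracket y (bracket x z)"
proof -
  have "bracket z (bracket x y) = - bracket (bracket x y) z" "bracket z x = - bracket x z"
    by (rule bracket_antisym)+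
  then show ?thesis using jacobi[of x y z]
    by (simp add: bracket_minus_right algebra_simps)
qed

lemma adjoint_module: "lie_module scale bracket scale UNIV bracket"
  by unfold_locales
    (simp_all add: bracket_add_right bracket_scale_right bracket_add_left bracket_scale_left bracket_bracket)

end

context lie_module
begin

lemma V_zero [simp]: "0 \<in> V" using subspace_V by (rule module.subspace_0)
lemma V_add: "u \<in> V \<Longrightarrow> v \<in> V \<Longrightarrow> u + v \<in> V" using subspace_V by (rule module.subspace_add)
lemma V_diff: "u \<in> V \<Longrightarrow> v \<in> V \<Longrightarrow> u - v \<in> V" using subspace_V by (rule module.subspace_diff)
lemma V_scale: "v \<in> V \<Longrightarrow> mscale c v \<in> V" using subspace_V by (rule module.subspace_scale)
lemma V_sum: "(\<And>i. i \<in> I \<Longrightarrow> f i \<in> V) \<Longrightarrow> (\<Sum>i\<in>I. f i) \<in> V"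
  using subspace_V by (rule module.subspace_sum)

lemma act_zero_right [simp]: "act x 0 = 0"
  using act_scale_right[of 0 x 0] by simp
lemma act_zero_left [simp]: "v \<in> V \<Longrightarrow> act 0 v = 0"
  using act_scale_left[of v 0 0] by simp
lemma act_diff_right: "u \<in> V \<Longrightarrow> v \<in> V \<Longrightarrow> act x (u - v) = act x u - act x v"
  using act_add_right[of "u - v" v x] by (simp add: V_diff)
lemma act_sum_right: "(\<And>i. i \<in> I \<Longrightarrow> f i \<in> V) \<Longrightarrow> act x (\<Sum>i\<in>I. f i) = (\<Sum>i\<in>I. act x (f i))"
  by (induction I rule: infinite_finite_induct) (simp_all add: act_add_right V_sum)
lemma act_sum_left: "v \<in> V \<Longrightarrow> act (\<Sum>i\<in>I. f i) v = (\<Sum>i\<in>I. act (f i) v)"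
  by (induction I rule: infinite_finite_induct) (simp_all add: act_add_left)

lemma pow_closed: "v \<in> V \<Longrightarrow> (act x ^^ n) v \<in> V"
  by (induction n) (simp_all add: act_closed)
lemma pow_zero [simp]: "(act x ^^ n) 0 = 0"
  by (induction n) simp_all
lemma pow_add: "u \<in> V \<Longrightarrow> v \<in> V \<Longrightarrow> (act x ^^ n) (u + v) = (act x ^^ n) u + (act x ^^ n) v"
  by (induction n) (simp_all add: act_add_right pow_closed)
lemma pow_scale: "v \<in> V \<Longrightarrow> (act x ^^ n) (mscale c v) = mscale c ((act x ^^ n) v)"
  by (induction n) (simp_all add: act_scale_right pow_closed)
lemma pow_scale_left: "v \<in> V \<Longrightarrow> (act (scale c x) ^^ n) v = mscale (c ^ n) ((act x ^^ n) v)"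
  by (induction n) (simp_all add: act_scale_left act_scale_right pow_closed V_scale)
lemma pow_eq_0_mono: "(act x ^^ m) v = 0 \<Longrightarrow> m \<le> n \<Longrightarrow> (act x ^^ n) v = 0"
  by (metis comp_apply funpow_add le_add_diff_inverse2 pow_zero)

definition locally_nilpotent :: "'g \<Rightarrow> bool" where
  "locally_nilpotent x \<longleftrightarrow> (\<forall>v\<in>V. \<exists>n. (act x ^^ n) v = 0)"

lemma subspace_nilpotent_vectors: "module.subspace {v \<in> V. \<exists>n. (act x ^^ n) v = 0}"
proof (rule module.subspaceI)
  show "0 \<in> {v \<in> V. \<exists>n. (act x ^^ n) v = 0}" by (auto intro: exI[of _ 0])
next
  fix u v assume "u \<in> {v \<in> V. \<exists>n. (act x ^^ n) v = 0}" "v \<in> {v \<in> V. \<exists>n. (act x ^^ n) v = 0}"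
  then obtain m n where *: "u \<in> V" "v \<in> V" "(act x ^^ m) u = 0" "(act x ^^ n) v = 0" by blast
  then have "(act x ^^ max m n) (u + v) = 0" by (simp add: pow_add pow_eq_0_mono)
  then show "u + v \<in> {v \<in> V. \<exists>n. (act x ^^ n) v = 0}" using * V_add by blast
next
  fix c u assume "u \<in> {v \<in> V. \<exists>n. (act x ^^ n) v = 0}"
  then obtain m where *: "u \<in> V" "(act x ^^ m) u = 0" by blast
  then have "(act x ^^ m) (mscale c u) = 0" by (simp add: pow_scale)
  then show "mscale c u \<in> {v \<in> V. \<exists>n. (act x ^^ n) v = 0}" using * V_scale by blast
qed

text \<open>Leibniz rule and pigeonhole: of j + n applications of \<open>x\<close>, at least j fall
  on \<open>y\<close> or at least n fall on \<open>v\<close>. Peeling off one application at a time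
  avoids binomial coefficients.\<close>

lemma pow_act_eq_0:
  assumes "(bracket x ^^ j) y = 0" "v \<in> V" "(act x ^^ n) v = 0"
  shows "(act x ^^ (j + n)) (act y v) = 0"
  using assms
proof (induction "j + n" arbitrary: j n y v)
  case 0
  then show ?case by simp
next
  case (Suc k)
  show ?case
  proof (cases "j = 0 \<or> n = 0")
    case True
    then have "act y v = 0" using Suc.prems by auto
    then show ?thesis by simp
  next
    case False
    then obtain j' n' where jn: "j = Suc j'" "n = Suc n'" by (metis not0_implies_Suc)
    have k: "k = j' + n" "k = j + n'" using Suc.hyps(2) jn by auto
    have "(act x ^^ k) (act (bracket x y) v) = 0"
      unfolding k(1) using Suc.prems jn k by (intro Suc.hyps(1)) (auto simp: funpow_swap1)
    moreover have "(act x ^^ k) (act y (act x v)) = 0"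
      unfolding k(2) using Suc.prems jn k by (intro Suc.hyps(1)) (auto simp: funpow_swap1 act_closed)
    moreover have "act x (act y v) = act (bracket x y) v + act y (act x v)"
      using Suc.prems by (simp add: act_bracket)
    ultimately have "(act x ^^ k) (act x (act y v)) = 0"
      using Suc.prems(2) by (simp only: pow_add act_closed add_0)
    then show ?thesis using Suc.hyps(2)[symmetric] by (simp add: funpow_swap1)
  qed
qed

end

text \<open>Local nilpotency of ad x makes the vectors killed by some power of \<open>x\<close> a
  submodule, and simplicity leaves only the two extremes.\<close>

lemma (in simple_lie_module) injective_or_locally_nilpotent:
  assumes "\<And>y. \<exists>j. (bracket x ^^ j) y = 0"
  shows "(\<forall>v\<in>V. act x v = 0 \<longrightarrow> v = 0) \<or> locally_nilpotent x"
proof -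
  let ?U = "{v \<in> V. \<exists>n. (act x ^^ n) v = 0}"
  have "?U = {0} \<or> ?U = V"
  proof (rule submodules_trivial)
    show "module.subspace ?U" by (rule subspace_nilpotent_vectors)
  next
    fix y u assume "u \<in> ?U"
    then obtain n where *: "u \<in> V" "(act x ^^ n) u = 0" by blast
    obtain j where "(bracket x ^^ j) y = 0" using assms by blast
    then have "(act x ^^ (j + n)) (act y u) = 0" using * by (intro pow_act_eq_0)
    then show "act y u \<in> ?U" using * act_closed by blast
  qed blast
  moreover have "v = 0" if "?U = {0}" "v \<in> V" "act x v = 0" for v
  proof -
    have "(act x ^^ 1) v = 0" using that(3) by simp
    then have "v \<in> ?U" using that(2) by blast
    then show ?thesis using that(1) by blast
  qed
  moreover have "locally_nilpotent x" if "?U = V" using that by (auto simp: locally_nilpotent_def)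
  ultimately show ?thesis by blast
qed

section \<open>Exponentials of locally nilpotent elements\<close>

locale lie_module_char_0 = lie_module scale bracket mscale V act
  for scale :: "'k::field_char_0 \<Rightarrow> 'g::ab_group_add \<Rightarrow> 'g" and bracket :: "'g \<Rightarrow> 'g \<Rightarrow> 'g"
    and mscale :: "'k \<Rightarrow> 'v::ab_group_add \<Rightarrow> 'v" and V :: "'v set" and act :: "'g \<Rightarrow> 'v \<Rightarrow> 'v"
begin

sublocale ad: lie_module scale bracket scale UNIV bracket
  by (rule adjoint_module)

text \<open>Divided powers: with the factorials built in, the Leibniz rule has no binomial
  coefficients.\<close>

definition divided :: "'g \<Rightarrow> nat \<Rightarrow> 'v \<Rightarrow> 'v" where
  "divided x k v = mscale (inverse (fact k)) ((act x ^^ k) v)"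

definition ad_divided :: "'g \<Rightarrow> nat \<Rightarrow> 'g \<Rightarrow> 'g" where
  "ad_divided x k y = scale (inverse (fact k)) ((bracket x ^^ k) y)"

lemma divided_closed: "v \<in> V \<Longrightarrow> divided x k v \<in> V"
  by (simp add: divided_def V_scale pow_closed)

lemma inverse_fact_Suc: "of_nat (Suc k) * inverse (fact (Suc k)) = (inverse (fact k) :: 'k)"
  by (simp add: field_simps del: of_nat_Suc)

lemma act_divided: "v \<in> V \<Longrightarrow> act x (divided x k v) = mscale (of_nat (Suc k)) (divided x (Suc k) v)"
  unfolding divided_def module.scale_scale inverse_fact_Suc by (simp add: act_scale_right pow_closed)

lemma bracket_ad_divided: "bracket x (ad_divided x k y) = scale (of_nat (Suc k)) (ad_divided x (Suc k) y)"
  unfolding ad_divided_def scale_scale inverse_fact_Suc by (simp add: bracket_scale_right)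

text \<open>The induction multiplies by n + 1, the factor between \<open>act x\<close> of the n-th
  divided power and the next one; characteristic 0 permits cancelling it.\<close>

lemma divided_act:
  assumes "v \<in> V"
  shows "divided x n (act y v) = (\<Sum>k\<le>n. act (ad_divided x k y) (divided x (n - k) v))"
proof (induction n)
  case 0
  then show ?case by (simp add: divided_def ad_divided_def)
next
  case (Suc n)
  let ?a = "\<lambda>k. ad_divided x k y" and ?d = "\<lambda>k. divided x k v"
  have V: "?d k \<in> V" "act z (?d k) \<in> V" for k z by (simp_all add: divided_closed act_closed assms)
  have "mscale (of_nat (Suc n)) (divided x (Suc n) (act y v)) = act x (divided x n (act y v))"
    by (simp add: act_divided act_closed assms)
  also have "\<dots> = (\<Sum>k\<le>n. act x (act (?a k) (?d (n - k))))"
    unfolding Suc by (rule act_sum_right) (rule V)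
  also have "\<dots> = (\<Sum>k\<le>n. mscale (of_nat (Suc k)) (act (?a (Suc k)) (?d (n - k))) +
      mscale (of_nat (Suc n - k)) (act (?a k) (?d (Suc n - k))))"
  proof (rule sum.cong)
    fix k assume "k \<in> {..n}"
    then have k: "Suc n - k = Suc (n - k)" by auto
    have "act x (act (?a k) (?d (n - k))) =
        act (bracket x (?a k)) (?d (n - k)) + act (?a k) (act x (?d (n - k)))"
      using V by (simp add: act_bracket)
    then show "act x (act (?a k) (?d (n - k))) = mscale (of_nat (Suc k)) (act (?a (Suc k)) (?d (n - k))) +
      mscale (of_nat (Suc n - k)) (act (?a k) (?d (Suc n - k)))"
      unfolding k bracket_ad_divided act_divided[OF assms] using V
      by (simp add: act_scale_left act_scale_right del: of_nat_Suc)
  qed simp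
  \<comment> \<open>Both sums may run up to \<open>Suc n\<close>: the added terms, k = 0 in the
    first and k = Suc n in the second, have coefficient 0. The two coefficients at k then add up to
    \<open>Suc n\<close>.\<close>
  also have "\<dots> = (\<Sum>k\<le>Suc n. mscale (of_nat k) (act (?a k) (?d (Suc n - k)))) +
      (\<Sum>k\<le>Suc n. mscale (of_nat (Suc n - k)) (act (?a k) (?d (Suc n - k))))"
  proof -
    have "(\<Sum>k\<le>Suc n. mscale (of_nat k) (act (?a k) (?d (Suc n - k)))) =
        (\<Sum>k\<le>n. mscale (of_nat (Suc k)) (act (?a (Suc k)) (?d (n - k))))"
      unfolding sum.atMost_Suc_shift by (simp del: of_nat_Suc)
    moreover have "(\<Sum>k\<le>Suc n. mscale (of_nat (Suc n - k)) (act (?a k) (?d (Suc n - k)))) =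
        (\<Sum>k\<le>n. mscale (of_nat (Suc n - k)) (act (?a k) (?d (Suc n - k))))" by simp
    ultimately show ?thesis by (simp only: sum.distrib)
  qed
  also have "\<dots> = (\<Sum>k\<le>Suc n. mscale (of_nat (Suc n)) (act (?a k) (?d (Suc n - k))))"
    unfolding sum.distrib[symmetric] module.scale_left_distrib[symmetric] of_nat_add[symmetric]
    by (rule sum.cong) auto
  also have "\<dots> = mscale (of_nat (Suc n)) (\<Sum>k\<le>Suc n. act (?a k) (?d (Suc n - k)))"
    by (simp only: module.scale_sum_right)
  finally show ?case by (simp only: module.scale_cancel_left of_nat_eq_0_iff) simp
qed

text \<open>The series is cut at the first vanishing power, which depends on \<open>v\<close>; by
  \<open>exp_act_eq\<close> any later cut gives the same value.\<close>

definition exp_act :: "'g \<Rightarrow> 'v \<Rightarrow> 'v" where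
  "exp_act x v = (\<Sum>k<(LEAST n. (act x ^^ n) v = 0). divided x k v)"

lemma exp_act_eq:
  assumes "(act x ^^ m) v = 0"
  shows "exp_act x v = (\<Sum>k<m. divided x k v)"
proof -
  let ?n = "LEAST n. (act x ^^ n) v = 0"
  have n: "(act x ^^ ?n) v = 0" "?n \<le> m" using assms by (rule LeastI, intro Least_le)
  show ?thesis unfolding exp_act_def
    using n(2) by (intro sum.mono_neutral_left) (auto simp: divided_def pow_eq_0_mono[OF n(1)])
qed

lemma exp_act_zero [simp]: "exp_act x 0 = 0"
  by (subst exp_act_eq[of 0 x]) auto

lemma exp_act_add:
  assumes "locally_nilpotent x" "u \<in> V" "v \<in> V"
  shows "exp_act x (u + v) = exp_act x u + exp_act x v"
proof -
  obtain m n where "(act x ^^ m) u = 0" "(act x ^^ n) v = 0"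
    using assms unfolding locally_nilpotent_def by blast
  then have "(act x ^^ max m n) u = 0" "(act x ^^ max m n) v = 0" by (auto intro: pow_eq_0_mono)
  moreover from this have "(act x ^^ max m n) (u + v) = 0" by (simp add: pow_add assms)
  ultimately show ?thesis using assms
    by (simp add: exp_act_eq[of "max m n" x] divided_def pow_add module.scale_right_distrib sum.distrib)
qed

text \<open>exp(x) v = v + w where w is killed by a lower power of \<open>x\<close>. Induction gives
  u with exp(x) u = w, and then v - u is a preimage of \<open>v\<close>.\<close>

lemma exp_act_surj:
  assumes x: "locally_nilpotent x" and v: "v \<in> V" "(act x ^^ m) v = 0"
  shows "\<exists>u\<in>V. exp_act x u = v"
  using v
proof (induction m arbitrary: v)
  case 0
  then show ?case by (intro bexI[of _ 0]) auto
next
  case (Suc m)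
  let ?w = "\<Sum>k<m. divided x (Suc k) v"
  have w: "exp_act x v = v + ?w"
    using Suc.prems(2) by (simp add: exp_act_eq[of "Suc m" x] sum.lessThan_Suc_shift divided_def del: funpow.simps(2) sum.lessThan_Suc)
  have wV: "?w \<in> V" using Suc.prems by (intro V_sum divided_closed)
  have "(act x ^^ m) (divided x (Suc k) v) = 0" for k
  proof -
    have "(act x ^^ m) ((act x ^^ Suc k) v) = (act x ^^ (m + Suc k)) v"
      by (simp only: funpow_add comp_apply)
    also have "\<dots> = 0" using Suc.prems(2) by (rule pow_eq_0_mono) simp
    finally show ?thesis using Suc.prems(1) unfolding divided_def
      by (simp add: pow_scale pow_closed del: funpow.simps(2))
  qed
  moreover have "(act x ^^ m) (\<Sum>k\<in>K. f k) = (\<Sum>k\<in>K. (act x ^^ m) (f k))"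
    if "\<And>k. f k \<in> V" for f :: "nat \<Rightarrow> 'v" and K
    by (induction K rule: infinite_finite_induct) (simp_all add: pow_add V_sum that)
  ultimately have "(act x ^^ m) ?w = 0" using Suc.prems(1) divided_closed by simp
  then obtain u where u: "u \<in> V" "exp_act x u = ?w" using Suc.IH wV by blast
  have "exp_act x (v - u) + exp_act x u = v + ?w"
    using exp_act_add[OF x V_diff[OF Suc.prems(1) u(1)] u(1)] w by simp
  then show ?case using u Suc.prems V_diff by (intro bexI[of _ "v - u"]) auto
qed

definition exp_ad :: "'g \<Rightarrow> nat \<Rightarrow> 'g \<Rightarrow> 'g" where
  "exp_ad x N y = (\<Sum>k<N. ad_divided x k y)"

text \<open>This is exp(x) y exp(-x) = exp(ad x) y written without inverses; both sides are the
  double sum of the Leibniz terms.\<close>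

lemma exp_act_intertwines:
  assumes y: "(bracket x ^^ N) y = 0" and x: "locally_nilpotent x" and v: "v \<in> V"
  shows "exp_act x (act y v) = act (exp_ad x N y) (exp_act x v)"
proof -
  obtain m where m: "(act x ^^ m) v = 0" using x v unfolding locally_nilpotent_def by blast
  let ?f = "\<lambda>i j. act (ad_divided x i y) (divided x j v)"
  have f0: "?f i j = 0" if "N \<le> i \<or> m \<le> j" for i j
  proof (cases "N \<le> i")
    case True
    then show ?thesis using ad.pow_eq_0_mono[OF y] v by (simp add: ad_divided_def divided_closed)
  next
    case False
    then show ?thesis using that pow_eq_0_mono[OF m] by (simp add: divided_def)
  qed
  have "exp_act x (act y v) = (\<Sum>n<N + m. \<Sum>k\<le>n. ?f k (n - k))"
    by (simp add: exp_act_eq[OF pow_act_eq_0[OF y v m]] divided_act v)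
  also have "\<dots> = (\<Sum>(i, j)\<in>{(i, j). i + j < N + m}. ?f i j)"
    by (rule sum.triangle_reindex[symmetric])
  \<comment> \<open>The rectangle lies in the triangle, and outside it either the ad power of
    \<open>y\<close> or the power on \<open>v\<close> vanishes.\<close>
  also have "\<dots> = (\<Sum>(i, j)\<in>{..<N} \<times> {..<m}. ?f i j)"
  proof (rule sum.mono_neutral_right)
    have "{(i, j). i + j < N + m} \<subseteq> {..<N + m} \<times> {..<N + m}" by auto
    then show "finite {(i, j). i + j < N + m}" by (rule finite_subset) simp
    show "\<forall>p\<in>{(i, j). i + j < N + m} - {..<N} \<times> {..<m}. (case p of (i, j) \<Rightarrow> ?f i j) = 0"
    proof
      fix p assume "p \<in> {(i, j). i + j < N + m} - {..<N} \<times> {..<m}"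
      then show "(case p of (i, j) \<Rightarrow> ?f i j) = 0" using f0[of "fst p" "snd p"] by (cases p) auto
    qed
  qed auto
  also have "\<dots> = (\<Sum>i<N. act (ad_divided x i y) (\<Sum>j<m. divided x j v))"
    unfolding sum.cartesian_product[symmetric] using v
    by (intro sum.cong refl act_sum_right[symmetric]) (simp add: divided_closed)
  also have "\<dots> = act (exp_ad x N y) (exp_act x v)"
    unfolding exp_ad_def exp_act_eq[OF m] using v by (simp add: act_sum_left V_sum divided_closed)
  finally show ?thesis .
qed

text \<open>By the intertwining relation the element acts as the conjugate of \<open>y\<close> by
  exp(x), and surjectivity of exp(x) reaches every vector.\<close>

lemma locally_nilpotent_exp_ad:
  assumes y: "(bracket x ^^ N) y = 0" and "locally_nilpotent x" "locally_nilpotent y"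
  shows "locally_nilpotent (exp_ad x N y)"
  unfolding locally_nilpotent_def
proof
  fix w assume w: "w \<in> V"
  obtain v where v: "v \<in> V" "exp_act x v = w"
    using exp_act_surj[OF assms(2) w] assms(2) w unfolding locally_nilpotent_def by blast
  have "(act (exp_ad x N y) ^^ n) w = exp_act x ((act y ^^ n) v)" for n
    by (induction n) (simp_all add: v exp_act_intertwines[OF y assms(2)] pow_closed)
  moreover obtain n where "(act y ^^ n) v = 0" using assms(3) v unfolding locally_nilpotent_def by blast
  ultimately have "(act (exp_ad x N y) ^^ n) w = 0" by simp
  then show "\<exists>n. (act (exp_ad x N y) ^^ n) w = 0" by blast
qed

end

text \<open>In place of a Vandermonde matrix: for p of degree n, p(2t) - 2^n p(t) has no term of
  degree n, so induction gives the lower coefficients up to the nonzero factors 2^i - 2^n; the top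
  one then follows from t = 1.\<close>

lemma (in vector_space) polynomial_coefficients_in_subspace:
  fixes a :: "nat \<Rightarrow> 'b"
  assumes L: "subspace L" and k: "(2 :: 'a) \<noteq> 0" "\<And>i j. i < j \<Longrightarrow> (2 :: 'a) ^ i \<noteq> 2 ^ j"
    and "\<And>t. (\<Sum>i<n. scale (t ^ i) (a i)) \<in> L" and "i < n"
  shows "a i \<in> L"
  using assms(4,5)
proof (induction n arbitrary: a i)
  case 0
  then show ?case by simp
next
  case (Suc n)
  define b where "b i = scale (2 ^ i - 2 ^ n) (a i)" for i
  have "(\<Sum>i<n. scale (t ^ i) (b i)) \<in> L" for t
  proof -
    have "(\<Sum>i<Suc n. scale ((2 * t) ^ i) (a i)) - scale (2 ^ n) (\<Sum>i<Suc n. scale (t ^ i) (a i)) \<in> L"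
      using Suc.prems(1) L by (intro subspace_diff subspace_scale)
    also have "(\<Sum>i<Suc n. scale ((2 * t) ^ i) (a i)) - scale (2 ^ n) (\<Sum>i<Suc n. scale (t ^ i) (a i)) =
        (\<Sum>i<Suc n. scale (t ^ i) (b i))"
      unfolding scale_sum_right sum_subtractf[symmetric] b_def
      by (rule sum.cong) (simp_all add: power_mult_distrib scale_left_diff_distrib algebra_simps)
    also have "\<dots> = (\<Sum>i<n. scale (t ^ i) (b i))" by (simp add: b_def)
    finally show ?thesis .
  qed
  then have b: "b i \<in> L" if "i < n" for i using Suc.IH that by blast
  have a: "a i \<in> L" if "i < n" for i
  proof -
    have "scale (inverse (2 ^ i - 2 ^ n)) (b i) \<in> L" using b[OF that] L by (rule subspace_scale[rotated])
    then show ?thesis using k(2)[OF that] by (simp add: b_def)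
  qed
  have "(\<Sum>i<Suc n. scale (1 ^ i) (a i)) - (\<Sum>i<n. a i) \<in> L"
    using L a by (intro subspace_diff Suc.prems(1) subspace_sum) auto
  then have "a n \<in> L" by simp
  then show ?case using a Suc.prems(2) by (cases "i = n") auto
qed

section \<open>The subalgebra spanned by nilpotent elements\<close>

context lie_module_char_0
begin

text \<open>Nilpotency under ad is included because it makes exp(ad x) y a finite sum and lets the
  same conjugation be carried out in the adjoint module.\<close>

definition nilpotent_set :: "'g set" where
  "nilpotent_set = {x. locally_nilpotent x \<and> (\<forall>y. \<exists>n. (bracket x ^^ n) y = 0)}"

definition nilpotent_span :: "'g set" where
  "nilpotent_span = span nilpotent_set"

interpretation adc: lie_module_char_0 scale bracket scale UNIV bracket
  by unfold_locales

lemma nilpotent_set_iff: "x \<in> nilpotent_set \<longleftrightarrow> locally_nilpotent x \<and> ad.locally_nilpotent x"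
  by (simp add: nilpotent_set_def ad.locally_nilpotent_def)

text \<open>The polynomial t -> exp(t ad x) y takes all its values in \<open>nilpotent_set\<close>,
  and the bracket is its linear coefficient.\<close>

lemma bracket_nilpotent_set:
  assumes x: "x \<in> nilpotent_set" and y: "y \<in> nilpotent_set"
  shows "bracket x y \<in> nilpotent_span"
proof -
  obtain N where N: "(bracket x ^^ N) y = 0" using x by (auto simp: nilpotent_set_def)
  \<comment> \<open>\<open>N + 2\<close> instead of \<open>N\<close>, so that the coefficient with
    index 1 occurs even when \<open>N\<close> is 0.\<close>
  have N2: "(bracket x ^^ (N + 2)) y = 0" using N by (rule ad.pow_eq_0_mono) simp
  have "(\<Sum>k<N + 2. scale (t ^ k) (ad_divided x k y)) \<in> nilpotent_span" for t
  proof -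
    have pw: "(bracket (scale t x) ^^ k) z = scale (t ^ k) ((bracket x ^^ k) z)" for k z
      by (rule ad.pow_scale_left) simp
    have tx: "locally_nilpotent (scale t x)" "ad.locally_nilpotent (scale t x)"
      using x unfolding nilpotent_set_iff locally_nilpotent_def ad.locally_nilpotent_def
      by (auto simp: pow_scale_left pw)
    have 0: "(bracket (scale t x) ^^ (N + 2)) y = 0" using N2 unfolding pw by simp
    have "exp_ad (scale t x) (N + 2) y \<in> nilpotent_set"
      using locally_nilpotent_exp_ad[OF 0 tx(1)] adc.locally_nilpotent_exp_ad[OF 0 tx(2)] y
      unfolding nilpotent_set_iff adc.exp_ad_def adc.ad_divided_def exp_ad_def ad_divided_def by blast
    moreover have "exp_ad (scale t x) (N + 2) y = (\<Sum>k<N + 2. scale (t ^ k) (ad_divided x k y))"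
      unfolding exp_ad_def ad_divided_def pw by (simp add: mult.commute)
    ultimately show ?thesis unfolding nilpotent_span_def by (simp add: span_base)
  qed
  moreover have "(2 :: 'k) ^ i \<noteq> 2 ^ j" if "i < j" for i j
  proof -
    have "of_nat (2 ^ i) \<noteq> (of_nat (2 ^ j) :: 'k)" unfolding of_nat_eq_iff using that by simp
    then show ?thesis by simp
  qed
  ultimately have "ad_divided x 1 y \<in> nilpotent_span"
    unfolding nilpotent_span_def
    by (intro polynomial_coefficients_in_subspace[where n = "N + 2" and a = "\<lambda>k. ad_divided x k y"]) auto
  then show ?thesis by (simp add: ad_divided_def)
qed

lemma nilpotent_span_closed:
  assumes "x \<in> nilpotent_span" "y \<in> nilpotent_span"
  shows "bracket x y \<in> nilpotent_span"
proof -
  have 1: "bracket x y \<in> nilpotent_span" if x: "x \<in> nilpotent_set" and "y \<in> nilpotent_span" for x y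
    using that(2) unfolding nilpotent_span_def
  proof (induction rule: span_induct_alt)
    case (step c u v)
    have "bracket x u \<in> span nilpotent_set"
      using bracket_nilpotent_set[OF x step(1)] unfolding nilpotent_span_def .
    then show ?case using step by (simp add: bracket_add_right bracket_scale_right span_add span_scale)
  qed (simp add: span_zero)
  show ?thesis using assms(1) unfolding nilpotent_span_def
  proof (induction rule: span_induct_alt)
    case (step c u v)
    have "bracket u y \<in> span nilpotent_set"
      using 1[OF step(1) assms(2)] unfolding nilpotent_span_def .
    then show ?case using step by (simp add: bracket_add_left bracket_scale_left span_add span_scale)
  qed (simp add: span_zero)
qed

end

section \<open>Ordered monomials and local finiteness\<close>

context lie_module
begin

definition word :: "(nat \<Rightarrow> 'g) \<Rightarrow> nat list \<Rightarrow> 'v \<Rightarrow> 'v" where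
  "word xs w v = foldr (\<lambda>i. act (xs i)) w v"

text \<open>The filtration by length: \<open>d\<close> bounds the number of letters. Letters of
  larger index act first.\<close>

definition sorted_words :: "(nat \<Rightarrow> 'g) \<Rightarrow> nat \<Rightarrow> nat \<Rightarrow> 'v \<Rightarrow> 'v set" where
  "sorted_words xs n d v = {word xs w v | w. sorted w \<and> set w \<subseteq> {..<n} \<and> length w \<le> d}"

lemma word_simps [simp]: "word xs [] v = v" "word xs (i # w) v = act (xs i) (word xs w v)"
  by (simp_all add: word_def)

lemma word_closed: "v \<in> V \<Longrightarrow> word xs w v \<in> V"
  by (induction w) (simp_all add: act_closed)

lemma sorted_words_mono: "d \<le> e \<Longrightarrow> module.span (sorted_words xs n d v) \<subseteq> module.span (sorted_words xs n e v)"
  by (intro module.span_mono) (auto simp: sorted_words_def)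

text \<open>Straightening enters as a hypothesis, limited to words of length at most
  \<open>d\<close>, because this is applied inside the induction that proves straightening.\<close>

lemma act_span_sorted_words:
  assumes v: "v \<in> V" and k: "k < n"
    and straighten: "\<And>w. sorted w \<Longrightarrow> set w \<subseteq> {..<n} \<Longrightarrow> length w \<le> d \<Longrightarrow>
      act (xs k) (word xs w v) - word xs (insort k w) v \<in> module.span (sorted_words xs n (length w) v)"
    and u: "u \<in> module.span (sorted_words xs n d v)"
  shows "act (xs k) u \<in> module.span (sorted_words xs n (Suc d) v)"
proof -
  have "u \<in> V \<and> act (xs k) u \<in> module.span (sorted_words xs n (Suc d) v)"
    using u
  proof (induction rule: module.span_induct_alt)
    case base
    then show ?case by (simp add: module.span_zero)
  next
    case (step c x y)
    then obtain w where w: "x = word xs w v" "sorted w" "set w \<subseteq> {..<n}" "length w \<le> d"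
      unfolding sorted_words_def by blast
    have "word xs (insort k w) v \<in> sorted_words xs n (Suc d) v"
      unfolding sorted_words_def using w k
      by (intro CollectI exI[of _ "insort k w"]) (auto simp: sorted_insort set_insort_key)
    then have "word xs (insort k w) v \<in> module.span (sorted_words xs n (Suc d) v)"
      by (rule module.span_base)
    moreover have "act (xs k) x - word xs (insort k w) v \<in> module.span (sorted_words xs n (Suc d) v)"
      using straighten[OF w(2-4)] sorted_words_mono[of "length w" "Suc d" xs n v] w(1,4) by auto
    ultimately have "act (xs k) x \<in> module.span (sorted_words xs n (Suc d) v)"
      using module.span_add by fastforce
    moreover have "x \<in> V" using w v by (simp add: word_closed)
    ultimately show ?case using step
      by (simp add: act_add_right act_scale_right V_scale V_add module.span_add module.span_scale)
  qed
  then show ?thesis ..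
qed

text \<open>If the first letter j is smaller than i, then x_i x_j = x_j x_i + [x_i, x_j]. The
  bracket is a combination of single letters, so it yields shorter words, and induction on the
  length handles both terms.\<close>

lemma straighten_word:
  assumes v: "v \<in> V"
    and closed: "\<And>i j. i < n \<Longrightarrow> j < n \<Longrightarrow> bracket (xs i) (xs j) \<in> span (xs ` {..<n})"
    and "i < n" "sorted w" "set w \<subseteq> {..<n}"
  shows "act (xs i) (word xs w v) - word xs (insort i w) v \<in> module.span (sorted_words xs n (length w) v)"
  using assms(3-)
proof (induction "length w" arbitrary: i w rule: less_induct)
  case less
  show ?case
  proof (cases "\<exists>j w'. w = j # w' \<and> j < i")
    case False
    then have "insort i w = i # w" by (cases w) auto
    then show ?thesis by (simp add: module.span_zero)
  next
    case True
    then obtain j w' where w: "w = j # w'" and ji: "j < i" by blast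
    have w': "sorted w'" "set w' \<subseteq> {..<n}" "j < n" "length w' < length w" using less.prems w by auto
    define Z where "Z d = module.span (sorted_words xs n d v)" for d
    \<comment> \<open>For words no longer than w' the induction hypothesis straightens, so a letter
      raises the filtration by just one.\<close>
    have act_Z: "act (xs k) u \<in> Z (length w)" if "k < n" "u \<in> Z (length w')" for k u
    proof -
      have "act (xs k) u \<in> Z (Suc (length w'))"
        unfolding Z_def
      proof (rule act_span_sorted_words[OF v that(1)])
        fix t assume t: "sorted t" "set t \<subseteq> {..<n}" "length t \<le> length w'"
        then show "act (xs k) (word xs t v) - word xs (insort k t) v \<in> module.span (sorted_words xs n (length t) v)"
          using w'(4) that(1) by (intro less.hyps) auto
      qed (use that(2) in \<open>simp add: Z_def\<close>)
      then show ?thesis by (simp add: w)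
    qed
    let ?u = "word xs w' v"
    have u: "?u \<in> V" "?u \<in> Z (length w')"
      unfolding Z_def using v w' by (auto simp: word_closed sorted_words_def intro!: module.span_base)
    have d: "act (xs i) ?u - word xs (insort i w') v \<in> Z (length w')"
      unfolding Z_def using less.hyps[OF w'(4) less.prems(1) w'(1,2)] .
    have "act (xs j) (act (xs i) ?u - word xs (insort i w') v) \<in> Z (length w)"
      using act_Z[OF w'(3) d] .
    moreover have "act z ?u \<in> Z (length w)" if "z \<in> span (xs ` {..<n})" for z
      using that
    proof (induction rule: span_induct_alt)
      case base
      then show ?case using u by (simp add: Z_def module.span_zero)
    next
      case (step c x y)
      then have "act x ?u \<in> Z (length w)" using act_Z u by blast
      then show ?case using step u
        by (simp add: act_add_left act_scale_left Z_def module.span_add module.span_scale)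
    qed
    then have "act (bracket (xs i) (xs j)) ?u \<in> Z (length w)" using closed less.prems w'(3) by blast
    ultimately have "act (xs j) (act (xs i) ?u - word xs (insort i w') v) + act (bracket (xs i) (xs j)) ?u
        \<in> Z (length w)" unfolding Z_def by (rule module.span_add)
    moreover have "act (xs j) (act (xs i) ?u - word xs (insort i w') v) + act (bracket (xs i) (xs j)) ?u =
        act (xs i) (word xs w v) - word xs (insort i w) v"
      using u v ji by (simp add: w act_bracket act_diff_right act_closed word_closed)
    ultimately show ?thesis by (simp add: Z_def)
  qed
qed

lemma sorted_split_last:
  assumes "sorted w" "set w \<subseteq> {..<Suc n}"
  shows "\<exists>w' m. w = w' @ replicate m n \<and> sorted w' \<and> set w' \<subseteq> {..<n}"
  using assms
proof (induction w rule: rev_induct)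
  case (snoc k w)
  show ?case
  proof (cases "k = n")
    case True
    from snoc obtain w' m where "w = w' @ replicate m n" "sorted w'" "set w' \<subseteq> {..<n}"
      by (auto simp: sorted_append)
    then show ?thesis using True
      by (intro exI[of _ w'] exI[of _ "Suc m"]) (simp add: replicate_append_same)
  next
    case False
    then have "set (w @ [k]) \<subseteq> {..<n}" using snoc.prems by (force simp: sorted_append)
    then show ?thesis using snoc.prems by (intro exI[of _ "w @ [k]"] exI[of _ 0]) simp
  qed
qed (auto intro: exI[of _ 0])

text \<open>The block of the largest letter acts first, and its powers beyond a vanishing one all
  give 0, so only finitely many vectors are passed on to the smaller letters.\<close>

lemma finite_sorted_words:
  fixes xs :: "nat \<Rightarrow> 'g"
  assumes "v \<in> V" "\<And>i. i < n \<Longrightarrow> locally_nilpotent (xs i)"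
  shows "finite {word xs w v | w. sorted w \<and> set w \<subseteq> {..<n}}"
  using assms
proof (induction n arbitrary: v)
  case 0
  have "{word xs w v | w. sorted w \<and> set w \<subseteq> {..<0}} = {v}" by auto
  then show ?case by simp
next
  case (Suc n)
  obtain M where M: "(act (xs n) ^^ M) v = 0" using Suc.prems unfolding locally_nilpotent_def by blast
  let ?S = "\<lambda>v. {word xs w v | w. sorted w \<and> set w \<subseteq> {..<n}}"
  have "finite (\<Union>m\<le>M. ?S ((act (xs n) ^^ m) v))"
    using Suc.prems by (intro finite_UN_I finite_atMost Suc.IH) (auto simp: pow_closed)
  moreover have "{word xs w v | w. sorted w \<and> set w \<subseteq> {..<Suc n}} \<subseteq> (\<Union>m\<le>M. ?S ((act (xs n) ^^ m) v))"
  proof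
    fix x assume "x \<in> {word xs w v | w. sorted w \<and> set w \<subseteq> {..<Suc n}}"
    then obtain w where w: "x = word xs w v" "sorted w" "set w \<subseteq> {..<Suc n}" by blast
    obtain w' m where w': "w = w' @ replicate m n" "sorted w'" "set w' \<subseteq> {..<n}"
      using sorted_split_last[OF w(2,3)] by blast
    have "word xs (replicate m n) v = (act (xs n) ^^ m) v" for m by (induction m) simp_all
    then have x: "x = word xs w' ((act (xs n) ^^ m) v)" using w(1) w'(1) by (simp add: word_def)
    have "(act (xs n) ^^ m) v = (act (xs n) ^^ min m M) v"
      using pow_eq_0_mono[OF M, of m] M by (cases "m \<le> M") (auto simp: min_def)
    then show "x \<in> (\<Union>m\<le>M. ?S ((act (xs n) ^^ m) v))" using x w' by (intro UN_I[of "min m M"]) auto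
  qed
  ultimately show ?case by (rule finite_subset[rotated])
qed

text \<open>The spanning half of the Poincare--Birkhoff--Witt theorem: the ordered monomials applied to \<open>v\<close>
  already span the submodule generated by \<open>v\<close>, and only finitely many of them are nonzero.\<close>

lemma locally_finite_of_locally_nilpotent_basis:
  fixes xs :: "nat \<Rightarrow> 'g"
  assumes v: "v \<in> V"
    and closed: "\<And>i j. i < n \<Longrightarrow> j < n \<Longrightarrow> bracket (xs i) (xs j) \<in> span (xs ` {..<n})"
    and nil: "\<And>i. i < n \<Longrightarrow> locally_nilpotent (xs i)"
  shows "\<exists>U. module.subspace U \<and> U \<subseteq> V \<and> v \<in> U \<and> fin_dim mscale U \<and>
    (\<forall>x\<in>span (xs ` {..<n}). \<forall>u\<in>U. act x u \<in> U)"
proof (intro exI conjI ballI)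
  let ?S = "{word xs w v | w. sorted w \<and> set w \<subseteq> {..<n}}"
  let ?U = "module.span ?S"
  show "module.subspace ?U" by (rule module.subspace_span)
  show U: "?U \<subseteq> V" using subspace_V v by (intro module.span_minimal) (auto simp: word_closed)
  have "v \<in> ?S" by (intro CollectI exI[of _ "[]"]) simp
  then show "v \<in> ?U" by (rule module.span_base)
  show "fin_dim mscale ?U"
    unfolding fin_dim_def by (intro exI[of _ ?S] conjI finite_sorted_words[OF v nil]) simp_all
  fix x u assume x: "x \<in> span (xs ` {..<n})" and u: "u \<in> ?U"
  have "u \<in> V \<and> act (xs k) u \<in> ?U" if k: "k < n" for k
    using u
  proof (induction rule: module.span_induct_alt)
    case base
    then show ?case by (simp add: module.span_zero)
  next
    case (step c s y)
    then obtain w where w: "s = word xs w v" "sorted w" "set w \<subseteq> {..<n}" by blast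
    have sub: "module.span (sorted_words xs n d v) \<subseteq> ?U" for d
      by (intro module.span_mono) (auto simp: sorted_words_def)
    have "word xs (insort k w) v \<in> sorted_words xs n (Suc (length w)) v"
      unfolding sorted_words_def using w k
      by (intro CollectI exI[of _ "insort k w"]) (auto simp: sorted_insort set_insort_key)
    then have "word xs (insort k w) v \<in> ?U" using module.span_base sub by blast
    moreover have "act (xs k) s - word xs (insort k w) v \<in> ?U"
      using straighten_word[OF v closed k w(2,3)] sub w(1) by blast
    ultimately have s: "act (xs k) s \<in> ?U" using module.span_add by fastforce
    moreover have "s \<in> V" using w v by (simp add: word_closed)
    ultimately show ?case using step s
      by (simp add: act_add_right act_scale_right V_scale V_add module.span_add module.span_scale)
  qed
  then have act_xs: "act (xs k) u \<in> ?U" if "k < n" for k using that by blast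
  show "act x u \<in> ?U"
    using x
  proof (induction rule: span_induct_alt)
    case base
    then show ?case using u U by (simp add: module.span_zero subset_iff)
  next
    case (step c x y)
    have "u \<in> V" using u U by blast
    moreover have "act x u \<in> ?U" using step act_xs by blast
    ultimately show ?case using step
      by (simp add: act_add_left act_scale_left module.span_add module.span_scale)
  qed
qed

end

text \<open>The basis of the span is chosen inside \<open>nilpotent_set\<close>, since other
  elements of the span are not known to be locally nilpotent.\<close>

lemma (in lie_module_char_0) nilpotent_span_locally_finite:
  assumes "fin_dim scale (UNIV :: 'g set)" "v \<in> V"
  shows "\<exists>U. module.subspace U \<and> U \<subseteq> V \<and> v \<in> U \<and> fin_dim mscale U \<and>
    (\<forall>x\<in>nilpotent_span. \<forall>u\<in>U. act x u \<in> U)"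
proof -
  obtain B where B: "B \<subseteq> nilpotent_set" "independent B" "nilpotent_set \<subseteq> span B"
    by (rule basis_exists)
  have span: "span B = nilpotent_span"
    unfolding nilpotent_span_def using B by (metis span_mono span_span subset_antisym)
  obtain F where "finite F" "UNIV \<subseteq> span F" using assms(1) unfolding fin_dim_def by blast
  then have "finite B" using independent_span_bound[of F B] B(2) by auto
  then obtain n xs where xs: "B = xs ` {..<n::nat}"
    by (metis finite_imp_nat_seg_image_inj_on lessThan_def)
  have closed: "bracket (xs i) (xs j) \<in> span (xs ` {..<n})" if "i < n" "j < n" for i j
  proof -
    have "xs i \<in> nilpotent_set" "xs j \<in> nilpotent_set" using B(1) xs that by auto
    then show ?thesis unfolding xs[symmetric] span by (rule bracket_nilpotent_set)
  qed
  have nil: "locally_nilpotent (xs i)" if "i < n" for i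
    using B(1) xs that by (auto simp: nilpotent_set_def)
  have "span (xs ` {..<n}) = nilpotent_span" using span xs by simp
  with locally_finite_of_locally_nilpotent_basis[OF assms(2) closed nil] show ?thesis by simp
qed

section \<open>Roots\<close>

text \<open>The values of the weights \<open>wt\<close> off \<open>H\<close> carry no information.\<close>

locale root_decomposition = simple_lie_algebra scale bracket
  for scale :: "'k::field_char_0 \<Rightarrow> 'g::ab_group_add \<Rightarrow> 'g" and bracket :: "'g \<Rightarrow> 'g \<Rightarrow> 'g" +
  fixes H :: "'g set" and n :: nat and e :: "nat \<Rightarrow> 'g" and \<phi> :: "nat \<Rightarrow> 'g \<Rightarrow> 'k"
    and wt :: "nat \<Rightarrow> 'g \<Rightarrow> 'k"
  assumes coord_add: "i < n \<Longrightarrow> \<phi> i (x + y) = \<phi> i x + \<phi> i y"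
    and coord_scale: "i < n \<Longrightarrow> \<phi> i (scale c x) = c * \<phi> i x"
    and coord_basis: "i < n \<Longrightarrow> j < n \<Longrightarrow> \<phi> i (e j) = (if i = j then 1 else 0)"
    and expand: "x = (\<Sum>j<n. scale (\<phi> j x) (e j))"
    and weight_e: "j < n \<Longrightarrow> h \<in> H \<Longrightarrow> bracket h (e j) = scale (wt j h) (e j)"
    and centralizer_H: "x \<in> H \<longleftrightarrow> (\<forall>h\<in>H. bracket h x = 0)"
begin

interpretation ad: lie_module scale bracket scale UNIV bracket
  by (rule adjoint_module)

lemma fin_dim_UNIV: "fin_dim scale (UNIV :: 'g set)"
  unfolding fin_dim_def
proof (intro exI conjI)
  show "UNIV \<subseteq> span (e ` {..<n})"
  proof
    fix x
    show "x \<in> span (e ` {..<n})"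
      by (subst expand[of x]) (intro span_sum span_scale span_base, simp)
  qed
qed simp

lemma coord_zero [simp]: "i < n \<Longrightarrow> \<phi> i 0 = 0"
  using coord_scale[of i 0 0] by simp

lemma coord_sum: "i < n \<Longrightarrow> \<phi> i (\<Sum>k\<in>K. f k) = (\<Sum>k\<in>K. \<phi> i (f k))"
  by (induction K rule: infinite_finite_induct) (simp_all add: coord_add)

lemma coord_diff: "i < n \<Longrightarrow> \<phi> i (x - y) = \<phi> i x - \<phi> i y"
  using coord_add[of i "x - y" y] by simp

lemma coord_eqI: "(\<And>i. i < n \<Longrightarrow> \<phi> i x = \<phi> i y) \<Longrightarrow> x = y"
  by (subst expand[of x], subst expand[of y]) (intro sum.cong, auto)

lemma e_nonzero: "j < n \<Longrightarrow> e j \<noteq> 0"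
  using coord_basis[of j j] by auto

text \<open>\<alpha> may be any function and only its values on \<open>H\<close> count, so sums and
  negatives of roots are formed pointwise without regard to extensionality.\<close>

definition root_space :: "('g \<Rightarrow> 'k) \<Rightarrow> 'g set" where
  "root_space \<alpha> = {x. \<forall>h\<in>H. bracket h x = scale (\<alpha> h) x}"

definition nonzero_on_H :: "('g \<Rightarrow> 'k) \<Rightarrow> bool" where
  "nonzero_on_H \<alpha> \<longleftrightarrow> (\<exists>h\<in>H. \<alpha> h \<noteq> 0)"

lemma nonzero_uminus [simp]: "nonzero_on_H (- \<alpha>) \<longleftrightarrow> nonzero_on_H \<alpha>"
  by (simp add: nonzero_on_H_def)

lemma root_spaceD: "x \<in> root_space \<alpha> \<Longrightarrow> h \<in> H \<Longrightarrow> bracket h x = scale (\<alpha> h) x"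
  by (simp add: root_space_def)

lemma root_space_cong: "(\<And>h. h \<in> H \<Longrightarrow> \<alpha> h = \<beta> h) \<Longrightarrow> root_space \<alpha> = root_space \<beta>"
  by (simp add: root_space_def)

lemma root_space_zero: "\<not> nonzero_on_H \<alpha> \<Longrightarrow> root_space \<alpha> = H"
proof (rule set_eqI)
  fix x assume "\<not> nonzero_on_H \<alpha>"
  then have "x \<in> root_space \<alpha> \<longleftrightarrow> (\<forall>h\<in>H. bracket h x = 0)"
    by (simp add: root_space_def nonzero_on_H_def)
  also have "\<dots> \<longleftrightarrow> x \<in> H" by (rule centralizer_H[symmetric])
  finally show "x \<in> root_space \<alpha> \<longleftrightarrow> x \<in> H" .
qed

lemma subspace_root_space: "subspace (root_space \<alpha>)"
  by (rule subspaceI)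
    (auto simp: root_space_def bracket_add_right bracket_scale_right scale_right_distrib mult.commute)

lemma e_root_space: "j < n \<Longrightarrow> e j \<in> root_space (wt j)"
  by (simp add: root_space_def weight_e)

lemma bracket_root_space:
  assumes "x \<in> root_space \<alpha>" "y \<in> root_space \<beta>"
  shows "bracket x y \<in> root_space (\<alpha> + \<beta>)"
  unfolding root_space_def
proof (intro CollectI ballI)
  fix h assume h: "h \<in> H"
  have "bracket h (bracket x y) = bracket (bracket h x) y + bracket x (bracket h y)"
    by (simp add: bracket_bracket)
  then show "bracket h (bracket x y) = scale ((\<alpha> + \<beta>) h) (bracket x y)"
    using assms h by (simp add: root_spaceD bracket_scale_left bracket_scale_right scale_left_distrib)
qed

lemma root_space_induct:
  assumes "subspace P" "\<And>\<alpha> x. x \<in> root_space \<alpha> \<Longrightarrow> x \<in> P"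
  shows "x \<in> P"
proof -
  have "e j \<in> P" if "j < n" for j using assms(2) e_root_space[OF that] .
  then show ?thesis by (subst expand[of x]) (intro subspace_sum[OF assms(1)] subspace_scale[OF assms(1)], simp)
qed

lemma coord_root_space:
  assumes "x \<in> root_space \<alpha>" "j < n" "h \<in> H"
  shows "wt j h = \<alpha> h \<or> \<phi> j x = 0"
proof -
  have "bracket h x = (\<Sum>i<n. scale (\<phi> i x * wt i h) (e i))"
    by (subst expand[of x]) (simp add: bracket_sum_right bracket_scale_right weight_e[OF _ assms(3)])
  then have "\<phi> j (bracket h x) = (\<Sum>i<n. \<phi> i x * wt i h * \<phi> j (e i))"
    using assms by (simp add: coord_sum coord_scale)
  also have "\<dots> = (\<Sum>i<n. if i = j then \<phi> i x * wt i h else 0)"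
    using assms coord_basis by (intro sum.cong) auto
  finally have "\<phi> j (bracket h x) = \<phi> j x * wt j h" using assms by simp
  moreover have "\<phi> j (bracket h x) = \<alpha> h * \<phi> j x"
    using assms by (simp add: root_spaceD coord_scale)
  ultimately show ?thesis by auto
qed

lemma root_vector_weight:
  assumes "x \<in> root_space \<alpha>" "x \<noteq> 0"
  shows "\<exists>j<n. \<forall>h\<in>H. wt j h = \<alpha> h"
proof -
  obtain j where "j < n" "\<phi> j x \<noteq> 0" using coord_eqI[of x 0] assms(2) by auto
  then show ?thesis using coord_root_space[OF assms(1)] by blast
qed

lemma ad_pow_root_space:
  "x \<in> root_space \<alpha> \<Longrightarrow> y \<in> root_space \<beta> \<Longrightarrow> (bracket x ^^ k) y \<in> root_space (\<lambda>h. \<beta> h + of_nat k * \<alpha> h)"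
proof (induction k)
  case (Suc k)
  have "bracket x ((bracket x ^^ k) y) \<in> root_space (\<alpha> + (\<lambda>h. \<beta> h + of_nat k * \<alpha> h))"
    using Suc by (intro bracket_root_space)
  moreover have "\<alpha> + (\<lambda>h. \<beta> h + of_nat k * \<alpha> h) = (\<lambda>h. \<beta> h + of_nat (Suc k) * \<alpha> h)"
    by (simp add: fun_eq_iff algebra_simps)
  ultimately show ?case by simp
qed simp

text \<open>The iterates have weights \<beta> + k\<alpha>, pairwise distinct in characteristic 0,
  while only the \<open>n\<close> weights \<open>wt j\<close> are available.\<close>

lemma ad_nilpotent:
  assumes x: "x \<in> root_space \<alpha>" and \<alpha>: "nonzero_on_H \<alpha>"
  shows "\<exists>k. (bracket x ^^ k) y = 0"
proof -
  obtain h where h: "h \<in> H" "\<alpha> h \<noteq> 0" using \<alpha> by (auto simp: nonzero_on_H_def)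
  have "y \<in> {y \<in> UNIV. \<exists>k. (bracket x ^^ k) y = 0}"
  proof (rule root_space_induct[OF ad.subspace_nilpotent_vectors])
    fix \<beta> z assume z: "z \<in> root_space \<beta>"
    have "\<exists>k. (bracket x ^^ k) z = 0"
    proof (rule ccontr)
      assume "\<nexists>k. (bracket x ^^ k) z = 0"
      then have "(bracket x ^^ k) z \<noteq> 0" for k by blast
      then have "\<exists>j<n. \<forall>h\<in>H. wt j h = \<beta> h + of_nat k * \<alpha> h" for k
        by (rule root_vector_weight[OF ad_pow_root_space[OF x z]])
      then have "\<forall>k. \<exists>j. j < n \<and> wt j h = \<beta> h + of_nat k * \<alpha> h" using h(1) by blast
      then obtain f where f: "\<forall>k. f k < n \<and> wt (f k) h = \<beta> h + of_nat k * \<alpha> h"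
        by (rule choice[THEN exE])
      have "inj f"
      proof (rule injI)
        fix k k' assume "f k = f k'"
        then have "\<beta> h + of_nat k * \<alpha> h = \<beta> h + of_nat k' * \<alpha> h"
          using f[rule_format, of k] f[rule_format, of k'] by (simp only:)
        then have "of_nat k * \<alpha> h = of_nat k' * \<alpha> h" by (simp only: add_left_cancel)
        then have "(of_nat k :: 'k) = of_nat k'" unfolding mult_right_cancel[OF h(2)] .
        then show "k = k'" by (simp only: of_nat_eq_iff)
      qed
      moreover have "range f \<subseteq> {..<n}" using f by blast
      then have "finite (range f)" by (rule finite_subset) simp
      ultimately show False using finite_imageD infinite_UNIV_nat by blast
    qed
    then show "z \<in> {y \<in> UNIV. \<exists>k. (bracket x ^^ k) y = 0}" by blast
  qed
  then show ?thesis by blast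
qed

text \<open>The center is an ideal, and it is proper because the algebra is not abelian.\<close>

lemma center_trivial:
  assumes "\<And>y. bracket x y = 0"
  shows "x = 0"
proof -
  let ?Z = "{x. \<forall>y. bracket x y = 0}"
  have "lie_ideal ?Z"
    unfolding lie_ideal_def
  proof (intro conjI allI ballI)
    show "subspace ?Z" by (rule subspaceI) (simp_all add: bracket_add_left bracket_scale_left)
    fix u z assume "z \<in> ?Z"
    then show "bracket u z \<in> ?Z" using bracket_antisym[of z u] by simp
  qed
  then have "?Z = {0} \<or> ?Z = UNIV" by (rule ideals_trivial)
  then show ?thesis using assms nonabelian by blast
qed

lemma bracket_opposite: "x \<in> root_space \<alpha> \<Longrightarrow> y \<in> root_space (- \<alpha>) \<Longrightarrow> bracket x y \<in> H"
  using bracket_root_space[of x \<alpha> y "- \<alpha>"] root_space_zero[of "\<alpha> + - \<alpha>"]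
  by (auto simp: nonzero_on_H_def)

end

subsection \<open>Strings\<close>

locale lie_algebra_char_0 = lie_algebra scale bracket
  for scale :: "'k::field_char_0 \<Rightarrow> 'g::ab_group_add \<Rightarrow> 'g" and bracket :: "'g \<Rightarrow> 'g \<Rightarrow> 'g"
begin

lemma weight_pow:
  assumes "bracket h y = scale a y" "bracket h v = scale c v"
  shows "bracket h ((bracket y ^^ j) v) = scale (c + of_nat j * a) ((bracket y ^^ j) v)"
proof (induction j)
  case (Suc j)
  have "bracket h (bracket y u) = bracket (bracket h y) u + bracket y (bracket h u)" for u
    by (simp add: bracket_bracket)
  then show ?case
    using Suc assms by (simp add: bracket_scale_left bracket_scale_right bracket_add_right scale_left_distrib algebra_simps)
qed (simp add: assms)

text \<open>The sl2 computation without normalisation: h = [x,y] has eigenvalue -a on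
  \<open>y\<close>, and a may be 0. The start of the string satisfies y x v = 0, which is weaker
  than the usual x v = 0; \<open>bracket_back_nonzero\<close> relies on this.\<close>

lemma string_step:
  assumes hy: "bracket (bracket x y) y = scale (- a) y" and hv: "bracket (bracket x y) v = scale c v"
    and yxv: "bracket y (bracket x v) = 0"
  shows "bracket x ((bracket y ^^ Suc j) v) =
    scale (of_nat (Suc j) * (c - a * of_nat j / 2)) ((bracket y ^^ j) v)"
proof (induction j)
  case 0
  have "bracket x (bracket y v) = bracket (bracket x y) v + bracket y (bracket x v)"
    by (simp add: bracket_bracket)
  then show ?case using hv yxv by simp
next
  case (Suc j)
  let ?u = "(bracket y ^^ Suc j) v"
  have "bracket x (bracket y ?u) = bracket (bracket x y) ?u + bracket y (bracket x ?u)"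
    by (simp only: bracket_bracket diff_add_cancel)
  also have "bracket (bracket x y) ?u = scale (c + of_nat (Suc j) * - a) ?u"
    by (rule weight_pow[OF hy hv])
  also have "bracket y (bracket x ?u) = scale (of_nat (Suc j) * (c - a * of_nat j / 2)) ?u"
    unfolding Suc by (simp add: bracket_scale_right)
  also have "scale (c + of_nat (Suc j) * - a) ?u + \<dots> =
      scale (of_nat (Suc (Suc j)) * (c - a * of_nat (Suc j) / 2)) ?u"
    unfolding scale_left_distrib[symmetric] by (simp add: field_simps)
  finally show ?case by simp
qed

text \<open>At the last nonzero vector of the string the factor in \<open>string_step\<close> has to
  vanish.\<close>

lemma string_top_weight:
  assumes "bracket (bracket x y) y = scale (- a) y" "bracket (bracket x y) v = scale c v"
    and "bracket y (bracket x v) = 0" and "v \<noteq> 0" and "\<exists>k. (bracket y ^^ k) v = 0"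
  shows "\<exists>j. c = a * of_nat j / 2"
proof -
  define k where "k = (LEAST k. (bracket y ^^ k) v = 0)"
  have k: "(bracket y ^^ k) v = 0" unfolding k_def using assms(5) by (rule LeastI_ex)
  obtain j where j: "k = Suc j" using k assms(4) by (cases k) auto
  have "(bracket y ^^ j) v \<noteq> 0" using not_less_Least[of j "\<lambda>k. (bracket y ^^ k) v = 0"] j k_def by simp
  moreover have "scale (of_nat (Suc j) * (c - a * of_nat j / 2)) ((bracket y ^^ j) v) = 0"
    using string_step[OF assms(1-3), of j] k unfolding j by simp
  ultimately have "of_nat (Suc j) * (c - a * of_nat j / 2) = 0" unfolding scale_eq_0_iff by blast
  then have "c - a * of_nat j / 2 = 0" by (simp del: of_nat_Suc)
  then show ?thesis by (intro exI[of _ j]) simp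
qed

text \<open>Climb to the end of the string with \<open>x\<close>, then descend with
  \<open>y\<close>. As a = 0 is allowed, the result also says that a = 0 forces c = 0, which is what
  \<open>opposite_bracket_zero\<close> exploits.\<close>

lemma weight_half_integral:
  assumes hx: "bracket (bracket x y) x = scale a x" and hy: "bracket (bracket x y) y = scale (- a) y"
    and hv: "bracket (bracket x y) v = scale c v" and "v \<noteq> 0"
    and nil: "\<And>v. \<exists>k. (bracket x ^^ k) v = 0" "\<And>v. \<exists>k. (bracket y ^^ k) v = 0"
  shows "\<exists>z. 2 * c = a * of_int z"
proof -
  define k where "k = (LEAST k. (bracket x ^^ k) v = 0)"
  have k: "(bracket x ^^ k) v = 0" unfolding k_def using nil(1) by (rule LeastI_ex)
  obtain m where m: "k = Suc m" using k assms(4) by (cases k) auto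
  let ?u = "(bracket x ^^ m) v"
  have "?u \<noteq> 0" using not_less_Least[of m "\<lambda>k. (bracket x ^^ k) v = 0"] m k_def by simp
  moreover have "bracket (bracket x y) ?u = scale (c + of_nat m * a) ?u"
    using hx hv by (rule weight_pow)
  moreover have "bracket y (bracket x ?u) = 0" using k m by simp
  ultimately obtain j where "c + of_nat m * a = a * of_nat j / 2"
    using string_top_weight[OF hy] nil(2) by blast
  then have "2 * c = a * of_int (int j - 2 * int m)" by (simp add: field_simps)
  then show ?thesis by blast
qed

end

subsection \<open>The Killing form\<close>

context root_decomposition
begin

interpretation ad: lie_module scale bracket scale UNIV bracket
  by (rule adjoint_module)

interpretation str: lie_algebra_char_0 scale bracket
  by unfold_locales

lemma opposite_weights:
  assumes "x \<in> root_space \<alpha>" "y \<in> root_space (- \<alpha>)"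
  shows "bracket (bracket x y) x = scale (\<alpha> (bracket x y)) x"
    and "bracket (bracket x y) y = scale (- \<alpha> (bracket x y)) y"
  using root_spaceD[OF assms(1) bracket_opposite[OF assms]] root_spaceD[OF assms(2) bracket_opposite[OF assms]]
  by simp_all

lemma weights_half_integral:
  assumes \<alpha>: "nonzero_on_H \<alpha>" and x: "x \<in> root_space \<alpha>" and y: "y \<in> root_space (- \<alpha>)" and j: "j < n"
  shows "\<exists>z. 2 * wt j (bracket x y) = \<alpha> (bracket x y) * of_int z"
proof (rule str.weight_half_integral[OF opposite_weights[OF x y]])
  show "bracket (bracket x y) (e j) = scale (wt j (bracket x y)) (e j)"
    using weight_e[OF j bracket_opposite[OF x y]] .
  show "\<exists>k. (bracket x ^^ k) v = 0" for v using ad_nilpotent[OF x \<alpha>] .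
  show "\<exists>k. (bracket y ^^ k) v = 0" for v using ad_nilpotent[OF y] \<alpha> by simp
qed (use e_nonzero[OF j] in simp)

lemma H_element_zero:
  assumes h: "h \<in> H" and "\<And>j. j < n \<Longrightarrow> wt j h = 0"
  shows "h = 0"
proof (rule center_trivial)
  fix y
  show "bracket h y = 0"
    by (subst expand[of y]) (simp add: bracket_sum_right bracket_scale_right weight_e[OF _ h] assms(2))
qed

lemma opposite_bracket_zero:
  assumes "nonzero_on_H \<alpha>" "x \<in> root_space \<alpha>" "y \<in> root_space (- \<alpha>)" "\<alpha> (bracket x y) = 0"
  shows "bracket x y = 0"
proof (rule H_element_zero[OF bracket_opposite[OF assms(2,3)]])
  fix j assume "j < n"
  then obtain z where "2 * wt j (bracket x y) = \<alpha> (bracket x y) * of_int z"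
    using weights_half_integral[OF assms(1-3)] by blast
  then show "wt j (bracket x y) = 0" using assms(4) by simp
qed

definition trace :: "('g \<Rightarrow> 'g) \<Rightarrow> 'k" where
  "trace f = (\<Sum>j<n. \<phi> j (f (e j)))"

definition killing :: "'g \<Rightarrow> 'g \<Rightarrow> 'k" where
  "killing x y = trace (\<lambda>z. bracket x (bracket y z))"

lemma trace_commute:
  assumes f: "\<And>x y. f (x + y) = f x + f y" "\<And>c x. f (scale c x) = scale c (f x)"
    and g: "\<And>x y. g (x + y) = g x + g y" "\<And>c x. g (scale c x) = scale c (g x)"
  shows "trace (\<lambda>z. f (g z)) = trace (\<lambda>z. g (f z))"
proof -
  have *: "trace (\<lambda>z. f (g z)) = (\<Sum>j<n. \<Sum>k<n. \<phi> k (g (e j)) * \<phi> j (f (e k)))"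
    if f: "\<And>x y. f (x + y) = f x + f y" "\<And>c x. f (scale c x) = scale c (f x)" for f g
    unfolding trace_def
  proof (rule sum.cong)
    fix j assume j: "j \<in> {..<n}"
    have f0: "f 0 = 0" using f(2)[of 0 0] by simp
    have f_sum: "f (\<Sum>k\<in>K. u k) = (\<Sum>k\<in>K. f (u k))" for u and K :: "nat set"
      by (induction K rule: infinite_finite_induct) (simp_all add: f f0)
    have "f (g (e j)) = (\<Sum>k<n. scale (\<phi> k (g (e j))) (f (e k)))"
      by (subst expand[of "g (e j)"]) (simp add: f_sum f(2))
    then show "\<phi> j (f (g (e j))) = (\<Sum>k<n. \<phi> k (g (e j)) * \<phi> j (f (e k)))"
      using j by (simp add: coord_sum coord_scale)
  qed simp
  have "trace (\<lambda>z. f (g z)) = (\<Sum>j<n. \<Sum>k<n. \<phi> k (g (e j)) * \<phi> j (f (e k)))"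
    by (rule *[OF f])
  also have "\<dots> = (\<Sum>k<n. \<Sum>j<n. \<phi> j (f (e k)) * \<phi> k (g (e j)))"
    by (subst sum.swap) (simp only: mult.commute)
  also have "\<dots> = trace (\<lambda>z. g (f z))" by (rule *[OF g, symmetric])
  finally show ?thesis .
qed

lemma trace_add: "trace (\<lambda>z. f z + g z) = trace f + trace g"
  by (simp add: trace_def coord_add sum.distrib)

lemma trace_diff: "trace (\<lambda>z. f z - g z) = trace f - trace g"
  by (simp add: trace_def coord_diff sum_subtractf)

lemma trace_scale: "trace (\<lambda>z. scale c (f z)) = c * trace f"
  by (simp add: trace_def coord_scale sum_distrib_left)

lemma killing_add_left: "killing (x + y) z = killing x z + killing y z"
  unfolding killing_def bracket_add_left trace_add ..

lemma killing_add_right: "killing z (x + y) = killing z x + killing z y"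
  unfolding killing_def bracket_add_left bracket_add_right trace_add ..

lemma killing_scale_left: "killing (scale c x) y = c * killing x y"
  unfolding killing_def bracket_scale_left trace_scale ..

lemma killing_scale_right: "killing x (scale c y) = c * killing x y"
  unfolding killing_def bracket_scale_left bracket_scale_right trace_scale ..

lemma killing_zero_right [simp]: "killing x 0 = 0"
  using killing_scale_right[of x 0 0] by simp

lemma killing_sum_right: "killing x (\<Sum>i\<in>I. f i) = (\<Sum>i\<in>I. killing x (f i))"
  by (induction I rule: infinite_finite_induct) (simp_all add: killing_add_right)

lemma killing_commute: "killing x y = killing y x"
  unfolding killing_def
  by (rule trace_commute) (simp_all add: bracket_add_right bracket_scale_right)

lemma killing_invariant: "killing (bracket x y) z = killing x (bracket y z)"
proof -
  have "trace (\<lambda>u. bracket y (bracket x (bracket z u))) = trace (\<lambda>u. bracket x (bracket z (bracket y u)))"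
    by (rule trace_commute) (simp_all add: bracket_add_right bracket_scale_right)
  then show ?thesis
    unfolding killing_def bracket_bracket bracket_diff_right trace_diff by simp
qed

lemma killing_H: "h \<in> H \<Longrightarrow> killing h h = (\<Sum>j<n. (wt j h)\<^sup>2)"
  unfolding killing_def trace_def
  by (rule sum.cong) (simp_all add: weight_e bracket_scale_right coord_scale coord_basis power2_eq_square)

text \<open>Over \<open>'k\<close> a sum of squares can vanish nontrivially; half-integrality
  reduces the sum in \<open>killing_H\<close> to integer squares, where it cannot.\<close>

lemma killing_coroot:
  assumes \<alpha>: "nonzero_on_H \<alpha>" and x: "x \<in> root_space \<alpha>" and y: "y \<in> root_space (- \<alpha>)"
    and 0: "killing (bracket x y) (bracket x y) = 0"
  shows "bracket x y = 0"
proof -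
  let ?h = "bracket x y"
  have "\<forall>j. \<exists>z. j < n \<longrightarrow> 2 * wt j ?h = \<alpha> ?h * of_int z"
    using weights_half_integral[OF \<alpha> x y] by blast
  then obtain z where z': "\<forall>j. j < n \<longrightarrow> 2 * wt j ?h = \<alpha> ?h * of_int (z j)"
    by (rule choice[THEN exE])
  then have z: "2 * wt j ?h = \<alpha> ?h * of_int (z j)" if "j < n" for j using that by blast
  have sq: "4 * (wt j ?h)\<^sup>2 = (\<alpha> ?h)\<^sup>2 * of_int ((z j)\<^sup>2)" if "j < n" for j
  proof -
    have "4 * (wt j ?h)\<^sup>2 = (2 * wt j ?h)\<^sup>2" by (simp add: power_mult_distrib)
    also have "\<dots> = (\<alpha> ?h)\<^sup>2 * of_int ((z j)\<^sup>2)" unfolding z[OF that] by (simp add: power_mult_distrib)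
    finally show ?thesis .
  qed
  have "0 = 4 * killing ?h ?h" using 0 by simp
  also have "\<dots> = (\<alpha> ?h)\<^sup>2 * of_int (\<Sum>j<n. (z j)\<^sup>2)"
    unfolding killing_H[OF bracket_opposite[OF x y]] of_int_sum sum_distrib_left
    by (intro sum.cong refl sq) simp
  finally have "(\<alpha> ?h)\<^sup>2 * of_int (\<Sum>j<n. (z j)\<^sup>2) = 0" by (rule sym)
  then have "\<alpha> ?h = 0 \<or> (\<Sum>j<n. (z j)\<^sup>2) = 0" unfolding mult_eq_0_iff of_int_eq_0_iff zero_eq_power2 .
  then have "wt j ?h = 0" if "j < n" for j
  proof
    assume "(\<Sum>j<n. (z j)\<^sup>2) = 0"
    then have "\<forall>j\<in>{..<n}. (z j)\<^sup>2 = 0" by (subst (asm) sum_nonneg_eq_0_iff) simp_all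
    then have "z j = 0" using that by simp
    then show ?thesis using z[OF that] by simp
  next
    assume "\<alpha> ?h = 0"
    then show ?thesis using z[OF that] by simp
  qed
  then show ?thesis by (rule H_element_zero[OF bracket_opposite[OF x y]])
qed

text \<open>Otherwise the nonzero root spaces span an ideal without component in \<open>H\<close>.
  It would have to be everything, whence H = 0, although some weight is nonzero on
  \<open>H\<close>.\<close>

lemma opposite_roots_noncommuting: "\<exists>\<alpha> x y. nonzero_on_H \<alpha> \<and> x \<in> root_space \<alpha> \<and> y \<in> root_space (- \<alpha>) \<and> bracket x y \<noteq> 0"
proof (rule ccontr)
  assume "\<not> ?thesis"
  then have no: "bracket x y = 0" if "nonzero_on_H \<alpha>" "x \<in> root_space \<alpha>" "y \<in> root_space (- \<alpha>)" for \<alpha> x y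
    using that by blast
  let ?R = "\<Union>\<alpha>\<in>{\<alpha>. nonzero_on_H \<alpha>}. root_space \<alpha>"
  have gen: "bracket u x \<in> span ?R" if u: "u \<in> root_space \<beta>" and x: "x \<in> ?R" for u x \<beta>
  proof -
    obtain \<alpha> where \<alpha>: "nonzero_on_H \<alpha>" "x \<in> root_space \<alpha>" using x by blast
    show ?thesis
    proof (cases "nonzero_on_H (\<beta> + \<alpha>)")
      case True
      then show ?thesis using bracket_root_space[OF u \<alpha>(2)] by (intro span_base) blast
    next
      case False
      then have "root_space \<beta> = root_space (- \<alpha>)"
        by (intro root_space_cong) (auto simp: nonzero_on_H_def eq_neg_iff_add_eq_0)
      then have "bracket x u = 0" using no[OF \<alpha>] u by blast
      then show ?thesis using bracket_antisym[of u x] by (simp add: span_zero)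
    qed
  qed
  have "lie_ideal (span ?R)"
    unfolding lie_ideal_def
  proof (intro conjI allI ballI)
    fix u x assume x: "x \<in> span ?R"
    have "u \<in> {u. \<forall>x\<in>span ?R. bracket u x \<in> span ?R}"
    proof (rule root_space_induct)
      show "subspace {u. \<forall>x\<in>span ?R. bracket u x \<in> span ?R}"
        by (rule subspaceI) (simp_all add: bracket_add_left bracket_scale_left span_add span_scale span_zero)
    next
      fix \<beta> u assume u: "u \<in> root_space \<beta>"
      have "bracket u x \<in> span ?R" if "x \<in> span ?R" for x
        using that
      proof (induction rule: span_induct_alt)
        case (step c a b)
        then show ?case using gen[OF u step(1)]
          by (simp add: bracket_add_right bracket_scale_right span_add span_scale)
      qed (simp add: span_zero)
      then show "u \<in> {u. \<forall>x\<in>span ?R. bracket u x \<in> span ?R}" by blast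
    qed
    then show "bracket u x \<in> span ?R" using x by blast
  qed simp
  then have "span ?R = {0} \<or> span ?R = UNIV" by (rule ideals_trivial)
  \<comment> \<open>If all weights vanished, the algebra would equal \<open>H\<close> and be
    abelian.\<close>
  moreover have "\<not> (\<forall>j<n. \<not> nonzero_on_H (wt j))"
  proof
    assume "\<forall>j<n. \<not> nonzero_on_H (wt j)"
    then have "e j \<in> H" if "j < n" for j using e_root_space[OF that] root_space_zero that by blast
    moreover have "subspace H" using subspace_root_space[of 0] root_space_zero[of 0] by (simp add: nonzero_on_H_def)
    ultimately have "x \<in> H" for x
      by (subst expand[of x]) (intro subspace_sum[of H] subspace_scale[of H], auto)
    then show False using nonabelian centralizer_H by blast
  qed
  then obtain j where j: "j < n" "nonzero_on_H (wt j)" by blast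
  then have "e j \<in> span ?R" using e_root_space by (intro span_base) blast
  then have "span ?R \<noteq> {0}" using e_nonzero[OF j(1)] by blast
  ultimately have U: "span ?R = UNIV" by blast
  \<comment> \<open>The coordinate of a basis vector of weight zero would vanish on every nonzero
    root space, hence everywhere.\<close>
  have nz: "nonzero_on_H (wt j)" if j: "j < n" for j
  proof (rule ccontr)
    assume j0: "\<not> nonzero_on_H (wt j)"
    have "\<phi> j x = 0" if "x \<in> span ?R" for x
      using that
    proof (induction rule: span_induct_alt)
      case (step c x y)
      then obtain \<alpha> h where "x \<in> root_space \<alpha>" "h \<in> H" "\<alpha> h \<noteq> 0" by (auto simp: nonzero_on_H_def)
      then have "\<phi> j x = 0" using coord_root_space[of x \<alpha> j h] j j0 by (auto simp: nonzero_on_H_def)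
      then show ?case using step j by (simp add: coord_add coord_scale)
    qed (use j in simp)
    then have "\<phi> j (e j) = 0" using U by blast
    then show False using coord_basis[OF j j] by simp
  qed
  have "h = 0" if h: "h \<in> H" for h
  proof (rule coord_eqI)
    fix i assume i: "i < n"
    have "h \<in> root_space 0" using h root_space_zero[of 0] by (simp add: nonzero_on_H_def)
    moreover obtain h' where "h' \<in> H" "wt i h' \<noteq> 0" using nz[OF i] by (auto simp: nonzero_on_H_def)
    ultimately show "\<phi> i h = \<phi> i 0" using coord_root_space[of h 0 i h'] i by simp
  qed
  then show False using nz[OF j(1)] weight_e[OF j(1)] e_nonzero[OF j(1)]
    by (metis bracket_zero_left nonzero_on_H_def scale_eq_0_iff)
qed

text \<open>The radical is an ideal by invariance, and it misses the bracket from
  \<open>opposite_roots_noncommuting\<close>, which pairs nontrivially with itself.\<close>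

lemma killing_nondegenerate:
  assumes "\<And>y. killing x y = 0"
  shows "x = 0"
proof -
  let ?Z = "{x. \<forall>y. killing x y = 0}"
  have "lie_ideal ?Z"
    unfolding lie_ideal_def
  proof (intro conjI allI ballI)
    show "subspace ?Z" by (rule subspaceI)
        (simp_all add: killing_add_left killing_scale_left killing_commute[of 0])
    fix u x assume x: "x \<in> ?Z"
    have "killing (bracket u x) y = 0" for y
    proof -
      have "killing (bracket u x) y = killing (bracket (- x) u) y"
        using bracket_antisym[of u x] by (simp add: bracket_minus_left)
      also have "\<dots> = killing (scale (- 1) x) (bracket u y)" by (simp add: killing_invariant)
      also have "\<dots> = 0" using x unfolding killing_scale_left by simp
      finally show ?thesis .
    qed
    then show "bracket u x \<in> ?Z" by blast
  qed
  then have "?Z = {0} \<or> ?Z = UNIV" by (rule ideals_trivial)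
  moreover obtain \<alpha> a b where "nonzero_on_H \<alpha>" "a \<in> root_space \<alpha>" "b \<in> root_space (- \<alpha>)" "bracket a b \<noteq> 0"
    using opposite_roots_noncommuting by blast
  then have "bracket a b \<notin> ?Z" using killing_coroot by blast
  ultimately show ?thesis using assms by blast
qed

text \<open>Nondegeneracy gives a basis vector pairing nontrivially with \<open>x\<close>;
  invariance forces its weight to be -\<alpha> and makes its bracket with \<open>x\<close> pair
  nontrivially with some h.\<close>

lemma opposite_partner:
  assumes \<alpha>: "nonzero_on_H \<alpha>" and x: "x \<in> root_space \<alpha>" "x \<noteq> 0"
  shows "\<exists>y\<in>root_space (- \<alpha>). bracket x y \<noteq> 0"
proof -
  obtain y where y: "killing x y \<noteq> 0" using killing_nondegenerate x(2) by blast
  have eq: "killing x y = (\<Sum>j<n. \<phi> j y * killing x (e j))"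
    by (subst expand[of y]) (simp add: killing_sum_right killing_scale_right)
  have "\<exists>j<n. killing x (e j) \<noteq> 0"
  proof (rule ccontr)
    assume "\<not> ?thesis"
    then have "killing x y = 0" unfolding eq by (intro sum.neutral) simp
    then show False using y by contradiction
  qed
  then obtain j where j: "j < n" "killing x (e j) \<noteq> 0" by blast
  have inv: "killing h (bracket x (e j)) = \<alpha> h * killing x (e j)" if h: "h \<in> H" for h
    unfolding killing_invariant[symmetric] root_spaceD[OF x(1) h] by (rule killing_scale_left)
  have "wt j h = - \<alpha> h" if h: "h \<in> H" for h
  proof -
    have "\<alpha> h * killing x (e j) = killing (bracket h x) (e j)"
      using root_spaceD[OF x(1) h] by (simp add: killing_scale_left)
    also have "bracket h x = scale (- 1) (bracket x h)" using bracket_antisym[of h x] by simp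
    also have "killing \<dots> (e j) = - killing x (bracket h (e j))"
      by (simp only: killing_scale_left killing_invariant mult_minus1)
    also have "\<dots> = - wt j h * killing x (e j)"
      by (simp add: weight_e[OF j(1) h] killing_scale_right)
    finally have "\<alpha> h = - wt j h" unfolding mult_right_cancel[OF j(2)] .
    then show ?thesis by simp
  qed
  then have "e j \<in> root_space (- \<alpha>)" using weight_e[OF j(1)] by (simp add: root_space_def)
  moreover obtain h where h: "h \<in> H" "\<alpha> h \<noteq> 0" using \<alpha> by (auto simp: nonzero_on_H_def)
  have "killing h (bracket x (e j)) \<noteq> 0" unfolding inv[OF h(1)] using h(2) j(2) by simp
  then have "bracket x (e j) \<noteq> 0" by (metis killing_zero_right)
  ultimately show ?thesis by blast
qed

end

section \<open>Root strings and linked roots\<close>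

context root_decomposition
begin

interpretation ad: lie_module scale bracket scale UNIV bracket
  by (rule adjoint_module)

interpretation str: lie_algebra_char_0 scale bracket
  by unfold_locales

lemma opposite_weights':
  assumes "x \<in> root_space \<alpha>" "y \<in> root_space (- \<alpha>)"
  shows "bracket (bracket y x) x = scale (- \<alpha> (bracket x y)) x"
  using opposite_weights(1)[OF assms] bracket_antisym[of y x] by (simp add: bracket_minus_left)

text \<open>A suitable z - t x commutes with \<open>y\<close>. As the start of a string along
  \<open>x\<close> its weight would have the wrong sign, so it is 0.\<close>

lemma root_space_one_dim:
  assumes \<alpha>: "nonzero_on_H \<alpha>" and x: "x \<in> root_space \<alpha>" "x \<noteq> 0" and z: "z \<in> root_space \<alpha>"
  shows "\<exists>c. z = scale c x"
proof -
  obtain y where y: "y \<in> root_space (- \<alpha>)" "bracket x y \<noteq> 0" using opposite_partner[OF \<alpha> x] by blast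
  define a where "a = \<alpha> (bracket x y)"
  have a: "a \<noteq> 0" using opposite_bracket_zero[OF \<alpha> x(1) y(1)] y(2) unfolding a_def by blast
  \<comment> \<open>Chosen so that \<alpha> vanishes at [z', y].\<close>
  define t where "t = \<alpha> (bracket z y) / a"
  define z' where "z' = z - scale t x"
  have z': "z' \<in> root_space \<alpha>"
    unfolding z'_def using x z subspace_root_space by (intro subspace_diff subspace_scale) auto
  \<comment> \<open>\<alpha> is an arbitrary function, so its value at [z', y] is computed through
    the action on the nonzero vector \<open>x\<close> instead of by linearity.\<close>
  have "scale (\<alpha> (bracket z' y)) x = bracket (bracket z' y) x"
    using root_spaceD[OF x(1) bracket_opposite[OF z' y(1)]] by simp
  also have "\<dots> = bracket (bracket z y) x - scale t (bracket (bracket x y) x)"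
    unfolding z'_def by (simp only: bracket_diff_left bracket_scale_left)
  also have "\<dots> = 0"
    unfolding root_spaceD[OF x(1) bracket_opposite[OF x(1) y(1)]] root_spaceD[OF x(1) bracket_opposite[OF z y(1)]]
    using a by (simp add: t_def a_def)
  finally have "\<alpha> (bracket z' y) = 0" using x(2) by simp
  then have z'y: "bracket z' y = 0" by (rule opposite_bracket_zero[OF \<alpha> z' y(1)])
  have "z' = 0"
  proof (rule ccontr)
    assume "z' \<noteq> 0"
    have "bracket (bracket y x) z' = scale (- a) z'"
      using root_spaceD[OF z' bracket_opposite[OF x(1) y(1)]] bracket_antisym[of y x]
      by (simp add: bracket_minus_left a_def)
    moreover have "bracket x (bracket y z') = 0" using z'y bracket_antisym[of y z'] by simp
    moreover have "\<exists>k. (bracket x ^^ k) z' = 0" using ad_nilpotent[OF x(1) \<alpha>] .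
    ultimately obtain j where j: "- a = a * of_nat j / 2"
      using str.string_top_weight[OF opposite_weights'[OF x(1) y(1)]] \<open>z' \<noteq> 0\<close> unfolding a_def by blast
    then have "a * of_nat j = - (a * 2)" by (simp add: field_simps)
    then have "a * of_nat (j + 2) = 0" by (simp add: distrib_left)
    then show False using a unfolding mult_eq_0_iff of_nat_eq_0_iff by simp
  qed
  then show ?thesis unfolding z'_def by auto
qed

text \<open>If y x u = 0, then u starts a string along \<open>y\<close> and x u one along
  \<open>x\<close>. The two string conditions read c = a j/2 and -(a + c) = a i/2, so a (i + j + 2)
  = 0.\<close>

lemma bracket_back_nonzero:
  assumes \<alpha>: "nonzero_on_H \<alpha>" and x: "x \<in> root_space \<alpha>" and u: "u \<in> root_space \<beta>" and xu: "bracket x u \<noteq> 0"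
  shows "\<exists>y\<in>root_space (- \<alpha>). bracket y (bracket x u) \<noteq> 0"
proof -
  have x0: "x \<noteq> 0" using xu by auto
  obtain y where y: "y \<in> root_space (- \<alpha>)" "bracket x y \<noteq> 0" using opposite_partner[OF \<alpha> x x0] by blast
  define a where "a = \<alpha> (bracket x y)"
  have a: "a \<noteq> 0" using opposite_bracket_zero[OF \<alpha> x y(1)] y(2) unfolding a_def by blast
  define c where "c = \<beta> (bracket x y)"
  have H: "bracket x y \<in> H" by (rule bracket_opposite[OF x y(1)])
  have "bracket y (bracket x u) \<noteq> 0"
  proof
    assume 0: "bracket y (bracket x u) = 0"
    have nil: "\<exists>k. (bracket x ^^ k) v = 0" "\<exists>k. (bracket y ^^ k) v = 0" for v
      using ad_nilpotent[OF x \<alpha>] ad_nilpotent[OF y(1)] \<alpha> by simp_all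
    have "u \<noteq> 0" using xu by auto
    then obtain j where j: "c = a * of_nat j / 2"
      using str.string_top_weight[OF opposite_weights(2)[OF x y(1)] root_spaceD[OF u H] 0 _ nil(2)]
      unfolding a_def c_def by blast
    have "bracket (bracket y x) (bracket x u) = scale (- (a + c)) (bracket x u)"
      using root_spaceD[OF bracket_root_space[OF x u] H] bracket_antisym[of y x]
      by (simp add: bracket_minus_left a_def c_def del: minus_add_distrib)
    moreover have "bracket x (bracket y (bracket x u)) = 0" using 0 by simp
    ultimately obtain i where i: "- (a + c) = a * of_nat i / 2"
      using str.string_top_weight[OF opposite_weights'[OF x y(1)] _ _ xu nil(1)] unfolding a_def by blast
    have "a * of_nat (i + j + 2) = 2 * (a * of_nat i / 2) + 2 * (a * of_nat j / 2) + 2 * a"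
      by (simp add: algebra_simps)
    also have "\<dots> = 0" unfolding i[symmetric] j[symmetric] by (simp add: algebra_simps)
    finally have "a * of_nat (i + j + 2) = 0" .
    then show False using a unfolding mult_eq_0_iff of_nat_eq_0_iff by simp
  qed
  then show ?thesis using y(1) by blast
qed

definition linked :: "('g \<Rightarrow> 'k) \<Rightarrow> ('g \<Rightarrow> 'k) \<Rightarrow> bool" where
  "linked \<alpha> \<beta> \<longleftrightarrow> (\<exists>x\<in>root_space \<alpha>. \<exists>y\<in>root_space \<beta>. bracket x y \<noteq> 0)"

lemma linked_sym: "linked \<alpha> \<beta> \<Longrightarrow> linked \<beta> \<alpha>"
  unfolding linked_def using bracket_antisym by (metis neg_equal_0_iff_equal)

lemma linked_back: "nonzero_on_H \<alpha> \<Longrightarrow> linked \<alpha> \<beta> \<Longrightarrow> linked (- \<alpha>) (\<alpha> + \<beta>)"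
  unfolding linked_def using bracket_back_nonzero bracket_root_space by meson

text \<open>Three uses of \<open>linked_back\<close> lead from the pair \<alpha>, \<beta> through
  \<alpha> + \<beta>, -\<alpha> and -(\<alpha> + \<beta>), \<beta> to -\<beta>, -\<alpha>.\<close>

lemma linked_uminus:
  assumes "nonzero_on_H \<alpha>" "nonzero_on_H \<beta>" "nonzero_on_H (\<alpha> + \<beta>)" "linked \<alpha> \<beta>"
  shows "linked (- \<alpha>) (- \<beta>)"
proof -
  have "linked (\<alpha> + \<beta>) (- \<alpha>)" using assms by (intro linked_sym[OF linked_back])
  from linked_back[OF assms(3) this] have "linked (- (\<alpha> + \<beta>)) \<beta>" by simp
  from linked_back[OF assms(2) linked_sym[OF this]] show ?thesis
    using linked_sym by (simp add: add.commute)
qed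

text \<open>\<open>P\<close> is a predicate on root spaces, so it sees \<alpha> only through its
  values on \<open>H\<close>. The link supplies a nonzero bracket, which spans the root space of the
  sum.\<close>

definition root_closed :: "('g set \<Rightarrow> bool) \<Rightarrow> bool" where
  "root_closed P \<longleftrightarrow> (\<forall>\<alpha> \<beta>. nonzero_on_H \<alpha> \<longrightarrow> nonzero_on_H \<beta> \<longrightarrow> nonzero_on_H (\<alpha> + \<beta>) \<longrightarrow>
     linked \<alpha> \<beta> \<longrightarrow> P (root_space \<alpha>) \<longrightarrow> P (root_space \<beta>) \<longrightarrow> P (root_space (\<alpha> + \<beta>)))"

definition exceptional :: "('g set \<Rightarrow> bool) \<Rightarrow> ('g \<Rightarrow> 'k) \<Rightarrow> bool" where
  "exceptional P \<alpha> \<longleftrightarrow> nonzero_on_H \<alpha> \<and> \<not> (P (root_space \<alpha>) \<and> P (root_space (- \<alpha>)))"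

lemma exceptional_uminus [simp]: "exceptional P (- \<alpha>) \<longleftrightarrow> exceptional P \<alpha>"
  by (auto simp: exceptional_def)

text \<open>Were \<delta> = \<beta> + \<alpha> not exceptional, closure applied to \<alpha> =
  \<delta> - \<beta> and -\<alpha> = -\<delta> + \<beta> would make \<alpha> non-exceptional;
  \<open>linked_back\<close> and \<open>linked_uminus\<close> provide the links.\<close>

lemma exceptional_add:
  assumes P: "root_closed P" and \<alpha>: "exceptional P \<alpha>" and \<beta>: "\<not> exceptional P \<beta>" "nonzero_on_H \<beta>"
    and linked: "linked \<beta> \<alpha>"
  shows "exceptional P (\<beta> + \<alpha>)"
proof (rule ccontr)
  let ?\<delta> = "\<beta> + \<alpha>"
  assume \<delta>: "\<not> exceptional P ?\<delta>"
  have \<alpha>0: "nonzero_on_H \<alpha>" using \<alpha> by (simp add: exceptional_def)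
  \<comment> \<open>If \<delta> vanished on \<open>H\<close>, then \<beta> and -\<alpha> would have
    the same root space, but exceptionality is invariant under sign.\<close>
  have \<delta>0: "nonzero_on_H ?\<delta>"
  proof (rule ccontr)
    assume "\<not> nonzero_on_H ?\<delta>"
    then have "\<beta> h = - \<alpha> h" if "h \<in> H" for h using that by (auto simp: nonzero_on_H_def eq_neg_iff_add_eq_0)
    then have "root_space \<beta> = root_space (- \<alpha>)" "root_space (- \<beta>) = root_space \<alpha>"
      by (auto intro!: root_space_cong)
    then show False using \<alpha> \<beta> by (simp add: exceptional_def)
  qed
  have closed: "P (root_space (\<gamma> + \<gamma>'))" if "nonzero_on_H \<gamma>" "nonzero_on_H \<gamma>'" "nonzero_on_H (\<gamma> + \<gamma>')"
    "linked \<gamma> \<gamma>'" "P (root_space \<gamma>)" "P (root_space \<gamma>')" for \<gamma> \<gamma>'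
    using P that unfolding root_closed_def by blast
  have l1: "linked ?\<delta> (- \<beta>)" using linked_back[OF \<beta>(2) linked] by (rule linked_sym)
  then have l2: "linked (- ?\<delta>) (- (- \<beta>))" using \<delta>0 \<beta>(2) \<alpha>0 by (intro linked_uminus) simp_all
  have Ps: "P (root_space ?\<delta>)" "P (root_space (- ?\<delta>))" "P (root_space \<beta>)" "P (root_space (- \<beta>))"
    using \<delta> \<beta> \<delta>0 unfolding exceptional_def by blast+
  have "P (root_space (?\<delta> + - \<beta>))" by (rule closed[OF \<delta>0 _ _ l1 Ps(1,4)]) (use \<beta>(2) \<alpha>0 in simp_all)
  moreover have "- ?\<delta> + - (- \<beta>) = - \<alpha>" by simp
  then have "P (root_space (- ?\<delta> + - (- \<beta>)))"
    by (intro closed[OF _ _ _ l2 Ps(2)]) (use \<delta>0 \<beta>(2) \<alpha>0 Ps in \<open>simp_all del: minus_add_distrib\<close>)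
  ultimately show False using \<alpha> \<open>- ?\<delta> + - (- \<beta>) = - \<alpha>\<close> by (simp add: exceptional_def)
qed

text \<open>If no root were exceptional for both, the two sets of exceptional root spaces would commute, and
  the centralizer of one of them would be a nonzero proper ideal.\<close>

lemma common_exceptional_root:
  assumes P: "root_closed P" "P {0}" and Q: "root_closed Q" "Q {0}"
    and ex: "\<exists>\<alpha>. exceptional P \<alpha>" "\<exists>\<alpha>. exceptional Q \<alpha>"
  shows "\<exists>\<alpha>. exceptional P \<alpha> \<and> exceptional Q \<alpha>"
proof (rule ccontr)
  assume "\<not> ?thesis"
  then have disj: "\<not> (exceptional P \<alpha> \<and> exceptional Q \<alpha>)" for \<alpha> by blast
  \<comment> \<open>Since \<open>P\<close> holds for the zero space, an exceptional root has a
    nonzero root vector, possibly after a change of sign.\<close>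
  have vec: "\<exists>\<alpha> x. exceptional P \<alpha> \<and> x \<in> root_space \<alpha> \<and> x \<noteq> 0" if "P {0}" "exceptional P \<alpha>" for P \<alpha>
  proof -
    have 0: "0 \<in> root_space \<beta>" for \<beta> using subspace_root_space by (rule subspace_0)
    have "root_space \<alpha> \<noteq> {0} \<or> root_space (- \<alpha>) \<noteq> {0}" using that by (auto simp: exceptional_def)
    then obtain x where "x \<noteq> 0" "x \<in> root_space \<alpha> \<or> x \<in> root_space (- \<alpha>)" using 0 by blast
    moreover have "exceptional P (- \<alpha>)" using that by simp
    ultimately show ?thesis using that(2) by blast
  qed
  obtain \<beta> x where x: "exceptional P \<beta>" "x \<in> root_space \<beta>" "x \<noteq> 0" using vec[of P] P ex by blast
  obtain \<alpha> y where y: "exceptional Q \<alpha>" "y \<in> root_space \<alpha>" "y \<noteq> 0" using vec[of Q] Q ex by blast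
  have nz: "nonzero_on_H \<gamma>" if "exceptional R \<gamma>" for R \<gamma> using that by (simp add: exceptional_def)
  let ?C = "{x. \<forall>\<alpha>. exceptional Q \<alpha> \<longrightarrow> (\<forall>y\<in>root_space \<alpha>. bracket x y = 0)}"
  \<comment> \<open>A nonzero bracket would make \<beta> + \<gamma> exceptional for both predicates,
    by \<open>exceptional_add\<close> used from either side.\<close>
  have "x \<in> ?C"
  proof (intro CollectI allI impI ballI, rule ccontr)
    fix \<gamma> z assume \<gamma>: "exceptional Q \<gamma>" and z: "z \<in> root_space \<gamma>" and "bracket x z \<noteq> 0"
    then have l: "linked \<beta> \<gamma>" using x(2) unfolding linked_def by blast
    have "exceptional Q (\<beta> + \<gamma>)"
      by (rule exceptional_add[OF Q(1) \<gamma> _ nz[OF x(1)] l]) (use disj x(1) in blast)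
    moreover have "exceptional P (\<gamma> + \<beta>)"
      by (rule exceptional_add[OF P(1) x(1) _ nz[OF \<gamma>] linked_sym[OF l]]) (use disj \<gamma> in blast)
    ultimately show False using disj[of "\<beta> + \<gamma>"] by (simp add: add.commute)
  qed
  have "lie_ideal ?C"
    unfolding lie_ideal_def
  proof (intro conjI allI ballI)
    show C: "subspace ?C" by (rule subspaceI) (simp_all add: bracket_add_left bracket_scale_left)
    fix u x assume x: "x \<in> ?C"
    have "u \<in> {u. \<forall>x\<in>?C. bracket u x \<in> ?C}"
    proof (rule root_space_induct)
      show "subspace {u. \<forall>x\<in>?C. bracket u x \<in> ?C}"
        by (rule subspaceI) (simp_all add: bracket_add_left bracket_scale_left)
    next
      fix \<gamma> u assume u: "u \<in> root_space \<gamma>"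
      show "u \<in> {u. \<forall>x\<in>?C. bracket u x \<in> ?C}"
      proof (intro CollectI ballI allI impI)
        fix x \<alpha> y assume x: "x \<in> ?C" and \<alpha>: "exceptional Q \<alpha>" and y: "y \<in> root_space \<alpha>"
        \<comment> \<open>Moving by a root that is not exceptional for \<open>Q\<close> keeps [u, y]
          in an exceptional root space; if \<gamma> vanishes on \<open>H\<close>, the root space
          does not even change.\<close>
        have uy: "bracket x (bracket u y) = 0" if "\<not> exceptional Q \<gamma>"
        proof (cases "bracket u y = 0")
          case False
          have "bracket u y \<in> root_space (\<gamma> + \<alpha>)" using u y by (rule bracket_root_space)
          moreover have "exceptional Q (\<gamma> + \<alpha>)"
          proof (cases "nonzero_on_H \<gamma>")
            case True
            have "linked \<gamma> \<alpha>" using False u y unfolding linked_def by blast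
            then show ?thesis by (rule exceptional_add[OF Q(1) \<alpha> that True])
          next
            case 0: False
            then have "root_space (\<gamma> + \<alpha>) = root_space \<alpha>" "root_space (- (\<gamma> + \<alpha>)) = root_space (- \<alpha>)"
              "nonzero_on_H (\<gamma> + \<alpha>) = nonzero_on_H \<alpha>"
              by (auto intro!: root_space_cong simp: nonzero_on_H_def)
            then show ?thesis using \<alpha> unfolding exceptional_def by simp
          qed
          ultimately show ?thesis using x by blast
        qed simp
        have xy: "bracket x y = 0" using x y \<alpha> by blast
        show "bracket (bracket u x) y = 0"
        proof (cases "exceptional Q \<gamma>")
          case True
          then have "bracket x u = 0" using x u by blast
          then have "bracket u x = 0" using bracket_antisym[of u x] by simp
          then show ?thesis by simp
        next
          case False
          then show ?thesis using uy xy by (simp add: bracket_bracket)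
        qed
      qed
    qed
    then show "bracket u x \<in> ?C" using x by blast
  qed
  then have "?C = {0} \<or> ?C = UNIV" by (rule ideals_trivial)
  then have C: "?C = UNIV" using \<open>x \<in> ?C\<close> x(3) by blast
  have "bracket y z = 0" for z
  proof -
    have "z \<in> ?C" unfolding C by simp
    then have "bracket z y = 0" using y by blast
    then show ?thesis using bracket_antisym[of y z] by simp
  qed
  then show False using center_trivial y(3) by blast
qed

end

section \<open>Simple weight modules\<close>

lemma (in vector_space) sum_eigenvectors_zero:
  assumes "finite K" and U: "subspace U"
    and T: "\<And>u v. u \<in> U \<Longrightarrow> v \<in> U \<Longrightarrow> T (u + v) = T u + T v" "\<And>c u. u \<in> U \<Longrightarrow> T (scale c u) = scale c (T u)"
    and "inj_on c K" "\<And>k. k \<in> K \<Longrightarrow> f k \<in> U" "\<And>k. k \<in> K \<Longrightarrow> T (f k) = scale (c k) (f k)"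
    and "(\<Sum>k\<in>K. f k) = 0"
  shows "\<forall>k\<in>K. f k = 0"
  using assms(1,5-)
proof (induction K arbitrary: f rule: finite_induct)
  case (insert m K)
  have T0: "T 0 = 0" using T(2)[OF subspace_0[OF U], of 0] by simp
  have T_sum: "T (\<Sum>k\<in>K. f k) = (\<Sum>k\<in>K. T (f k))" if "finite K" "\<forall>k\<in>K. f k \<in> U" for K
    using that
  proof (induction K rule: finite_induct)
    case (insert i K)
    then have "(\<Sum>k\<in>K. f k) \<in> U" using U by (intro subspace_sum) auto
    then show ?case using insert by (simp add: T(1))
  qed (simp add: T0)
  have fK: "\<forall>k\<in>K. f k \<in> U" using insert.prems(2) by blast
  have fm: "f m = - (\<Sum>k\<in>K. f k)" using insert.prems(4) insert.hyps by (simp add: eq_neg_iff_add_eq_0)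
  have fU: "f m \<in> U" "(\<Sum>k\<in>K. f k) \<in> U" using U insert.prems by (auto intro: subspace_sum)
  have "0 = T (f m + (\<Sum>k\<in>K. f k)) - scale (c m) (f m + (\<Sum>k\<in>K. f k))"
    using fm T0 by simp
  also have "\<dots> = T (\<Sum>k\<in>K. f k) - scale (c m) (\<Sum>k\<in>K. f k)"
    using T(1)[OF fU] insert.prems(3)[of m] by (simp add: scale_right_distrib)
  also have "\<dots> = (\<Sum>k\<in>K. scale (c k - c m) (f k))"
    unfolding T_sum[OF insert.hyps(1) fK] scale_sum_right sum_subtractf[symmetric]
    by (rule sum.cong) (simp_all add: insert.prems(3) scale_left_diff_distrib)
  finally have "(\<Sum>k\<in>K. scale (c k - c m) (f k)) = 0" by simp
  then have "\<forall>k\<in>K. scale (c k - c m) (f k) = 0"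
    using insert.prems U
    by (intro insert.IH) (auto simp: T(2) intro: subspace_scale)
  moreover have "c k - c m \<noteq> 0" if "k \<in> K" for k
    using insert.prems(1) insert.hyps(2) that by (auto simp: inj_on_def)
  ultimately have K: "\<forall>k\<in>K. f k = 0" by auto
  then have "f m = 0" using fm by simp
  then show ?case using K by simp
qed simp

text \<open>Eigenvectors for infinitely many eigenvalues would be independent. This excludes
  infinite weight strings in a finite-dimensional subspace.\<close>

lemma (in vector_space) fin_dim_eigenvectors:
  fixes f :: "nat \<Rightarrow> 'b"
  assumes fin: "fin_dim scale U" and U: "subspace U" "U \<subseteq> V" and V: "subspace V"
    and T: "\<And>u v. u \<in> V \<Longrightarrow> v \<in> V \<Longrightarrow> T (u + v) = T u + T v" "\<And>c u. u \<in> V \<Longrightarrow> T (scale c u) = scale c (T u)"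
    and c: "inj c" and f: "\<And>k. f k \<in> U" "\<And>k. T (f k) = scale (c k) (f k)"
  shows "\<exists>k. f k = 0"
proof (rule ccontr)
  assume nz: "\<not> ?thesis"
  have "inj f"
  proof (rule injI)
    fix i j assume "f i = f j"
    then have "scale (c i) (f i) = scale (c j) (f i)" by (metis f(2))
    then have "c i = c j" using nz unfolding scale_cancel_right by blast
    then show "i = j" using c by (simp add: inj_eq)
  qed
  have "independent (range f)"
  proof
    assume "dependent (range f)"
    then obtain S u where S: "finite S" "S \<subseteq> range f" "(\<Sum>v\<in>S. scale (u v) v) = 0" "\<exists>v\<in>S. u v \<noteq> 0"
      unfolding dependent_explicit by blast
    obtain K where K: "finite K" "S = f ` K" using S(1,2) by (meson finite_subset_image)
    have "(\<Sum>k\<in>K. scale (u (f k)) (f k)) = 0"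
      using S(3) unfolding K(2) by (subst (asm) sum.reindex) (use \<open>inj f\<close> in \<open>auto intro: inj_on_subset\<close>)
    then have "\<forall>k\<in>K. scale (u (f k)) (f k) = 0"
      using K(1) c f U(2) V
      by (intro sum_eigenvectors_zero[OF K(1) V T, where c = c])
        (auto simp: T(2) subset_iff mult.commute intro: inj_on_subset subspace_scale)
    then show False using S(4) nz unfolding K(2) by auto
  qed
  moreover obtain F where "finite F" "U \<subseteq> span F" using fin unfolding fin_dim_def by blast
  moreover have "range f \<subseteq> span F" using f(1) \<open>U \<subseteq> span F\<close> by blast
  ultimately have "finite (range f)" using independent_span_bound by blast
  then show False using \<open>inj f\<close> finite_imageD infinite_UNIV_nat by blast
qed

text \<open>The decomposition is a parameter and not built from \<open>V\<close>, so that two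
  modules can share one.\<close>

locale root_decomposition_module =
  root_decomposition scale bracket H n e \<phi> wt + simple_lie_module scale bracket mscale V act
  for scale :: "'k::field_char_0 \<Rightarrow> 'g::ab_group_add \<Rightarrow> 'g" and bracket :: "'g \<Rightarrow> 'g \<Rightarrow> 'g"
    and H :: "'g set" and n :: nat and e :: "nat \<Rightarrow> 'g" and \<phi> :: "nat \<Rightarrow> 'g \<Rightarrow> 'k"
    and wt :: "nat \<Rightarrow> 'g \<Rightarrow> 'k"
    and mscale :: "'k \<Rightarrow> 'v::ab_group_add \<Rightarrow> 'v" and V :: "'v set" and act :: "'g \<Rightarrow> 'v \<Rightarrow> 'v" +
  assumes weight: "weight_module scale H mscale V act"
begin

sublocale lie_module_char_0 scale bracket mscale V act
  by unfold_locales

definition weight_vector :: "('g \<Rightarrow> 'k) \<Rightarrow> 'v \<Rightarrow> bool" where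
  "weight_vector \<mu> v \<longleftrightarrow> v \<in> V \<and> v \<noteq> 0 \<and> (\<forall>h\<in>H. act h v = mscale (\<mu> h) v)"

lemma weight_vector_exists: "\<exists>\<mu> v. weight_vector \<mu> v"
proof (rule ccontr)
  assume no: "\<not> ?thesis"
  have "(\<Union>\<mu>\<in>dual_of scale H. weight_space H mscale V act \<mu>) \<subseteq> {0}"
    using no by (auto simp: weight_space_def weight_vector_def)
  then have "module.span (\<Union>\<mu>\<in>dual_of scale H. weight_space H mscale V act \<mu>) \<subseteq> {0}"
    by (rule module.span_minimal) (rule module.subspace_single_0)
  moreover have "module.span (\<Union>\<mu>\<in>dual_of scale H. weight_space H mscale V act \<mu>) = V"
    using weight by (simp add: weight_module_def internal_direct_sum_def)
  ultimately show False using nonzero V_zero by auto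
qed

lemma weight_pow_act:
  assumes "x \<in> root_space \<alpha>" "v \<in> V" "\<And>h. h \<in> H \<Longrightarrow> act h v = mscale (\<mu> h) v" "h \<in> H"
  shows "act h ((act x ^^ k) v) = mscale (\<mu> h + of_nat k * \<alpha> h) ((act x ^^ k) v)"
proof (induction k)
  case (Suc k)
  let ?u = "(act x ^^ k) v"
  have u: "?u \<in> V" using assms(2) by (rule pow_closed)
  have "act h (act x ?u) = act (bracket h x) ?u + act x (act h ?u)" using u by (simp add: act_bracket)
  also have "\<dots> = mscale (\<alpha> h) (act x ?u) + mscale (\<mu> h + of_nat k * \<alpha> h) (act x ?u)"
    unfolding Suc root_spaceD[OF assms(1,4)] using u by (simp add: act_scale_left act_scale_right)
  also have "\<dots> = mscale (\<mu> h + of_nat (Suc k) * \<alpha> h) (act x ?u)"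
    unfolding module.scale_left_distrib[symmetric] by (simp add: distrib_right add.left_commute)
  finally show ?case by simp
qed (use assms in simp)

lemma injective_or_nilpotent:
  assumes "x \<in> root_space \<alpha>" "nonzero_on_H \<alpha>"
  shows "(\<forall>v\<in>V. act x v = 0 \<longrightarrow> v = 0) \<or> locally_nilpotent x"
  using ad_nilpotent[OF assms] by (rule injective_or_locally_nilpotent)

text \<open>If \<open>x\<close> is not locally nilpotent it acts injectively, so no power of it
  kills \<open>v\<close>.\<close>

lemma weight_string:
  assumes x: "x \<in> root_space \<alpha>" and \<alpha>: "nonzero_on_H \<alpha>" and "\<not> locally_nilpotent x"
    and v: "weight_vector \<mu> v"
  shows "weight_vector (\<lambda>h. \<mu> h + of_nat k * \<alpha> h) ((act x ^^ k) v)"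
proof -
  have inj: "\<forall>v\<in>V. act x v = 0 \<longrightarrow> v = 0" using injective_or_nilpotent[OF x \<alpha>] assms(3) by blast
  have vV: "v \<in> V" "v \<noteq> 0" "\<And>h. h \<in> H \<Longrightarrow> act h v = mscale (\<mu> h) v"
    using v by (auto simp: weight_vector_def)
  have "(act x ^^ k) v \<noteq> 0"
  proof (induction k)
    case (Suc k)
    then show ?case using inj pow_closed[OF vV(1)] by auto
  qed (use vV in simp)
  then show ?thesis
    unfolding weight_vector_def using weight_pow_act[OF x vV(1,3)] pow_closed[OF vV(1)] by blast
qed

text \<open>Local finiteness confines the whole string of a weight vector to a finite-dimensional
  subspace, which cannot hold infinitely many weights.\<close>

lemma locally_nilpotent_of_span:
  assumes x: "x \<in> root_space \<alpha>" and \<alpha>: "nonzero_on_H \<alpha>" and L: "x \<in> nilpotent_span"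
  shows "locally_nilpotent x"
proof (rule ccontr)
  assume no: "\<not> ?thesis"
  obtain \<mu> v where v: "weight_vector \<mu> v" using weight_vector_exists by blast
  have vV: "v \<in> V" using v by (simp add: weight_vector_def)
  obtain h where h: "h \<in> H" "\<alpha> h \<noteq> 0" using \<alpha> by (auto simp: nonzero_on_H_def)
  obtain U where U: "module.subspace U" "U \<subseteq> V" "v \<in> U" "fin_dim mscale U" "\<And>u. u \<in> U \<Longrightarrow> act x u \<in> U"
    using nilpotent_span_locally_finite[OF fin_dim_UNIV vV] L by blast
  have wv: "weight_vector (\<lambda>h. \<mu> h + of_nat k * \<alpha> h) ((act x ^^ k) v)" for k
    by (rule weight_string[OF x \<alpha> no v])
  have "\<exists>k. (act x ^^ k) v = 0"
  proof (rule module.fin_dim_eigenvectors[OF U(4,1,2) subspace_V])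
    show "act h (u + w) = act h u + act h w" if "u \<in> V" "w \<in> V" for u w
      using that by (rule act_add_right)
    show "act h (mscale c u) = mscale c (act h u)" if "u \<in> V" for c u
      using that by (rule act_scale_right)
    show "inj (\<lambda>k. \<mu> h + of_nat k * \<alpha> h)" using h(2) by (auto intro: injI)
    show "(act x ^^ k) v \<in> U" for k by (induction k) (simp_all add: U(3,5))
    show "act h ((act x ^^ k) v) = mscale (\<mu> h + of_nat k * \<alpha> h) ((act x ^^ k) v)" for k
      using wv h(1) by (simp add: weight_vector_def)
  qed
  then show False using wv by (simp add: weight_vector_def)
qed

lemma root_closed_nilpotent: "root_closed (\<lambda>R. \<forall>x\<in>R. locally_nilpotent x)"
  unfolding root_closed_def
proof (intro allI impI ballI)
  fix \<alpha> \<beta> z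
  assume nz: "nonzero_on_H \<alpha>" "nonzero_on_H \<beta>" "nonzero_on_H (\<alpha> + \<beta>)" and "linked \<alpha> \<beta>"
    and nil: "\<forall>x\<in>root_space \<alpha>. locally_nilpotent x" "\<forall>x\<in>root_space \<beta>. locally_nilpotent x"
    and z: "z \<in> root_space (\<alpha> + \<beta>)"
  then obtain x y where x: "x \<in> root_space \<alpha>" and y: "y \<in> root_space \<beta>" and xy: "bracket x y \<noteq> 0"
    unfolding linked_def by blast
  have "x \<in> nilpotent_set" "y \<in> nilpotent_set"
    unfolding nilpotent_set_def using nil x y ad_nilpotent nz by blast+
  then have L: "bracket x y \<in> nilpotent_span" by (rule bracket_nilpotent_set)
  obtain c where "z = scale c (bracket x y)"
    using root_space_one_dim[OF nz(3) bracket_root_space[OF x y] xy z] by blast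
  then have "z \<in> nilpotent_span" using L unfolding nilpotent_span_def by (simp add: span_scale)
  then show "locally_nilpotent z" by (rule locally_nilpotent_of_span[OF z nz(3)])
qed

text \<open>Without exceptional roots the nilpotent elements span a nonzero ideal, hence everything,
  and local finiteness then gives a nonzero finite-dimensional submodule of the simple module
  \<open>V\<close>.\<close>

lemma exceptional_exists:
  assumes inf: "\<not> fin_dim mscale V"
  shows "\<exists>\<alpha>. exceptional (\<lambda>R. \<forall>x\<in>R. locally_nilpotent x) \<alpha>"
proof (rule ccontr)
  assume no: "\<not> ?thesis"
  have L: "x \<in> nilpotent_span" if "nonzero_on_H \<alpha>" "x \<in> root_space \<alpha>" for \<alpha> x
  proof -
    have "locally_nilpotent x" using no that unfolding exceptional_def by blast
    then have "x \<in> nilpotent_set" unfolding nilpotent_set_def using ad_nilpotent that by blast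
    then show ?thesis unfolding nilpotent_span_def by (rule span_base)
  qed
  have sub: "subspace nilpotent_span" by (simp add: nilpotent_span_def)
  have "lie_ideal nilpotent_span"
    unfolding lie_ideal_def
  proof (intro conjI allI ballI sub)
    fix u x assume x: "x \<in> nilpotent_span"
    have "u \<in> {u. bracket u x \<in> nilpotent_span}"
    proof (rule root_space_induct)
      show "subspace {u. bracket u x \<in> nilpotent_span}"
        using sub by (intro subspaceI)
          (simp_all add: bracket_add_left bracket_scale_left subspace_0 subspace_add subspace_scale)
    next
      fix \<beta> u assume u: "u \<in> root_space \<beta>"
      have "bracket u x \<in> nilpotent_span"
      proof (cases "nonzero_on_H \<beta>")
        case True
        then show ?thesis using nilpotent_span_closed L u x by blast
      next
        case False
        then have uH: "u \<in> H" using u root_space_zero by blast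
        \<comment> \<open>For \<open>u\<close> in \<open>H\<close> the basis vectors whose weight is
          0 at \<open>u\<close> drop out of [u, x], so brackets with \<open>H\<close> stay in the
          span although \<open>H\<close> is not yet known to lie in it.\<close>
        have terms: "scale (wt j u) (e j) \<in> nilpotent_span" if j: "j < n" for j
        proof (cases "wt j u = 0")
          case True
          then show ?thesis using sub by (simp add: subspace_0)
        next
          case False
          then have "nonzero_on_H (wt j)" using uH by (auto simp: nonzero_on_H_def)
          then show ?thesis using L e_root_space[OF j] sub by (intro subspace_scale)
        qed
        have "(\<Sum>j<n. scale (\<phi> j x) (scale (wt j u) (e j))) \<in> nilpotent_span"
        proof (intro subspace_sum[OF sub])
          fix j assume "j \<in> {..<n}"
          then have "scale (wt j u) (e j) \<in> nilpotent_span" using terms by simp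
          then show "scale (\<phi> j x) (scale (wt j u) (e j)) \<in> nilpotent_span" by (rule subspace_scale[OF sub])
        qed
        moreover have "bracket u x = (\<Sum>j<n. scale (\<phi> j x) (scale (wt j u) (e j)))"
          by (subst expand[of x]) (simp add: bracket_sum_right bracket_scale_right weight_e[OF _ uH])
        ultimately show ?thesis by simp
      qed
      then show "u \<in> {u. bracket u x \<in> nilpotent_span}" by blast
    qed
    then show "bracket u x \<in> nilpotent_span" by blast
  qed
  then have "nilpotent_span = {0} \<or> nilpotent_span = UNIV" by (rule ideals_trivial)
  moreover obtain \<alpha> x y where x: "nonzero_on_H \<alpha>" "x \<in> root_space \<alpha>" "bracket x y \<noteq> 0"
    using opposite_roots_noncommuting by blast
  have "x \<noteq> 0" using x(3) by auto
  ultimately have "nilpotent_span = UNIV" using L[OF x(1,2)] by blast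
  obtain \<mu> v where v: "v \<in> V" "v \<noteq> 0" using weight_vector_exists unfolding weight_vector_def by blast
  obtain U where U: "module.subspace U" "U \<subseteq> V" "v \<in> U" "fin_dim mscale U"
      "\<And>x u. u \<in> U \<Longrightarrow> act x u \<in> U"
    using nilpotent_span_locally_finite[OF fin_dim_UNIV v(1)] \<open>nilpotent_span = UNIV\<close> by blast
  have "U = {0} \<or> U = V" using U(1,2,5) by (rule submodules_trivial)
  then show False using U(3,4) v(2) inf by blast
qed

end

section \<open>The root decomposition seen from a faithful weight module\<close>

text \<open>The kernel of the action is an ideal. If it were everything, each line would be a
  submodule and \<open>V\<close> would be one-dimensional.\<close>

lemma (in simple_lie_module) act_faithful:
  assumes simple: "simple_lie_algebra scale bracket" and inf: "\<not> fin_dim mscale V"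
    and 0: "\<And>v. v \<in> V \<Longrightarrow> act x v = 0"
  shows "x = 0"
proof -
  interpret g: simple_lie_algebra scale bracket by fact
  let ?K = "{x. \<forall>v\<in>V. act x v = 0}"
  have "lie_ideal ?K"
    unfolding lie_ideal_def
    by (intro conjI allI ballI subspaceI) (simp_all add: act_add_left act_scale_left act_bracket act_closed)
  then have "?K = {0} \<or> ?K = UNIV" by (rule g.ideals_trivial)
  moreover have "?K \<noteq> UNIV"
  proof
    assume K: "?K = UNIV"
    have triv: "act y v = 0" if "v \<in> V" for y v
    proof -
      have "y \<in> ?K" unfolding K by simp
      then show ?thesis using that by blast
    qed
    obtain v where v: "v \<in> V" "v \<noteq> 0" using nonzero V_zero by blast
    let ?U = "module.span {v}"
    have sub: "?U \<subseteq> V" using v(1) subspace_V by (intro module.span_minimal) auto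
    have "?U = {0} \<or> ?U = V"
    proof (rule submodules_trivial[OF module.subspace_span sub])
      fix y u assume "u \<in> ?U"
      then have "act y u = 0" using sub triv by blast
      then show "act y u \<in> ?U" by (simp add: module.span_zero)
    qed
    moreover have "v \<in> ?U" by (simp add: module.span_base)
    ultimately have "V \<subseteq> ?U" using v(2) by blast
    then show False using inf unfolding fin_dim_def by blast
  qed
  ultimately have "?K = {0}" by blast
  moreover have "x \<in> ?K" using 0 by blast
  ultimately show ?thesis by blast
qed

text \<open>The matrix coefficients of \<open>g\<close> in a basis of weight vectors are eigenfunctionals for the adjoint
  action of \<open>H\<close> and separate the points of \<open>g\<close>; a dual basis to some of them consists of root vectors.\<close>

lemma root_decomposition_exists:
  fixes scg :: "'k::field_char_0 \<Rightarrow> 'g::ab_group_add \<Rightarrow> 'g"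
  assumes g: "simple_lie_algebra scg brg" "fin_dim scg UNIV" "lie_algebra.cartan_subalgebra scg brg H"
    and W: "simple_lie_module scg brg scw W act" "weight_module scg H scw W act" "\<not> fin_dim scw W"
  shows "\<exists>n e \<phi> wt. root_decomposition scg brg H n e \<phi> wt"
proof -
  interpret g: simple_lie_algebra scg brg by fact
  interpret W: simple_lie_module scg brg scw W act by fact
  have "vector_space scw" by unfold_locales
  then obtain B wtB where B: "weight_basis scw scg H act B wtB" "W.module.span B = W"
    using weight_basis_exists[of scw W H act scg] W.subspace_V W.act_add_right W.act_scale_right W(2) by blast
  interpret B: weight_basis scw scg H act B wtB by fact
  have BW: "b \<in> W" if "b \<in> B" for b using B(2) W.module.span_base that by blast
  have faithful: "x = 0" if x: "\<And>b. b \<in> B \<Longrightarrow> act x b = 0" for x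
  proof (rule W.act_faithful[OF g(1) W(3)])
    fix v assume "v \<in> W"
    then have "v \<in> W.module.span B" using B(2) by simp
    then have "v \<in> W \<and> act x v = 0"
    proof (induction rule: W.module.span_induct_alt)
      case (step c u w)
      then show ?case using x BW
        by (simp add: W.act_add_right W.act_scale_right W.V_add W.V_scale)
    qed simp
    then show "act x v = 0" ..
  qed
  \<comment> \<open>Diagonal operators commute, and the action is faithful.\<close>
  have abelian: "brg h h' = 0" if h: "h \<in> H" "h' \<in> H" for h h'
  proof (rule faithful)
    fix b assume b: "b \<in> B"
    then show "act (brg h h') b = 0"
      using h BW[OF b] by (simp add: W.act_bracket B.T_basis W.act_scale_right mult.commute)
  qed
  have H: "g.subspace H" "g.normalizer H = H"
    using g(3) by (simp_all add: g.cartan_subalgebra_def g.lie_subalgebra_def)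
  \<comment> \<open>An element commuting with \<open>H\<close> normalizes \<open>H\<close>, and
    \<open>H\<close> is its own normalizer.\<close>
  have centralizer: "x \<in> H \<longleftrightarrow> (\<forall>h\<in>H. brg h x = 0)" for x
  proof
    assume x: "\<forall>h\<in>H. brg h x = 0"
    have "brg x h = 0" if "h \<in> H" for h using x that g.bracket_antisym[of x h] by simp
    then have "x \<in> g.normalizer H" using g.subspace_0[OF H(1)] by (simp add: g.normalizer_def)
    then show "x \<in> H" using H(2) by simp
  qed (use abelian in blast)
  define \<Phi> where "\<Phi> = {\<lambda>x. W.module.representation B (act x b) b' | b b'. b \<in> B}"
  have \<Phi>_weight: "\<exists>c. \<forall>h\<in>H. \<forall>x. f (brg h x) = c h * f x" if f\<Phi>: "f \<in> \<Phi>" for f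
  proof -
    obtain b b' where f: "f = (\<lambda>x. W.module.representation B (act x b) b')" and b: "b \<in> B"
      using f\<Phi> unfolding \<Phi>_def by blast
    \<comment> \<open>The coefficient from b to b' has weight \<open>wtB b'\<close> minus
      \<open>wtB b\<close>.\<close>
    have "f (brg h x) = (wtB b' h - wtB b h) * f x" if h: "h \<in> H" for h x
    proof -
      have x: "act x b \<in> W" using BW[OF b] by (rule W.act_closed)
      have "act (brg h x) b = act h (act x b) - scw (wtB b h) (act x b)"
        using BW[OF b] B.T_basis[OF b h] by (simp add: W.act_bracket W.act_scale_right)
      moreover have sp: "act x b \<in> W.module.span B" using x B(2) by simp
      ultimately show ?thesis unfolding f
        by (simp add: W.module.representation_diff[OF B.independent_B]
            W.module.representation_scale[OF B.independent_B] B.T_rep[OF h sp]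
            W.module.span_scale left_diff_distrib)
    qed
    then show ?thesis by (intro exI[of _ "\<lambda>h. wtB b' h - wtB b h"]) simp
  qed
  have \<Phi>_linear: "f (x + y) = f x + f y" "f (scg c x) = c * f x" if f\<Phi>: "f \<in> \<Phi>" for f x y c
  proof -
    obtain b b' where f: "f = (\<lambda>x. W.module.representation B (act x b) b')" and b: "b \<in> B"
      using f\<Phi> unfolding \<Phi>_def by blast
    have sp: "act z b \<in> W.module.span B" for z using W.act_closed[OF BW[OF b]] B(2) by simp
    show "f (x + y) = f x + f y"
      unfolding f W.act_add_left[OF BW[OF b]] W.module.representation_add[OF B.independent_B sp sp] ..
    show "f (scg c x) = c * f x"
      unfolding f W.act_scale_left[OF BW[OF b]] W.module.representation_scale[OF B.independent_B sp] ..
  qed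
  obtain S where S: "finite S" "UNIV \<subseteq> g.span S" using g(2) unfolding fin_dim_def by blast
  have "\<exists>(n::nat) e f. (\<forall>i<n. f i \<in> \<Phi>) \<and> (\<forall>i<n. \<forall>j<n. f i (e j) = (if i = j then 1 else 0)) \<and>
           (\<forall>x. x = (\<Sum>j<n. scg (f j x) (e j)))"
  proof (rule g.biorthogonal_basis[OF S(1)])
    show "g.span S = UNIV" using S(2) by blast
    show "f (x + y) = f x + f y" if "f \<in> \<Phi>" for f x y using that by (rule \<Phi>_linear)
    show "f (scg c x) = c * f x" if "f \<in> \<Phi>" for f c x using that by (rule \<Phi>_linear)
    show "\<exists>f\<in>\<Phi>. f x \<noteq> 0" if x0: "x \<noteq> 0" for x
    proof -
      obtain b where b: "b \<in> B" "act x b \<noteq> 0" using faithful x0 by blast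
      have sp: "act x b \<in> W.module.span B" using W.act_closed[OF BW[OF b(1)]] B(2) by simp
      have "\<exists>b'. W.module.representation B (act x b) b' \<noteq> 0"
      proof (rule ccontr)
        assume "\<not> ?thesis"
        then have "{b'. W.module.representation B (act x b) b' \<noteq> 0} = {}" by blast
        then have "act x b = 0"
          using W.module.sum_nonzero_representation_eq[OF B.independent_B sp] by (simp only: sum.empty)
        then show False using b(2) by contradiction
      qed
      then obtain b' where b': "W.module.representation B (act x b) b' \<noteq> 0" ..
      have "(\<lambda>x. W.module.representation B (act x b) b') \<in> \<Phi>" unfolding \<Phi>_def using b(1) by blast
      then show ?thesis
        by (rule bexI[where P = "\<lambda>f. f x \<noteq> 0" and A = \<Phi>, rotated]) (rule b')
    qed
  qed
  then obtain n :: nat and e f where f: "\<And>i. i < n \<Longrightarrow> f i \<in> \<Phi>"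
    and fe: "\<And>i j. i < n \<Longrightarrow> j < n \<Longrightarrow> f i (e j) = (if i = j then 1 else 0)"
    and exp: "\<And>x. x = (\<Sum>j<n. scg (f j x) (e j))" by blast
  have "\<forall>i. \<exists>c. i < n \<longrightarrow> (\<forall>h\<in>H. \<forall>x. f i (brg h x) = c h * f i x)" using \<Phi>_weight f by blast
  then obtain c where c: "\<forall>i. i < n \<longrightarrow> (\<forall>h\<in>H. \<forall>x. f i (brg h x) = c i h * f i x)"
    by (rule choice[THEN exE])
  have "root_decomposition scg brg H n e f c"
  proof unfold_locales
    fix i x y k assume i: "i < n"
    show "f i (x + y) = f i x + f i y" "f i (scg k x) = k * f i x" using \<Phi>_linear[OF f[OF i]] by blast+
  next
    fix j h assume j: "j < n" and h: "h \<in> H"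
    have "brg h (e j) = (\<Sum>i<n. scg (f i (brg h (e j))) (e i))" by (rule exp)
    also have "\<dots> = (\<Sum>i<n. if i = j then scg (c j h) (e j) else 0)"
    proof (rule sum.cong)
      fix i assume "i \<in> {..<n}"
      then have "f i (brg h (e j)) = c i h * (if i = j then 1 else 0)" using c h fe[of i j] j by simp
      then show "scg (f i (brg h (e j))) (e i) = (if i = j then scg (c j h) (e j) else 0)" by simp
    qed simp
    finally show "brg h (e j) = scg (c j h) (e j)" using j by simp
  qed (use fe exp centralizer in blast)+
  then show ?thesis by blast
qed

text \<open>A common exceptional root gives each module an injective root vector for that root or
  its negative, with no control over which; \<open>s\<close> records the relative sign.\<close>

lemma parallel_weight_strings:
  fixes scg :: "'k::field_char_0 \<Rightarrow> 'g::ab_group_add \<Rightarrow> 'g"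
  assumes g: "simple_lie_algebra scg brg" "fin_dim scg UNIV" "lie_algebra.cartan_subalgebra scg brg H"
    and W: "simple_lie_module scg brg scw W act" "weight_module scg H scw W act" "\<not> fin_dim scw W"
    and W': "simple_lie_module scg brg scw' W' act'" "weight_module scg H scw' W' act'" "\<not> fin_dim scw' W'"
  shows "\<exists>\<alpha> \<mu> \<nu>. \<exists>s\<in>{1, - 1}. (\<exists>h\<in>H. \<alpha> h \<noteq> 0) \<and>
    (\<forall>k. \<exists>v\<in>W. v \<noteq> 0 \<and> (\<forall>h\<in>H. act h v = scw (\<mu> h + of_nat k * \<alpha> h) v)) \<and>
    (\<forall>k. \<exists>v\<in>W'. v \<noteq> 0 \<and> (\<forall>h\<in>H. act' h v = scw' (\<nu> h + of_nat k * (s * \<alpha> h)) v))"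
proof -
  obtain n e \<phi> wt where R: "root_decomposition scg brg H n e \<phi> wt"
    using root_decomposition_exists[OF g W] by blast
  interpret root_decomposition scg brg H n e \<phi> wt by fact
  interpret W: root_decomposition_module scg brg H n e \<phi> wt scw W act
    by (rule root_decomposition_module.intro[OF R W(1)]) (unfold_locales, fact)
  interpret W': root_decomposition_module scg brg H n e \<phi> wt scw' W' act'
    by (rule root_decomposition_module.intro[OF R W'(1)]) (unfold_locales, fact)
  have "\<exists>\<alpha>. exceptional (\<lambda>R. \<forall>x\<in>R. W.locally_nilpotent x) \<alpha> \<and>
      exceptional (\<lambda>R. \<forall>x\<in>R. W'.locally_nilpotent x) \<alpha>"
    using W.root_closed_nilpotent W'.root_closed_nilpotent W.exceptional_exists[OF W(3)]
      W'.exceptional_exists[OF W'(3)]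
    by (intro common_exceptional_root)
      (auto simp: W.locally_nilpotent_def W'.locally_nilpotent_def intro!: exI[of _ 1])
  then obtain \<alpha> where \<alpha>: "exceptional (\<lambda>R. \<forall>x\<in>R. W.locally_nilpotent x) \<alpha>"
      "exceptional (\<lambda>R. \<forall>x\<in>R. W'.locally_nilpotent x) \<alpha>" by blast
  have nz: "nonzero_on_H \<alpha>" using \<alpha>(1) by (simp add: exceptional_def)
  obtain \<beta> x where \<beta>: "\<beta> = \<alpha> \<or> \<beta> = - \<alpha>" and x: "x \<in> root_space \<beta>" "\<not> W.locally_nilpotent x"
    using \<alpha>(1) unfolding exceptional_def by blast
  obtain \<gamma> y where \<gamma>: "\<gamma> = \<alpha> \<or> \<gamma> = - \<alpha>" and y: "y \<in> root_space \<gamma>" "\<not> W'.locally_nilpotent y"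
    using \<alpha>(2) unfolding exceptional_def by blast
  have nz': "nonzero_on_H \<beta>" "nonzero_on_H \<gamma>" using nz \<beta> \<gamma> by auto
  obtain s :: 'k where s: "s \<in> {1, - 1}" "\<And>h. \<gamma> h = s * \<beta> h"
    using \<beta> \<gamma> that[of 1] that[of "- 1"] by auto
  obtain \<mu> v where v: "W.weight_vector \<mu> v" using W.weight_vector_exists by blast
  obtain \<nu> w where w: "W'.weight_vector \<nu> w" using W'.weight_vector_exists by blast
  have "\<exists>v\<in>W. v \<noteq> 0 \<and> (\<forall>h\<in>H. act h v = scw (\<mu> h + of_nat k * \<beta> h) v)" for k
    using W.weight_string[OF x(1) nz'(1) x(2) v, of k] unfolding W.weight_vector_def by blast
  moreover have "\<exists>v\<in>W'. v \<noteq> 0 \<and> (\<forall>h\<in>H. act' h v = scw' (\<nu> h + of_nat k * (s * \<beta> h)) v)" for k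
    using W'.weight_string[OF y(1) nz'(2) y(2) w, of k] unfolding W'.weight_vector_def s(2) by blast
  moreover have "\<exists>h\<in>H. \<beta> h \<noteq> 0" using nz'(1) by (simp add: nonzero_on_H_def)
  ultimately show ?thesis using s(1) by blast
qed

section \<open>Weights of tensor products\<close>

definition bounded_fibres :: "('a \<Rightarrow> 'b) \<Rightarrow> 'a set \<Rightarrow> bool" where
  "bounded_fibres f A \<longleftrightarrow> (\<exists>N. \<forall>y. finite {x \<in> A. f x = y} \<and> card {x \<in> A. f x = y} \<le> N)"

lemma (in weight_basis) admissible_iff_bounded_fibres:
  "admissible scg H scale (span B) T \<longleftrightarrow> bounded_fibres wt B"
  unfolding admissible_iff bounded_fibres_def
proof (rule arg_cong[where f = Ex], rule ext)
  fix N
  have e: "{b \<in> B. wt b = \<mu>} = {}" if "\<mu> \<notin> dual_of scg H" for \<mu> using wt_dual that by blast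
  show "(\<forall>\<mu>\<in>dual_of scg H. finite {b \<in> B. wt b = \<mu>} \<and> card {b \<in> B. wt b = \<mu>} \<le> N) =
      (\<forall>\<mu>. finite {b \<in> B. wt b = \<mu>} \<and> card {b \<in> B. wt b = \<mu>} \<le> N)"
  proof (intro iffI allI)
    fix \<mu> assume *: "\<forall>\<mu>\<in>dual_of scg H. finite {b \<in> B. wt b = \<mu>} \<and> card {b \<in> B. wt b = \<mu>} \<le> N"
    show "finite {b \<in> B. wt b = \<mu>} \<and> card {b \<in> B. wt b = \<mu>} \<le> N"
    proof (cases "\<mu> \<in> dual_of scg H")
      case False
      show ?thesis unfolding e[OF False] by simp
    qed (use * in blast)
  qed blast
qed

lemma bounded_fibres_image:
  assumes "inj_on \<tau> A" "\<And>x. x \<in> A \<Longrightarrow> g (\<tau> x) = f x"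
  shows "bounded_fibres g (\<tau> ` A) \<longleftrightarrow> bounded_fibres f A"
proof -
  have eq: "{v \<in> \<tau> ` A. g v = y} = \<tau> ` {x \<in> A. f x = y}" for y using assms(2) by auto
  have inj: "inj_on \<tau> {x \<in> A. f x = y}" for y using assms(1) by (rule inj_on_subset) blast
  show ?thesis unfolding bounded_fibres_def eq by (simp only: finite_image_iff[OF inj] card_image[OF inj])
qed

locale weight_families =
  fixes H :: "'g set" and l :: nat and B :: "nat \<Rightarrow> 'w set" and wt :: "nat \<Rightarrow> 'w \<Rightarrow> 'g \<Rightarrow> 'k::field"
  assumes wt_extensional: "i < l \<Longrightarrow> b \<in> B i \<Longrightarrow> wt i b \<in> extensional H"
begin

definition total_weight :: "(nat \<Rightarrow> 'w) \<Rightarrow> 'g \<Rightarrow> 'k" where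
  "total_weight b = (\<lambda>h\<in>H. \<Sum>i<l. wt i (b i) h)"

lemma total_weight_upd:
  assumes "i < l"
  shows "total_weight (b(i := x)) = (\<lambda>h\<in>H. wt i x h + (\<Sum>k\<in>{..<l} - {i}. wt k (b k) h))"
proof -
  have "(\<Sum>k<l. wt k ((b(i := x)) k) h) = wt i x h + (\<Sum>k\<in>{..<l} - {i}. wt k (b k) h)" for h
  proof -
    have "(\<Sum>k\<in>{..<l} - {i}. wt k ((b(i := x)) k) h) = (\<Sum>k\<in>{..<l} - {i}. wt k (b k) h)"
      by (rule sum.cong) auto
    then show ?thesis using assms by (subst sum.remove[of _ i]) auto
  qed
  then show ?thesis unfolding total_weight_def by simp
qed

lemma upd_PiE_B: "b \<in> PiE {..<l} B \<Longrightarrow> i < l \<Longrightarrow> x \<in> B i \<Longrightarrow> b(i := x) \<in> PiE {..<l} B"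
  by (auto simp: PiE_iff extensional_def)

text \<open>Once the entries in the finite factors are fixed, the total weight determines the weight
  of the remaining entry, which leaves at most \<open>N\<close> choices for each of the
  \<open>card P\<close> tuples.\<close>

lemma bounded_total_weight:
  assumes bounded: "\<And>i. i < l \<Longrightarrow> bounded_fibres (wt i) (B i)"
    and inf: "card {i. i < l \<and> infinite (B i)} \<le> 1"
  shows "bounded_fibres total_weight (PiE {..<l} B)"
proof (cases "\<exists>j<l. \<forall>i<l. i \<noteq> j \<longrightarrow> finite (B i)")
  case True
  then obtain j where j: "j < l" and fin: "\<And>i. i < l \<Longrightarrow> i \<noteq> j \<Longrightarrow> finite (B i)" by blast
  obtain N where N: "\<And>\<mu>. finite {x \<in> B j. wt j x = \<mu>}" "\<And>\<mu>. card {x \<in> B j. wt j x = \<mu>} \<le> N"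
    using bounded[OF j] unfolding bounded_fibres_def by blast
  define P where "P = PiE ({..<l} - {j}) B"
  have P: "finite P" unfolding P_def using fin by (intro finite_PiE) auto
  have "finite {b \<in> PiE {..<l} B. total_weight b = \<mu>} \<and>
      card {b \<in> PiE {..<l} B. total_weight b = \<mu>} \<le> card P * N" for \<mu>
  proof -
    define \<kappa> where "\<kappa> c = (\<lambda>h\<in>H. \<mu> h - (\<Sum>i\<in>{..<l} - {j}. wt i (c i) h))" for c
    define S where "S = Sigma P (\<lambda>c. {x \<in> B j. wt j x = \<kappa> c})"
    define r where "r b = (restrict b ({..<l} - {j}), b j)" for b :: "nat \<Rightarrow> 'w"
    have fS: "finite S" unfolding S_def using P N(1) by (intro finite_SigmaI)
    have "card S = (\<Sum>c\<in>P. card {x \<in> B j. wt j x = \<kappa> c})"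
      unfolding S_def using P N(1) by (intro card_SigmaI) auto
    also have "\<dots> \<le> (\<Sum>c\<in>P. N)" by (rule sum_mono) (rule N(2))
    finally have cS: "card S \<le> card P * N" by simp
    have inj: "inj_on r {b \<in> PiE {..<l} B. total_weight b = \<mu>}"
    proof (rule inj_onI)
      fix b b' assume b: "b \<in> {b \<in> PiE {..<l} B. total_weight b = \<mu>}"
        "b' \<in> {b \<in> PiE {..<l} B. total_weight b = \<mu>}" and eq: "r b = r b'"
      have r: "restrict b ({..<l} - {j}) = restrict b' ({..<l} - {j})" "b j = b' j"
        using eq unfolding r_def prod.inject by blast+
      have "b i = b' i" if "i \<in> {..<l}" for i
        using fun_cong[OF r(1), of i] r(2) that by (cases "i = j") (simp_all add: restrict_def)
      moreover have "b \<in> PiE {..<l} B" "b' \<in> PiE {..<l} B" using b by blast+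
      ultimately show "b = b'" by (intro PiE_ext)
    qed
    have sub: "r ` {b \<in> PiE {..<l} B. total_weight b = \<mu>} \<subseteq> S"
    proof
      fix p assume "p \<in> r ` {b \<in> PiE {..<l} B. total_weight b = \<mu>}"
      then obtain b where b: "b \<in> PiE {..<l} B" "total_weight b = \<mu>" and p: "p = r b" by blast
      have bj: "b j \<in> B j" using b j by auto
      have bP: "restrict b ({..<l} - {j}) \<in> P" unfolding P_def using b by auto
      have "wt j (b j) = \<kappa> (restrict b ({..<l} - {j}))"
      proof (rule extensionalityI[OF wt_extensional[OF j bj]])
        show "\<kappa> (restrict b ({..<l} - {j})) \<in> extensional H" by (simp add: \<kappa>_def)
        fix h assume h: "h \<in> H"
        have "\<mu> h = wt j (b j) h + (\<Sum>i\<in>{..<l} - {j}. wt i (b i) h)"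
          using total_weight_upd[OF j, of b "b j"] b(2) h by auto
        moreover have "(\<Sum>i\<in>{..<l} - {j}. wt i (restrict b ({..<l} - {j}) i) h) =
            (\<Sum>i\<in>{..<l} - {j}. wt i (b i) h)" by (rule sum.cong) auto
        ultimately show "wt j (b j) h = \<kappa> (restrict b ({..<l} - {j})) h"
          unfolding \<kappa>_def using h by simp
      qed
      then show "p \<in> S" unfolding p r_def S_def using bj bP by blast
    qed
    have "finite {b \<in> PiE {..<l} B. total_weight b = \<mu>}"
      using inj finite_subset[OF sub fS] by (rule finite_imageD[rotated])
    moreover have "card {b \<in> PiE {..<l} B. total_weight b = \<mu>} \<le> card S"
      using inj sub fS by (rule card_inj_on_le)
    ultimately show ?thesis using cS by simp
  qed
  then show ?thesis unfolding bounded_fibres_def by blast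
next
  case False
  \<comment> \<open>For l > 0 a suitable index exists: that of the one infinite factor, or 0 if
    there is none.\<close>
  have "l = 0"
  proof (rule ccontr)
    assume l: "l \<noteq> 0"
    let ?I = "{i. i < l \<and> infinite (B i)}"
    have I: "finite ?I" by simp
    obtain j where j: "j < l" "?I \<subseteq> {j}"
    proof (cases "?I = {}")
      case True
      have "?I \<subseteq> {0}" unfolding True by simp
      moreover have "0 < l" using l by simp
      ultimately show ?thesis using that[of 0] by blast
    next
      case False
      then obtain j where "j \<in> ?I" by blast
      moreover have "i = j" if "i \<in> ?I" for i
        using card_le_Suc0_iff_eq[OF I] inf that \<open>j \<in> ?I\<close> by simp
      ultimately show ?thesis using that[of j] by blast
    qed
    then show False using False by blast
  qed
  then have "PiE {..<l} B = {\<lambda>x. undefined}" by simp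
  then have "finite {b \<in> PiE {..<l} B. total_weight b = \<mu>}"
      "card {b \<in> PiE {..<l} B. total_weight b = \<mu>} \<le> card {\<lambda>x :: nat. undefined :: 'w}" for \<mu>
    by (simp, intro card_mono) auto
  then show ?thesis unfolding bounded_fibres_def by blast
qed

text \<open>Freezing the other entries of \<open>b\<close> embeds each fibre of \<open>wt i\<close>
  in one fibre of \<open>total_weight\<close>.\<close>

lemma bounded_factor:
  assumes bounded: "bounded_fibres total_weight (PiE {..<l} B)" and b: "b \<in> PiE {..<l} B" and i: "i < l"
  shows "bounded_fibres (wt i) (B i)"
proof -
  obtain N where N: "\<And>\<mu>. finite {b \<in> PiE {..<l} B. total_weight b = \<mu>}"
      "\<And>\<mu>. card {b \<in> PiE {..<l} B. total_weight b = \<mu>} \<le> N"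
    using bounded unfolding bounded_fibres_def by blast
  have "finite {x \<in> B i. wt i x = \<mu>} \<and> card {x \<in> B i. wt i x = \<mu>} \<le> N" for \<mu>
  proof -
    define \<rho> where "\<rho> = (\<lambda>h\<in>H. \<mu> h + (\<Sum>k\<in>{..<l} - {i}. wt k (b k) h))"
    define r where "r x = b(i := x)" for x
    have inj: "inj_on r {x \<in> B i. wt i x = \<mu>}" unfolding r_def by (rule inj_onI) (metis fun_upd_same)
    have sub: "r ` {x \<in> B i. wt i x = \<mu>} \<subseteq> {b \<in> PiE {..<l} B. total_weight b = \<rho>}"
      unfolding r_def \<rho>_def using upd_PiE_B[OF b i] total_weight_upd[OF i, of b] by auto
    have "finite {x \<in> B i. wt i x = \<mu>}"
      using inj finite_subset[OF sub N(1)] by (rule finite_imageD[rotated])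
    moreover have "card {x \<in> B i. wt i x = \<mu>} \<le> N"
      using card_inj_on_le[OF inj sub N(1)] N(2)[of \<rho>] by linarith
    ultimately show ?thesis ..
  qed
  then show ?thesis unfolding bounded_fibres_def by blast
qed

lemma unbounded_of_strings:
  assumes b: "b \<in> PiE {..<l} B" and ij: "i < l" "j < l" "i \<noteq> j"
    and x: "\<And>k. x k \<in> B i" "\<And>k h. h \<in> H \<Longrightarrow> wt i (x k) h = \<mu> h + of_nat k * \<alpha> h"
    and y: "\<And>k. y k \<in> B j" "\<And>k h. h \<in> H \<Longrightarrow> wt j (y k) h = \<nu> h + of_nat k * (s * \<alpha> h)"
    and s: "s \<in> {1, - 1}" and char_0: "inj (of_nat :: nat \<Rightarrow> 'k)" and h0: "h0 \<in> H" "\<alpha> h0 \<noteq> 0"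
  shows "\<not> bounded_fibres total_weight (PiE {..<l} B)"
proof
  assume "bounded_fibres total_weight (PiE {..<l} B)"
  then obtain N where N: "\<And>\<mu>. finite {b \<in> PiE {..<l} B. total_weight b = \<mu>}"
      "\<And>\<mu>. card {b \<in> PiE {..<l} B. total_weight b = \<mu>} \<le> N"
    unfolding bounded_fibres_def by blast
  \<comment> \<open>For strings of equal direction the second is traversed backwards from
    \<open>N\<close>, for opposite directions both run forwards. The shifts then add up to the
    constant \<open>D\<close>, so \<open>N\<close> + 1 tuples share one weight.\<close>
  define q where "q k = (if s = 1 then N - k else k)" for k
  define p where "p k = b(i := x k, j := y (q k))" for k
  define D where "D h = (if s = 1 then of_nat N * \<alpha> h else 0)" for h
  define \<rho> where "\<rho> = (\<lambda>h\<in>H. \<mu> h + \<nu> h + D h + (\<Sum>k\<in>{..<l} - {j} - {i}. wt k (b k) h))"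
  have pP: "p k \<in> PiE {..<l} B" for k
    unfolding p_def using ij x(1) y(1) by (intro upd_PiE_B b)
  have tw: "total_weight (p k) = \<rho>" if k: "k \<le> N" for k
  proof -
    have "(\<Sum>m\<in>{..<l} - {j}. wt m ((b(i := x k)) m) h) =
        wt i (x k) h + (\<Sum>m\<in>{..<l} - {j} - {i}. wt m (b m) h)" for h
    proof -
      have "(\<Sum>m\<in>{..<l} - {j} - {i}. wt m ((b(i := x k)) m) h) =
          (\<Sum>m\<in>{..<l} - {j} - {i}. wt m (b m) h)" by (rule sum.cong) auto
      then show ?thesis using ij by (subst sum.remove[of _ i]) auto
    qed
    moreover have "of_nat (q k) * (s * \<alpha> h) + of_nat k * \<alpha> h = D h" for h
      using s k by (auto simp: q_def D_def of_nat_diff algebra_simps)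
    then have "wt j (y (q k)) h + wt i (x k) h = \<mu> h + \<nu> h + D h" if "h \<in> H" for h
      using x(2)[OF that] y(2)[OF that] by (metis (no_types, lifting) add.assoc add.commute)
    ultimately show ?thesis
      unfolding p_def total_weight_upd[OF ij(2)] \<rho>_def by (intro restrict_ext) (simp add: add.assoc[symmetric])
  qed
  have inj: "inj_on p {..N}"
  proof (rule inj_onI)
    fix k k' assume "p k = p k'"
    then have "p k i = p k' i" by simp
    then have "x k = x k'" using ij by (simp add: p_def)
    then have "\<mu> h0 + of_nat k * \<alpha> h0 = \<mu> h0 + of_nat k' * \<alpha> h0" using x(2)[OF h0(1)] by metis
    then have "of_nat k * \<alpha> h0 = of_nat k' * \<alpha> h0" by (simp only: add_left_cancel)
    then have "(of_nat k :: 'k) = of_nat k'" unfolding mult_right_cancel[OF h0(2)] .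
    with char_0 show "k = k'" by (rule injD)
  qed
  have sub: "p ` {..N} \<subseteq> {b \<in> PiE {..<l} B. total_weight b = \<rho>}" using pP tw by blast
  have "card {..N} \<le> card {b \<in> PiE {..<l} B. total_weight b = \<rho>}"
    using inj sub N(1) by (rule card_inj_on_le)
  then show False using N(2)[of \<rho>] by simp
qed

end

section \<open>Evaluation weight modules\<close>

context map_algebra
begin

text \<open>If c differed from 1, then (1 - c) times the unit element would be an invertible element
  of \<open>M\<close>. Weights involve only h \<otimes> 1, so this is the residue that
  matters.\<close>

lemma residue_one:
  assumes "maximal_ideal M"
  shows "residue_at scs M 1 = 1"
  unfolding residue_at_def
proof (rule the_equality)
  interpret id: module "(*) :: 's \<Rightarrow> 's \<Rightarrow> 's" by unfold_locales (simp_all add: algebra_simps)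
  have M: "id.subspace M" "M \<noteq> UNIV" using assms by (simp_all add: maximal_ideal_def)
  show "1 - scs 1 1 \<in> M" using id.subspace_0[OF M(1)] by simp
  fix c assume c: "1 - scs c 1 \<in> M"
  show "c = 1"
  proof (rule ccontr)
    assume "c \<noteq> 1"
    then have "scs (inverse (1 - c)) (1 - scs c 1) = 1"
      by (simp add: S.scale_right_diff_distrib S.scale_left_diff_distrib[symmetric] field_simps)
    moreover have "scs (inverse (1 - c)) (1 - scs c 1) = scs (inverse (1 - c)) 1 * (1 - scs c 1)"
      using S.scale_mult[of "inverse (1 - c)" 1 "1 - scs c 1"] by simp
    ultimately have "scs (inverse (1 - c)) 1 * (1 - scs c 1) = 1" by simp
    then have "1 \<in> M" using id.subspace_scale[OF M(1) c, of "scs (inverse (1 - c)) 1"] by simp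
    then have "x \<in> M" for x using id.subspace_scale[OF M(1), of 1 x] by simp
    then show False using M(2) by blast
  qed
qed

end

context evaluation_weight_module
begin

lemma act_one_pure:
  assumes "w \<in> PiE {..<l} W"
  shows "act (tens h 1) (\<tau> w) = (\<Sum>i<l. \<tau> (w(i := actW i h (w i))))"
  unfolding act_pure[OF assms] by (rule sum.cong) (simp_all add: residue_one maximal)

text \<open>For \<open>l = 0\<close> no assumption makes \<open>scw\<close> a vector space structure, hence the separate treatment.\<close>

lemma admissible_empty_product:
  assumes l: "l = 0" and H: "g.subspace H"
  shows "admissible scg H scv V (\<lambda>h. act (tens h 1))"
proof -
  let ?u = "\<lambda>_ :: nat. undefined :: 'w"
  have PiE: "PiE {..<l} W = {?u}" using l by simp
  have rel: "multilinear_relations scw l W = {}" using l by (simp add: multilinear_relations_def)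
  have "vector_space scv" by unfold_locales
  note single = free_extension_single[OF this]
  have T: "free_extension scv \<tau> ` {p. Poly_Mapping.keys p \<subseteq> {?u}} = V"
    "\<And>p. Poly_Mapping.keys p \<subseteq> {?u} \<Longrightarrow> free_extension scv \<tau> p = 0 \<longleftrightarrow> p \<in> Modules.module.span free_scale {}"
    using tensor_product_W unfolding is_tensor_product_def is_free_quotient_def PiE rel by blast+
  interpret f: vector_space "free_scale :: 'k \<Rightarrow> ((nat \<Rightarrow> 'w) \<Rightarrow>\<^sub>0 'k) \<Rightarrow> _" by (rule vector_space_free_scale)
  \<comment> \<open>There are no relations here, so the tensor product is the free space on the
    single empty tuple.\<close>
  have "\<tau> ?u \<noteq> 0"
  proof
    assume "\<tau> ?u = 0"
    then have "free_extension scv \<tau> (Poly_Mapping.single ?u 1) = 0" by (simp add: single)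
    then have "Poly_Mapping.single ?u (1 :: 'k) \<in> f.span {}" using T(2)[of "Poly_Mapping.single ?u 1"] by simp
    then have "Poly_Mapping.lookup (Poly_Mapping.single ?u (1 :: 'k)) ?u = 0" by simp
    then show False by (simp only: lookup_single_eq one_neq_zero)
  qed
  have "V = module.span {\<tau> ?u}"
  proof
    show "V \<subseteq> module.span {\<tau> ?u}"
    proof
      fix v assume "v \<in> V"
      then obtain p where p: "Poly_Mapping.keys p \<subseteq> {?u}" "v = free_extension scv \<tau> p"
        using T(1) by blast
      show "v \<in> module.span {\<tau> ?u}" unfolding p(2) free_extension_def
        using p(1) by (intro module.span_sum module.span_scale module.span_base) blast
    qed
    have "\<tau> ?u \<in> V" unfolding T(1)[symmetric]
      by (intro image_eqI[of _ _ "Poly_Mapping.single ?u 1"]) (simp_all add: single)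
    then show "module.span {\<tau> ?u} \<subseteq> V" using subspace_V by (intro module.span_minimal) auto
  qed
  define \<mu> :: "'g \<Rightarrow> 'k" where "\<mu> = (\<lambda>h\<in>H. 0)"
  interpret wb: weight_basis scv scg H "\<lambda>h. act (tens h 1)" "{\<tau> ?u}" "\<lambda>_. \<mu>"
  proof unfold_locales
    show "module.independent {\<tau> ?u}" using \<open>\<tau> ?u \<noteq> 0\<close> by simp
    show "\<mu> \<in> dual_of scg H" using H by (auto simp: \<mu>_def dual_of_def g.subspace_add g.subspace_scale)
  next
    fix b h assume "b \<in> {\<tau> ?u}" "h \<in> H"
    then show "act (tens h 1) b = scv (\<mu> h) b"
      using act_one_pure[of ?u h] PiE l by (simp add: \<mu>_def)
  qed (use \<open>V = module.span {\<tau> ?u}\<close> act_add_right act_scale_right in auto)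
  have "bounded_fibres (\<lambda>_. \<mu>) {\<tau> ?u}"
    unfolding bounded_fibres_def
    by (intro exI[of _ 1] allI conjI card_mono[of "{\<tau> ?u}", simplified]) (auto intro: card_mono[of "{\<tau> ?u}", simplified])
  then show ?thesis using wb.admissible_iff_bounded_fibres \<open>V = module.span {\<tau> ?u}\<close> by simp
qed

lemma admissible_iff_total_weight:
  assumes l: "0 < l" and H: "g.subspace H"
    and B: "\<And>i. i < l \<Longrightarrow> weight_basis scw scg H (actW i) (B i) (wt i)"
    and span: "\<And>i. i < l \<Longrightarrow> Modules.module.span scw (B i) = W i"
  shows "admissible scg H scv V (\<lambda>h. act (tens h 1)) \<longleftrightarrow>
    bounded_fibres (weight_families.total_weight H l wt) (PiE {..<l} B)"
proof -
  interpret W0: simple_lie_module scg brg scw "W 0" "actW 0" using simple_W l by blast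
  have subW: "Modules.module.subspace scw (W i)" if "i < l" for i
  proof -
    interpret Wi: simple_lie_module scg brg scw "W i" "actW i" using simple_W that by blast
    show ?thesis by (rule Wi.subspace_V)
  qed
  interpret t: tensor_product_family scw scv l W V \<tau>
    by unfold_locales (use tensor_product_W subW in auto)
  have indep: "\<not> Modules.module.dependent scw (B i)" if "i < l" for i
    using B[OF that] by (rule weight_basis.independent_B)
  have dual: "wt i b \<in> dual_of scg H" if "i < l" "b \<in> B i" for i b
    using B[OF that(1)] that(2) by (rule weight_basis.wt_dual)
  interpret wf: weight_families H l B wt
    by unfold_locales (use dual in \<open>auto simp: dual_of_def\<close>)
  let ?P = "PiE {..<l} B"
  \<comment> \<open>Basis tensors inherit their weight through the inverse of \<open>\<tau>\<close>,
    which is injective on basis tuples.\<close>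
  define wtV where "wtV v = wf.total_weight (inv_into ?P \<tau> v)" for v
  have inj: "inj_on \<tau> ?P" by (rule t.inj_pure_basis[OF indep span])
  have wtV: "wtV (\<tau> b) = wf.total_weight b" if "b \<in> ?P" for b
    unfolding wtV_def using inv_into_f_f[OF inj that] by simp
  have V: "module.span (\<tau> ` ?P) = V" by (rule t.span_pure_basis[OF indep span])
  interpret wb: weight_basis scv scg H "\<lambda>h. act (tens h 1)" "\<tau> ` ?P" wtV
  proof unfold_locales
    show "module.independent (\<tau> ` ?P)" by (rule t.independent_pure_basis[OF indep span])
  next
    fix h v u assume "v \<in> module.span (\<tau> ` ?P)" "u \<in> module.span (\<tau> ` ?P)"
    then show "act (tens h 1) (v + u) = act (tens h 1) v + act (tens h 1) u"
      unfolding V by (rule act_add_right)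
  next
    fix h v c assume "v \<in> module.span (\<tau> ` ?P)"
    then show "act (tens h 1) (scv c v) = scv c (act (tens h 1) v)"
      unfolding V by (rule act_scale_right)
  next
    fix v assume "v \<in> \<tau> ` ?P"
    then obtain b where b: "b \<in> ?P" "v = \<tau> b" by blast
    have bi: "wt i (b i) \<in> dual_of scg H" if "i < l" for i using dual[OF that] b(1) that by auto
    have add: "wt i (b i) (x + y) = wt i (b i) x + wt i (b i) y" if "i < l" "x \<in> H" "y \<in> H" for i x y
      using bi[OF that(1)] that(2,3) by (simp add: dual_of_def)
    have scale: "wt i (b i) (scg c x) = c * wt i (b i) x" if "i < l" "x \<in> H" for i x c
      using bi[OF that(1)] that(2) by (simp add: dual_of_def)
    show "wtV v \<in> dual_of scg H"
      unfolding b(2) wtV[OF b(1)] wf.total_weight_def dual_of_def using H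
      by (simp add: g.subspace_add g.subspace_scale add scale sum.distrib sum_distrib_left)
  next
    fix v h assume "v \<in> \<tau> ` ?P" and h: "h \<in> H"
    then obtain b where b: "b \<in> ?P" "v = \<tau> b" by blast
    have bW: "b \<in> PiE {..<l} W" using t.PiE_B_subset[OF indep span] b(1) by blast
    have "act (tens h 1) (\<tau> b) = (\<Sum>i<l. \<tau> (b(i := actW i h (b i))))" by (rule act_one_pure[OF bW])
    also have "\<dots> = (\<Sum>i<l. scv (wt i (b i) h) (\<tau> b))"
    proof (rule sum.cong)
      fix i assume i: "i \<in> {..<l}"
      have "b i \<in> B i" "b i \<in> W i" using b(1) bW i by auto
      then have "actW i h (b i) = scw (wt i (b i) h) (b i)"
        using weight_basis.T_basis[OF B _ h] i by simp
      then show "\<tau> (b(i := actW i h (b i))) = scv (wt i (b i) h) (\<tau> b)"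
        using t.\<tau>_scale[OF bW _ \<open>b i \<in> W i\<close>, of "wt i (b i) h"] i by simp
    qed simp
    finally show "act (tens h 1) v = scv (wtV v h) v"
      unfolding b(2) wtV[OF b(1)] wf.total_weight_def using h by (simp add: module.scale_sum_left)
  qed
  show ?thesis
    using wb.admissible_iff_bounded_fibres bounded_fibres_image[where g = wtV and f = wf.total_weight, OF inj wtV] unfolding V by simp
qed

end

theorem theorem3p14:
  fixes scg :: "'k::{alg_closed_field, field_char_0} \<Rightarrow> 'g::ab_group_add \<Rightarrow> 'g"
    and brg :: "'g \<Rightarrow> 'g \<Rightarrow> 'g"
    and H :: "'g set"
    and scs :: "'k \<Rightarrow> 's::comm_ring_1 \<Rightarrow> 's"
    and scl :: "'k \<Rightarrow> 'l::ab_group_add \<Rightarrow> 'l"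
    and brl :: "'l \<Rightarrow> 'l \<Rightarrow> 'l"
    and tens :: "'g \<Rightarrow> 's \<Rightarrow> 'l"
    and scv :: "'k \<Rightarrow> 'v::ab_group_add \<Rightarrow> 'v"
    and V :: "'v set"
    and act :: "'l \<Rightarrow> 'v \<Rightarrow> 'v"
    and scw :: "'k \<Rightarrow> 'w::ab_group_add \<Rightarrow> 'w"
    and l :: nat
    and M :: "nat \<Rightarrow> 's set"
    and W :: "nat \<Rightarrow> 'w set"
    and actW :: "nat \<Rightarrow> 'g \<Rightarrow> 'w \<Rightarrow> 'w"
    and \<tau> :: "(nat \<Rightarrow> 'w) \<Rightarrow> 'v"
  assumes "simple_lie_algebra scg brg"
    and "fin_dim scg UNIV"
    and "lie_algebra.cartan_subalgebra scg brg H"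
    and "finite_type_algebra scs"
    and "map_algebra scg brg scs scl brl tens"
    and "evaluation_weight_module scg brg scs scl brl tens scv V act scw l M W actW \<tau> H"
    and "simple_lie_module scl brl scv V act"
  shows "admissible scg H scv V (\<lambda>h. act (tens h 1)) \<longleftrightarrow>
    (\<forall>i<l. admissible scg H scw (W i) (actW i)) \<and> card {i. i < l \<and> \<not> fin_dim scw (W i)} \<le> 1"
proof -
  interpret E: evaluation_weight_module scg brg scs scl brl tens scv V act scw l M W actW \<tau> H by fact
  have H: "E.g.subspace H"
    using assms(3) by (simp add: E.g.cartan_subalgebra_def E.g.lie_subalgebra_def)
  show ?thesis
  proof (cases "l = 0")
    case True
    then show ?thesis using E.admissible_empty_product[OF True H] by simp
  next
    case False
    then have l: "0 < l" by simp
    have "\<forall>i. \<exists>Bw. i < l \<longrightarrow> weight_basis scw scg H (actW i) (fst Bw) (snd Bw) \<and> module.span scw (fst Bw) = W i"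
    proof (intro allI)
      fix i
      show "\<exists>Bw. i < l \<longrightarrow> weight_basis scw scg H (actW i) (fst Bw) (snd Bw) \<and> module.span scw (fst Bw) = W i"
      proof (cases "i < l")
        case True
        interpret Wi: simple_lie_module scg brg scw "W i" "actW i" using E.simple_W True by blast
        have vs: "vector_space scw" by unfold_locales
        obtain B wt where "weight_basis scw scg H (actW i) B wt" "module.span scw B = W i"
          using weight_basis_exists[where T = "actW i", OF vs Wi.subspace_V Wi.act_add_right Wi.act_scale_right E.weight_W[OF True]]
          by blast
        then show ?thesis by (intro exI[of _ "(B, wt)"]) simp
      qed blast
    qed
    then obtain Bw where Bw: "\<forall>i. i < l \<longrightarrow> weight_basis scw scg H (actW i) (fst (Bw i)) (snd (Bw i)) \<and>
        module.span scw (fst (Bw i)) = W i"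
      by (rule choice[THEN exE])
    define B where "B i = fst (Bw i)" for i
    define wt where "wt i = snd (Bw i)" for i
    have wb: "weight_basis scw scg H (actW i) (B i) (wt i)" and span: "module.span scw (B i) = W i"
      if "i < l" for i using Bw that by (simp_all add: B_def wt_def)
    interpret wf: weight_families H l B wt
    proof
      fix i b assume "i < l" "b \<in> B i"
      then have "wt i b \<in> dual_of scg H" using weight_basis.wt_dual[OF wb] by blast
      then show "wt i b \<in> extensional H" by (simp add: dual_of_def)
    qed
    have adm: "admissible scg H scw (W i) (actW i) \<longleftrightarrow> bounded_fibres (wt i) (B i)"
      and fin: "fin_dim scw (W i) \<longleftrightarrow> finite (B i)" and ne: "B i \<noteq> {}" if "i < l" for i
    proof -
      interpret weight_basis scw scg H "actW i" "B i" "wt i" by (rule wb[OF that])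
      show "admissible scg H scw (W i) (actW i) \<longleftrightarrow> bounded_fibres (wt i) (B i)"
        using admissible_iff_bounded_fibres unfolding span[OF that] .
      show "fin_dim scw (W i) \<longleftrightarrow> finite (B i)"
        using fin_dim_span_iff[OF independent_B] unfolding span[OF that] .
      interpret Wi: simple_lie_module scg brg scw "W i" "actW i" using E.simple_W that by blast
      show "B i \<noteq> {}" using Wi.nonzero span[OF that] by auto
    qed
    \<comment> \<open>Turns strings of weight vectors into strings of basis vectors: every basis
      vector in the support of a weight vector has the same weight.\<close>
    have basis_vector: "\<exists>b\<in>B i. \<forall>h\<in>H. wt i b h = \<mu> h"
      if "i < l" "v \<in> W i" and v0: "v \<noteq> 0" and wv: "\<forall>h\<in>H. actW i h v = scw (\<mu> h) v" for i v \<mu>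
    proof -
      interpret weight_basis scw scg H "actW i" "B i" "wt i" by (rule wb[OF that(1)])
      have v: "v \<in> span (B i)" using that(2) span[OF that(1)] by simp
      have "\<exists>b. representation (B i) v b \<noteq> 0"
      proof (rule ccontr)
        assume "\<not> ?thesis"
        then have "{b. representation (B i) v b \<noteq> 0} = {}" by blast
        then have "v = 0" using sum_nonzero_representation_eq[OF independent_B v] by (simp only: sum.empty)
        then show False using v0 by contradiction
      qed
      then obtain b where b: "representation (B i) v b \<noteq> 0" ..
      then have "b \<in> B i" by (rule representation_ne_zero)
      moreover have "\<forall>h\<in>H. wt i b h = \<mu> h" using in_weight_space_iff[OF v, of \<mu>] wv b by blast
      ultimately show ?thesis by blast
    qed
    obtain b0 where b0: "b0 \<in> PiE {..<l} B" using ne by (metis PiE_eq_empty_iff ex_in_conv lessThan_iff)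
    have "bounded_fibres wf.total_weight (PiE {..<l} B) \<longleftrightarrow>
      (\<forall>i<l. bounded_fibres (wt i) (B i)) \<and> card {i. i < l \<and> infinite (B i)} \<le> 1"
    proof (intro iffI conjI allI impI)
      fix i assume "bounded_fibres wf.total_weight (PiE {..<l} B)" "i < l"
      then show "bounded_fibres (wt i) (B i)" using b0 by (intro wf.bounded_factor)
    next
      assume bounded: "bounded_fibres wf.total_weight (PiE {..<l} B)"
      show "card {i. i < l \<and> infinite (B i)} \<le> 1"
      proof (rule ccontr)
        assume "\<not> ?thesis"
        then have "\<not> (\<forall>i\<in>{i. i < l \<and> infinite (B i)}. \<forall>j\<in>{i. i < l \<and> infinite (B i)}. i = j)"
          by (subst card_le_Suc0_iff_eq[symmetric]) simp_all
        then obtain i j where ij: "i < l" "j < l" "i \<noteq> j" "infinite (B i)" "infinite (B j)" by blast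
        then have inf: "\<not> fin_dim scw (W i)" "\<not> fin_dim scw (W j)" using fin by simp_all
        obtain \<alpha> \<mu> \<nu> s where s: "s \<in> {1, - 1}" and \<alpha>: "\<exists>h\<in>H. \<alpha> h \<noteq> 0"
          and x: "\<And>k. \<exists>v\<in>W i. v \<noteq> 0 \<and> (\<forall>h\<in>H. actW i h v = scw (\<mu> h + of_nat k * \<alpha> h) v)"
          and y: "\<And>k. \<exists>v\<in>W j. v \<noteq> 0 \<and> (\<forall>h\<in>H. actW j h v = scw (\<nu> h + of_nat k * (s * \<alpha> h)) v)"
          using parallel_weight_strings[OF assms(1-3) E.simple_W[OF ij(1)] E.weight_W[OF ij(1)] inf(1)
              E.simple_W[OF ij(2)] E.weight_W[OF ij(2)] inf(2)] by blast
        have "\<exists>b. b \<in> B i \<and> (\<forall>h\<in>H. wt i b h = \<mu> h + of_nat k * \<alpha> h)" for k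
        proof -
          obtain v where v: "v \<in> W i" "v \<noteq> 0" "\<forall>h\<in>H. actW i h v = scw (\<mu> h + of_nat k * \<alpha> h) v"
            using x[of k] by blast
          show ?thesis using basis_vector[OF ij(1) v] by blast
        qed
        then have "\<forall>k. \<exists>b. b \<in> B i \<and> (\<forall>h\<in>H. wt i b h = \<mu> h + of_nat k * \<alpha> h)" by blast
        then obtain xs where xs: "\<forall>k. xs k \<in> B i \<and> (\<forall>h\<in>H. wt i (xs k) h = \<mu> h + of_nat k * \<alpha> h)"
          by (rule choice[THEN exE])
        have "\<exists>b. b \<in> B j \<and> (\<forall>h\<in>H. wt j b h = \<nu> h + of_nat k * (s * \<alpha> h))" for k
        proof -
          obtain v where v: "v \<in> W j" "v \<noteq> 0"
            "\<forall>h\<in>H. actW j h v = scw (\<nu> h + of_nat k * (s * \<alpha> h)) v"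
            using y[of k] by blast
          show ?thesis using basis_vector[OF ij(2) v] by blast
        qed
        then have "\<forall>k. \<exists>b. b \<in> B j \<and> (\<forall>h\<in>H. wt j b h = \<nu> h + of_nat k * (s * \<alpha> h))" by blast
        then obtain ys where ys: "\<forall>k. ys k \<in> B j \<and> (\<forall>h\<in>H. wt j (ys k) h = \<nu> h + of_nat k * (s * \<alpha> h))"
          by (rule choice[THEN exE])
        obtain h0 where h0: "h0 \<in> H" "\<alpha> h0 \<noteq> 0" using \<alpha> by blast
        have "\<not> bounded_fibres wf.total_weight (PiE {..<l} B)"
          by (rule wf.unbounded_of_strings[OF b0 ij(1-3), where x = xs and y = ys and \<mu> = \<mu> and \<nu> = \<nu>
                and \<alpha> = \<alpha> and s = s, OF _ _ _ _ s inj_of_nat h0]) (use xs ys in blast)+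
        then show False using bounded by contradiction
      qed
    next
      assume "(\<forall>i<l. bounded_fibres (wt i) (B i)) \<and> card {i. i < l \<and> infinite (B i)} \<le> 1"
      then show "bounded_fibres wf.total_weight (PiE {..<l} B)" by (intro wf.bounded_total_weight) blast+
    qed
    moreover have "{i. i < l \<and> \<not> fin_dim scw (W i)} = {i. i < l \<and> infinite (B i)}" using fin by blast
    moreover have "admissible scg H scv V (\<lambda>h. act (tens h 1)) \<longleftrightarrow>
        bounded_fibres wf.total_weight (PiE {..<l} B)"
      using l H wb span by (rule E.admissible_iff_total_weight)
    ultimately show ?thesis using adm by simp
  qed
qed

end
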